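(* Let $D:f=0$ be a reduced surface of degree $d$ in $\mathbb{P}^3$ which is not a cone and which is nearly free with exponents $1\leq d_1\leq d_2\leq d_3$, i.e. the minimal graded free resolution of the Milnor algebra $M(f)$ has the form $$0\to S(-d_3-d)\to S(-d_1-(d-1))\oplus S(-d_2-(d-1))\oplus S(-d_3-(d-1))^2\to S(-(d-1))^4\to S.$$ Then: (i) $d_1+d_2+d_3=d$, $mdr(f)=d_1$, $ct(f)=d_1+d-2$ and $st(f)=d+d_3-3$. (ii) The Hilbert polynomial is $P(M(f))(k)=ak+b$, where $a,b$ are given as follows. Put $d_1'=d_1$, $d_2'=d_2$, $d_3'=d_3-1$, let $s_1',s_2',s_3'$ be the elementary symmetric functions of $d_1',d_2',d_3'$ (of degrees $1,2,3$), and set $$a'=s_1'^2-s_2',\qquad b'=2a'-s_1'^3+\frac{3}{2}s_1's_2'-\frac{1}{2}s_3'.$$ Then $$a=a'-1,\qquad b=b'+d+d_3-3.$$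
   Context: $S=\mathbb{C}[x,y,z,w]$ with the standard grading; $f\in S$ is homogeneous of degree $d$; $J_f$ is the Jacobian ideal generated by the partial derivatives $f_x,f_y,f_z,f_w$; $M(f)=S/J_f$ is the graded Milnor algebra. $H(M(f))(k)=\dim_{\mathbb{C}} M(f)_k$ is its Hilbert function and $P(M(f))$ its Hilbert polynomial, i.e. the unique polynomial with $H(M(f))(k)=P(M(f))(k)$ for all large $k$. $D$ is a cone if, after a linear change of coordinates, $f$ does not depend on one of the variables. $AR(f)=\{(a_0,a_1,a_2,a_3)\in S^4: a_0f_x+a_1f_y+a_2f_z+a_3f_w=0\}$, graded by the degree of the components. A reduced surface that is not a cone is nearly free with exponents $d_1\le d_2\le d_3$ precisely when the minimal resolution of $M(f)$ has the form displayed in the claim. Invariants: - $st(f)=\min\{q: H(M(f))(k)=P(M(f))(k)\text{ for all }k\geq q\}$. - $ct(f)=\max\{q:\dim M(f)_k=\dim M(f_s)_k\text{ for all }k\leq q\}$, where $f_s\in S$ is any homogeneous polynomial of degree $d$ defining a smooth surface in $\mathbb{P}^3$. - $mdr(f)=\min\{q: H^3(K^*(f))_{q+3}\neq 0\}$, where $K^*(f)$ is the Koszul complex of $f_x,f_y,f_z,f_w$ with its natural grading; explicitly, $H^3(K^*(f))_{q+3}=AR(f)_q/KR(f)_q$, where $KR(f)\subset AR(f)$ is the submodule generated by the Koszul (trivial) relations $f_je_i-f_ie_j$. *)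

theory Defs
  imports
    "HOL-Analysis.Analysis"
    "HOL-Library.Poly_Mapping"
    "HOL-Computational_Algebra.Squarefree"
    "HOL-Algebra.QuotRing"
    "HOL-Algebra.Embedded_Algebras"
    "HOL-Algebra.Algebraic_Closure_Type"
begin

section \<open>The polynomial ring in four variables\<close>

text \<open>
  The variables are indexed by the four-element type \<^typ>\<open>4\<close>. A monomial is its exponent vector,
  and a polynomial is a finitely supported map from monomials to coefficients.
\<close>

type_synonym mpoly = "(4 \<Rightarrow>\<^sub>0 nat) \<Rightarrow>\<^sub>0 complex"

definition const :: "complex \<Rightarrow> mpoly" where
  "const c = Poly_Mapping.single 0 c"

definition var :: "4 \<Rightarrow> mpoly" where
  "var i = Poly_Mapping.single (Poly_Mapping.single i 1) 1"

definition mdeg :: "(4 \<Rightarrow>\<^sub>0 nat) \<Rightarrow> nat" where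
  "mdeg m = (\<Sum>i\<in>UNIV. Poly_Mapping.lookup m i)"

text \<open>The zero polynomial is homogeneous of every degree, so this is the graded piece of degree \<open>k\<close>.\<close>

definition homogeneous :: "nat \<Rightarrow> mpoly \<Rightarrow> bool" where
  "homogeneous k p \<longleftrightarrow> (\<forall>m\<in>Poly_Mapping.keys p. mdeg m = k)"

definition pd :: "4 \<Rightarrow> mpoly \<Rightarrow> mpoly" where
  "pd i p = (\<Sum>m\<in>Poly_Mapping.keys p. Poly_Mapping.single (m - Poly_Mapping.single i 1)
                            (of_nat (Poly_Mapping.lookup m i) * Poly_Mapping.lookup p m))"

text \<open>
  Evaluation along a ring homomorphism \<open>h\<close> on the coefficients: \<open>h = id\<close> evaluates at a point,
  \<open>h = const\<close> substitutes polynomials for the variables.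
\<close>

definition evaluate :: "(complex \<Rightarrow> 'a::comm_semiring_1) \<Rightarrow> (4 \<Rightarrow> 'a) \<Rightarrow> mpoly \<Rightarrow> 'a" where
  "evaluate h v p = (\<Sum>m\<in>Poly_Mapping.keys p.
     h (Poly_Mapping.lookup p m) * (\<Prod>i\<in>UNIV. v i ^ Poly_Mapping.lookup m i))"

definition linear_change :: "complex^4^4 \<Rightarrow> mpoly \<Rightarrow> mpoly" where
  "linear_change A p = evaluate const (\<lambda>i. \<Sum>j\<in>UNIV. const (A $ i $ j) * var j) p"

section \<open>Surfaces\<close>

definition is_cone :: "mpoly \<Rightarrow> bool" where
  "is_cone f \<longleftrightarrow> (\<exists>A::complex^4^4. invertible A \<and>
     (\<exists>i. \<forall>m\<in>Poly_Mapping.keys (linear_change A f). Poly_Mapping.lookup m i = 0))"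

definition smooth_surface :: "mpoly \<Rightarrow> bool" where
  "smooth_surface g \<longleftrightarrow> (\<forall>v::complex^4. v \<noteq> 0 \<longrightarrow> evaluate id (($) v) g = 0 \<longrightarrow>
     (\<exists>i. evaluate id (($) v) (pd i g) \<noteq> 0))"

section \<open>The Milnor algebra and its Hilbert function\<close>

abbreviation mpoly_ring :: "mpoly ring" where
  "mpoly_ring \<equiv> ring_of_type_algebra"

definition jacobian_ideal :: "mpoly \<Rightarrow> mpoly set" where
  "jacobian_ideal f = Idl\<^bsub>mpoly_ring\<^esub> (range (\<lambda>i. pd i f))"

definition milnor_algebra :: "mpoly \<Rightarrow> mpoly set ring" where
  "milnor_algebra f = mpoly_ring Quot (jacobian_ideal f)"

definition milnor_class :: "mpoly \<Rightarrow> mpoly \<Rightarrow> mpoly set" where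
  "milnor_class f p = jacobian_ideal f +>\<^bsub>mpoly_ring\<^esub> p"

definition milnor_piece :: "mpoly \<Rightarrow> nat \<Rightarrow> mpoly set set" where
  "milnor_piece f k = milnor_class f ` {p. homogeneous k p}"

text \<open>The dimension is taken over the image of the constants in the Milnor algebra.\<close>

definition hilbert_fun :: "mpoly \<Rightarrow> nat \<Rightarrow> nat" where
  "hilbert_fun f k = ring.dim (milnor_algebra f) (milnor_class f ` range const) (milnor_piece f k)"

definition hilbert_poly :: "mpoly \<Rightarrow> real poly" where
  "hilbert_poly f = (THE P. \<forall>\<^sub>F k in sequentially. real (hilbert_fun f k) = poly P (real k))"

definition st :: "mpoly \<Rightarrow> nat" where
  "st f = (LEAST q. \<forall>k\<ge>q. real (hilbert_fun f k) = poly (hilbert_poly f) (real k))"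

text \<open>Here \<open>g\<close> is the equation of a smooth surface of the same degree as \<open>f\<close>.\<close>

definition ct :: "mpoly \<Rightarrow> mpoly \<Rightarrow> nat" where
  "ct g f = (GREATEST q. \<forall>k\<le>q. hilbert_fun f k = hilbert_fun g k)"

section \<open>Jacobian syzygies\<close>

definition AR :: "mpoly \<Rightarrow> (mpoly^4) set" where
  "AR f = {a. (\<Sum>i\<in>UNIV. a $ i * pd i f) = 0}"

definition KR :: "mpoly \<Rightarrow> (mpoly^4) set" where
  "KR f = module.span (*s) {axis i (pd j f) - axis j (pd i f) | i j. True}"

definition homogeneous_vecs :: "nat \<Rightarrow> (mpoly^4) set" where
  "homogeneous_vecs q = {a. \<forall>i. homogeneous q (a $ i)}"

text \<open>As \<open>KR f \<subseteq> AR f\<close>, non-inclusion says that the degree \<open>q\<close> part of \<open>AR f / KR f\<close> is nonzero.\<close>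

definition mdr :: "mpoly \<Rightarrow> nat" where
  "mdr f = (LEAST q. \<not> AR f \<inter> homogeneous_vecs q \<subseteq> KR f \<inter> homogeneous_vecs q)"

section \<open>Minimal graded free resolutions\<close>

text \<open>
  The graded free module with basis indexed by \<open>'n\<close> and \<open>j\<close>-th summand \<open>S(-b\<^sub>j)\<close> is given by its
  vector of shifts \<open>b :: nat^'n\<close>; its \<open>j\<close>-th basis vector sits in degree \<open>b\<^sub>j\<close>. A degree-preserving
  map \<open>\<Oplus>\<^sub>j S(-b\<^sub>j) \<rightarrow> \<Oplus>\<^sub>i S(-a\<^sub>i)\<close> is a matrix whose entry \<open>(i, j)\<close> is homogeneous of degree
  \<open>b\<^sub>j - a\<^sub>i\<close>, hence zero if that is negative.
\<close>

definition graded_map :: "nat^'n \<Rightarrow> nat^'m \<Rightarrow> mpoly^'n^'m \<Rightarrow> bool" where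
  "graded_map b a A \<longleftrightarrow> (\<forall>i j. if a $ i \<le> b $ j then homogeneous (b $ j - a $ i) (A $ i $ j)
                                else A $ i $ j = 0)"

text \<open>Minimality: all entries lie in the ideal generated by the variables.\<close>

definition minimal_map :: "mpoly^'n^'m \<Rightarrow> bool" where
  "minimal_map A \<longleftrightarrow> (\<forall>i j. Poly_Mapping.lookup (A $ i $ j) 0 = 0)"

text \<open>
  \<open>0 \<rightarrow> \<Oplus>S(-c\<^sub>j) \<rightarrow> \<Oplus>S(-b\<^sub>j) \<rightarrow> \<Oplus>S(-a\<^sub>j) \<rightarrow> S\<close>, with maps \<open>C\<close>, \<open>B\<close>, \<open>A\<close>, is a minimal graded free
  resolution of the quotient of \<open>S\<close> by the homogeneous ideal \<open>I\<close>.
\<close>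

definition minimal_graded_free_resolution ::
  "mpoly set \<Rightarrow> nat^'n1 \<Rightarrow> nat^'n2 \<Rightarrow> nat^'n3 \<Rightarrow>
   mpoly^'n1^1 \<Rightarrow> mpoly^'n2^'n1 \<Rightarrow> mpoly^'n3^'n2 \<Rightarrow> bool" where
  "minimal_graded_free_resolution I a b c A B C \<longleftrightarrow>
     graded_map a (vec 0) A \<and> graded_map b a B \<and> graded_map c b C \<and>
     minimal_map A \<and> minimal_map B \<and> minimal_map C \<and>
     range ((*v) A) = {v. v $ 1 \<in> I} \<and>
     range ((*v) B) = {v. A *v v = 0} \<and>
     range ((*v) C) = {v. B *v v = 0} \<and>
     {v. C *v v = 0} = {0}"

text \<open>
  A non-cone has degree at least 1 (constants are cones), so \<open>d - 1\<close> is not truncated below.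
\<close>

definition nearly_free :: "nat \<Rightarrow> mpoly \<Rightarrow> nat \<Rightarrow> nat \<Rightarrow> nat \<Rightarrow> bool" where
  "nearly_free d f d1 d2 d3 \<longleftrightarrow>
     homogeneous d f \<and> squarefree f \<and> \<not> is_cone f \<and> d1 \<le> d2 \<and> d2 \<le> d3 \<and>
     (\<exists>A B C. minimal_graded_free_resolution (jacobian_ideal f)
        (vec (d - 1) :: nat^4)
        (vector [d1 + (d - 1), d2 + (d - 1), d3 + (d - 1), d3 + (d - 1)] :: nat^4)
        (vec (d3 + d) :: nat^1) A B C)"

end

theory Submission
  imports Defs
begin

text \<open>
  Write \<open>e = d - 1\<close>, \<open>S\<^sub>k\<close> for the forms of degree \<open>k\<close>, and \<open>h(n) = dim S\<^sub>n\<close>. Counting dimensions along the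
  resolution gives the Hilbert function of the Milnor algebra in every degree:
  \<open>H(k) = h(k) - 4 h(k - e) + h(k - e - d\<^sub>1) + h(k - e - d\<^sub>2) + 2 h(k - e - d\<^sub>3) - h(k - d - d\<^sub>3)\<close>
  (\<open>hilbert_fun_resolution\<close>). The function \<open>h(n)\<close> agrees with the polynomial
  \<open>(n + 1)(n + 2)(n + 3) / 6\<close> exactly for \<open>n \<ge> -3\<close>. The largest shift is \<open>d + d\<^sub>3\<close>, so \<open>H\<close> agrees with a
  polynomial from \<open>k = d + d\<^sub>3 - 3\<close> on and fails to do so at \<open>k = d + d\<^sub>3 - 4\<close>. This gives \<open>st\<close> and, once
  \<open>d\<^sub>1 + d\<^sub>2 + d\<^sub>3 = d\<close> is known, the coefficients of the Hilbert polynomial.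

  The relation \<open>d\<^sub>1 + d\<^sub>2 + d\<^sub>3 = d\<close> has two halves. The coefficient of \<open>k\<^sup>2\<close> in the polynomial is
  \<open>(d - d\<^sub>1 - d\<^sub>2 - d\<^sub>3) / 2\<close>, and it is nonnegative because \<open>H\<close> is. For the other inequality, which uses
  that \<open>f\<close> is reduced, let \<open>B\<close> be the \<open>4 \<times> 4\<close> matrix of the middle map. The kernel of \<open>B\<close> is spanned by one
  column \<open>C\<close>, so its adjugate factors as \<open>C r\<close> with a row \<open>r \<noteq> 0\<close> of forms of degree
  \<open>d\<^sub>1 + d\<^sub>2 + d\<^sub>3 - 1\<close>, and \<open>r\<close> is proportional to the gradient of \<open>f\<close>. With Euler's formula the form
  \<open>\<rho> = x r\<^sub>1 + y r\<^sub>2 + z r\<^sub>3 + w r\<^sub>4\<close> satisfies \<open>\<rho> f\<^sub>i = d f r\<^sub>i\<close>. Since \<open>f\<close> is squarefree, the logarithmic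
  derivatives \<open>f\<^sub>i / f\<close> together have a pole along every prime factor of \<open>f\<close>, so \<open>f\<close> divides \<open>\<rho>\<close>
  (\<open>squarefree_log_derivative\<close>), and comparing degrees gives \<open>d \<le> d\<^sub>1 + d\<^sub>2 + d\<^sub>3\<close>
  (\<open>syzygy_resolution_degree_le\<close>).

  For \<open>mdr\<close>: all syzygies of the gradient are combinations of the columns of \<open>B\<close>, the first of which has
  degree \<open>d\<^sub>1 < e\<close>, whereas the Koszul relations start in degree \<open>e\<close>.

  For \<open>ct\<close> the Hilbert function of a smooth surface \<open>g\<close> is needed in degrees \<open>k < 2 e\<close>. It equals
  \<open>h(k) - 4 h(k - e)\<close> there, because the partial derivatives of \<open>g\<close> have only Koszul relations: by the
  Nullstellensatz (\<open>weak_nullstellensatz\<close>) the Jacobian ideal contains powers \<open>x\<^sup>N, y\<^sup>N, z\<^sup>N, w\<^sup>N\<close>,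
  which form a regular sequence, and four elements whose ideal contains a regular sequence of length
  four have an acyclic Koszul complex (\<open>syzygy_components_in_ideal\<close>). Comparing the two Hilbert functions,
  the first difference is the syzygy of degree \<open>d\<^sub>1\<close>, in degree \<open>k = e + d\<^sub>1\<close>.
\<close>

section \<open>Monomials, homogeneous components and derivatives\<close>

abbreviation coef :: "mpoly \<Rightarrow> (4 \<Rightarrow>\<^sub>0 nat) \<Rightarrow> complex" where
  "coef \<equiv> Poly_Mapping.lookup"

abbreviation monomial :: "(4 \<Rightarrow>\<^sub>0 nat) \<Rightarrow> complex \<Rightarrow> mpoly" where
  "monomial \<equiv> Poly_Mapping.single"

lemma mpoly_as_sum: "(p::mpoly) = (\<Sum>m\<in>Poly_Mapping.keys p. monomial m (coef p m))"
proof (rule poly_mapping_eqI)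
  fix k
  have "coef (\<Sum>m\<in>Poly_Mapping.keys p. monomial m (coef p m)) k
      = (\<Sum>m\<in>Poly_Mapping.keys p. if m = k then coef p m else 0)"
    by (auto simp: lookup_sum lookup_single when_def intro!: sum.cong)
  also have "\<dots> = coef p k"
    by (simp add: sum.delta in_keys_iff)
  finally show "coef p k = coef (\<Sum>m\<in>Poly_Mapping.keys p. monomial m (coef p m)) k" ..
qed

lemma mpoly_induct [case_names monomial add]:
  assumes "\<And>m c. P (monomial m c)" and "\<And>p q. P p \<Longrightarrow> P q \<Longrightarrow> P (p + q)"
  shows "P (p::mpoly)"
proof -
  have "P (\<Sum>m\<in>A. monomial m (coef p m))" if "finite A" for A
    using that
  proof (induction A)
    case empty
    show ?case using assms(1)[of 0 0] by simp
  qed (auto intro: assms)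
  then show ?thesis by (subst mpoly_as_sum) auto
qed

text \<open>
  Every polynomial is a sum of monomials, so identities that are additive in a polynomial reduce to monomials.
\<close>

lemma additive_eqI:
  fixes F G :: "mpoly \<Rightarrow> 'a::ab_group_add"
  assumes "\<And>p q. F (p + q) = F p + F q" and "\<And>p q. G (p + q) = G p + G q"
    and "\<And>m c. F (monomial m c) = G (monomial m c)"
  shows "F p = G p"
  by (induction p rule: mpoly_induct) (simp_all add: assms)

lemma const_0 [simp]: "const 0 = 0" and const_1 [simp]: "const 1 = 1"
  by (simp_all add: const_def)

lemma const_add: "const (a + b) = const a + const b"
  by (simp add: const_def single_add)

lemma const_uminus: "const (- a) = - const a"
  by (simp add: const_def single_uminus)

lemma const_diff: "const (a - b) = const a - const b"
  by (simp add: const_def single_diff)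

lemma const_mult: "const (a * b) = const a * const b"
  by (simp add: const_def mult_single)

lemma const_of_nat: "const (of_nat n) = of_nat n"
  by (simp add: const_def)

lemma const_sum: "const (sum g A) = (\<Sum>i\<in>A. const (g i))"
  by (induction A rule: infinite_finite_induct) (simp_all add: const_add)

lemma const_eq_0_iff [simp]: "const c = 0 \<longleftrightarrow> c = 0"
  by (metis const_0 const_def inj_single[THEN injD])

lemma const_mult_monomial: "const c * monomial m a = monomial m (c * a)"
  by (simp add: const_def mult_single)

lemma coef_const_mult [simp]: "coef (const c * p) m = c * coef p m"
  by (rule additive_eqI[where F = "\<lambda>p. coef (const c * p) m"])
     (simp_all add: const_mult_monomial lookup_add algebra_simps lookup_single when_def)

lemma coef_const: "coef (const c) m = (if m = 0 then c else 0)"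
  by (simp add: const_def lookup_single when_def)

lemma mdeg_0 [simp]: "mdeg 0 = 0"
  by (simp add: mdeg_def)

lemma mdeg_add: "mdeg (m + n) = mdeg m + mdeg n"
  by (simp add: mdeg_def lookup_add sum.distrib)

lemma mdeg_single [simp]: "mdeg (Poly_Mapping.single i k) = k"
proof -
  have "mdeg (Poly_Mapping.single i k) = (\<Sum>j\<in>UNIV. if i = j then k else 0)"
    unfolding mdeg_def by (intro sum.cong) (auto simp: lookup_single when_def)
  then show ?thesis by simp
qed

lemma mdeg_eq_0_iff [simp]: "mdeg m = 0 \<longleftrightarrow> m = 0"
proof
  assume "mdeg m = 0"
  then show "m = 0" by (intro poly_mapping_eqI) (simp add: mdeg_def)
qed simp

lemma single_plus_minus:
  "Poly_Mapping.lookup m i \<noteq> 0 \<Longrightarrow> Poly_Mapping.single i 1 + (m - Poly_Mapping.single i 1) = (m :: 4 \<Rightarrow>\<^sub>0 nat)"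
  by (rule poly_mapping_eqI) (auto simp: lookup_add lookup_minus lookup_single when_def)

lemma homogeneous_iff: "homogeneous k p \<longleftrightarrow> (\<forall>m. coef p m \<noteq> 0 \<longrightarrow> mdeg m = k)"
  by (auto simp: homogeneous_def in_keys_iff)

lemma homogeneous_0 [simp]: "homogeneous k 0"
  by (simp add: homogeneous_def)

lemma homogeneous_add: "homogeneous k p \<Longrightarrow> homogeneous k q \<Longrightarrow> homogeneous k (p + q)"
  unfolding homogeneous_iff lookup_add by (metis add.right_neutral)

lemma homogeneous_diff: "homogeneous k p \<Longrightarrow> homogeneous k q \<Longrightarrow> homogeneous k (p - q)"
  unfolding homogeneous_iff lookup_minus by (metis diff_zero)

lemma homogeneous_uminus: "homogeneous k p \<Longrightarrow> homogeneous k (- p)"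
  by (simp add: homogeneous_iff)

lemma homogeneous_sum: "(\<And>i. i \<in> A \<Longrightarrow> homogeneous k (g i)) \<Longrightarrow> homogeneous k (sum g A)"
  by (induction A rule: infinite_finite_induct) (auto intro: homogeneous_add)

lemma homogeneous_mult:
  assumes "homogeneous k p" and "homogeneous l q"
  shows "homogeneous (k + l) (p * q)"
  unfolding homogeneous_def
proof
  fix m assume "m \<in> Poly_Mapping.keys (p * q)"
  then obtain a b where "m = a + b" "a \<in> Poly_Mapping.keys p" "b \<in> Poly_Mapping.keys q"
    using keys_mult[of p q] by auto
  with assms show "mdeg m = k + l" by (simp add: homogeneous_def mdeg_add)
qed

lemma homogeneous_monomial: "mdeg m = k \<Longrightarrow> homogeneous k (monomial m c)"
  by (auto simp: homogeneous_def split: if_splits)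

lemma homogeneous_const: "homogeneous 0 (const c)"
  unfolding const_def by (rule homogeneous_monomial) simp

lemma homogeneous_1: "homogeneous 0 1"
  using homogeneous_const[of 1] by simp

lemma homogeneous_prod:
  assumes "finite A" and "\<And>i. i \<in> A \<Longrightarrow> homogeneous (k i) (g i)"
  shows "homogeneous (sum k A) (prod g A)"
  using assms
proof (induction A rule: finite_induct)
  case (insert x A)
  then show ?case
    using homogeneous_mult[of "k x" "g x" "sum k A" "prod g A"] by simp
qed (simp add: homogeneous_1)

lemma homogeneous_const_mult: "homogeneous k p \<Longrightarrow> homogeneous k (const c * p)"
  by (simp add: homogeneous_iff)

lemma homogeneous_var: "homogeneous 1 (var i)"
  unfolding var_def by (rule homogeneous_monomial) simp

lemma homogeneous_0_eq_const: "homogeneous 0 p \<Longrightarrow> p = const (coef p 0)"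
  by (intro poly_mapping_eqI) (auto simp: homogeneous_iff coef_const)

text \<open>
  The sum of the terms of a polynomial whose exponent vector satisfies \<open>Q\<close>. The homogeneous components are
  the case of a degree condition; other choices split a polynomial along a monomial ideal.
\<close>

definition part :: "((4 \<Rightarrow>\<^sub>0 nat) \<Rightarrow> bool) \<Rightarrow> mpoly \<Rightarrow> mpoly" where
  "part Q p = (\<Sum>m | m \<in> Poly_Mapping.keys p \<and> Q m. monomial m (coef p m))"

lemma coef_part: "coef (part Q p) m = (if Q m then coef p m else 0)"
proof -
  have "coef (part Q p) m = (\<Sum>n | n \<in> Poly_Mapping.keys p \<and> Q n. if n = m then coef p n else 0)"
    by (auto simp: part_def lookup_sum lookup_single when_def intro!: sum.cong)
  also have "\<dots> = (if Q m then coef p m else 0)"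
    by (simp add: sum.delta in_keys_iff)
  finally show ?thesis .
qed

abbreviation hcomp :: "nat \<Rightarrow> mpoly \<Rightarrow> mpoly" where
  "hcomp k \<equiv> part (\<lambda>m. mdeg m = k)"

lemma part_add: "part Q (p + q) = part Q p + part Q q"
  by (rule poly_mapping_eqI) (simp add: coef_part lookup_add)

lemma part_diff: "part Q (p - q) = part Q p - part Q q"
  by (rule poly_mapping_eqI) (simp add: coef_part lookup_minus)

lemma part_0 [simp]: "part Q 0 = 0"
  by (rule poly_mapping_eqI) (simp add: coef_part)

lemma part_sum: "part Q (sum g A) = (\<Sum>i\<in>A. part Q (g i))"
  by (induction A rule: infinite_finite_induct) (auto simp: part_add)

lemma part_compl: "part Q p + part (\<lambda>m. \<not> Q m) p = p"
  by (rule poly_mapping_eqI) (simp add: coef_part lookup_add)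

lemma homogeneous_hcomp: "homogeneous k (hcomp k p)"
  by (simp add: homogeneous_iff coef_part)

lemma hcomp_homogeneous: "homogeneous k p \<Longrightarrow> hcomp l p = (if k = l then p else 0)"
  by (rule poly_mapping_eqI) (auto simp: coef_part homogeneous_iff)

lemma hcomp_0: "hcomp 0 p = const (coef p 0)"
  by (rule poly_mapping_eqI) (auto simp: coef_part coef_const)

text \<open>
  Multiplication by a form of degree \<open>e\<close> shifts homogeneous components by \<open>e\<close>.
\<close>

lemma hcomp_mult:
  assumes "homogeneous e g"
  shows "hcomp k (a * g) = (if k < e then 0 else hcomp (k - e) a * g)"
proof (rule additive_eqI[where F = "\<lambda>a. hcomp k (a * g)"])
  fix m c
  have "homogeneous (mdeg m + e) (monomial m c * g)"
    by (intro homogeneous_mult homogeneous_monomial assms refl)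
  moreover have "homogeneous (mdeg m) (monomial m c)" by (rule homogeneous_monomial) simp
  ultimately show "hcomp k (monomial m c * g) =
      (if k < e then 0 else hcomp (k - e) (monomial m c) * g)"
    by (auto simp: hcomp_homogeneous)
qed (auto simp: part_add algebra_simps)

lemma hcomp_large: "\<exists>N. \<forall>k\<ge>N. hcomp k p = 0"
proof (intro exI allI impI)
  fix k assume k: "Suc (sum mdeg (Poly_Mapping.keys p)) \<le> k"
  have "mdeg m < k" if "m \<in> Poly_Mapping.keys p" for m
    using member_le_sum[OF that, of mdeg] k by simp
  then show "hcomp k p = 0"
    by (intro poly_mapping_eqI) (auto simp: coef_part in_keys_iff)
qed

lemma pd_monomial: "pd i (monomial m c) = monomial (m - Poly_Mapping.single i 1) (of_nat (Poly_Mapping.lookup m i) * c)"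
  by (cases "c = 0") (simp_all add: pd_def)

lemma pd_add: "pd i (p + q) = pd i p + pd i q"
  unfolding pd_def
  by (rule setsum_keys_plus_distrib) (simp_all add: algebra_simps single_add)

lemma pd_0 [simp]: "pd i 0 = 0"
  by (simp add: pd_def)

text \<open>
  Both sides are biadditive, so the product rule only has to be checked on two monomials.
\<close>

lemma pd_mult: "pd i (p * q) = pd i p * q + p * pd i q"
proof (rule additive_eqI[where F = "\<lambda>p. pd i (p * q)"])
  fix m c
  show "pd i (monomial m c * q) = pd i (monomial m c) * q + monomial m c * pd i q"
  proof (rule additive_eqI[where F = "\<lambda>q. pd i (monomial m c * q)"])
    fix n b
    have *: "monomial (m - Poly_Mapping.single i 1 + n) (of_nat (Poly_Mapping.lookup m i) * x)
        = monomial (m + n - Poly_Mapping.single i 1) (of_nat (Poly_Mapping.lookup m i) * x)" for m n x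
    proof (cases "Poly_Mapping.lookup m i = 0")
      case False
      then have "m - Poly_Mapping.single i 1 + n = m + n - Poly_Mapping.single i 1"
        by (intro poly_mapping_eqI) (auto simp: lookup_add lookup_minus lookup_single when_def)
      then show ?thesis by simp
    qed simp
    show "pd i (monomial m c * monomial n b) =
        pd i (monomial m c) * monomial n b + monomial m c * pd i (monomial n b)"
      using *[of m n "c * b"] *[of n m "c * b"]
      by (simp add: pd_monomial mult_single lookup_add algebra_simps single_add)
  qed (simp_all add: pd_add algebra_simps)
qed (simp_all add: pd_add algebra_simps)

lemma homogeneous_pd:
  assumes "homogeneous d p" shows "homogeneous (d - 1) (pd i p)"
  unfolding pd_def
proof (rule homogeneous_sum)
  fix m assume m: "m \<in> Poly_Mapping.keys p"
  show "homogeneous (d - 1) (monomial (m - Poly_Mapping.single i 1) (of_nat (Poly_Mapping.lookup m i) * coef p m))"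
  proof (cases "Poly_Mapping.lookup m i = 0")
    case False
    have "mdeg m = 1 + mdeg (m - Poly_Mapping.single i 1)"
      by (subst single_plus_minus[OF False, symmetric]) (simp only: mdeg_add mdeg_single)
    with m assms show ?thesis by (intro homogeneous_monomial) (auto simp: homogeneous_def)
  qed simp
qed

lemma euler:
  assumes "homogeneous d p"
  shows "(\<Sum>i\<in>UNIV. var i * pd i p) = of_nat d * p"
proof -
  have mono: "(\<Sum>i\<in>UNIV. var i * pd i (monomial m c)) = of_nat (mdeg m) * monomial m c" for m c
  proof -
    have "var i * pd i (monomial m c) = of_nat (Poly_Mapping.lookup m i) * monomial m c" for i
    proof (cases "Poly_Mapping.lookup m i = 0")
      case False
      then show ?thesis
        using single_plus_minus[OF False]
        by (simp add: pd_monomial var_def mult_single flip: single_of_nat)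
    qed (simp add: pd_monomial)
    then show ?thesis
      by (simp add: mdeg_def sum_distrib_right)
  qed
  have sum: "(\<Sum>i\<in>UNIV. var i * pd i (sum g A)) = (\<Sum>a\<in>A. \<Sum>i\<in>UNIV. var i * pd i (g a))"
    for g and A :: "(4 \<Rightarrow>\<^sub>0 nat) set"
    by (induction A rule: infinite_finite_induct) (simp_all add: pd_add algebra_simps sum.distrib)
  have "(\<Sum>i\<in>UNIV. var i * pd i p) =
      (\<Sum>i\<in>UNIV. var i * pd i (\<Sum>m\<in>Poly_Mapping.keys p. monomial m (coef p m)))"
    using mpoly_as_sum[of p] by simp
  also have "\<dots> = (\<Sum>m\<in>Poly_Mapping.keys p. of_nat (mdeg m) * monomial m (coef p m))"
    by (simp only: sum mono)
  also have "\<dots> = (\<Sum>m\<in>Poly_Mapping.keys p. of_nat d * monomial m (coef p m))"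
    using assms by (intro sum.cong) (auto simp: homogeneous_def)
  also have "\<dots> = of_nat d * p"
    using mpoly_as_sum[of p] by (simp flip: sum_distrib_left)
  finally show ?thesis .
qed

definition eval_at :: "(4 \<Rightarrow> complex) \<Rightarrow> mpoly \<Rightarrow> complex" where
  "eval_at v p = (\<Sum>m\<in>Poly_Mapping.keys p. coef p m * (\<Prod>i\<in>UNIV. v i ^ Poly_Mapping.lookup m i))"

lemma evaluate_id: "evaluate id v p = eval_at v p"
  by (simp add: evaluate_def eval_at_def)

lemma eval_at_add: "eval_at v (p + q) = eval_at v p + eval_at v q"
  unfolding eval_at_def
  by (rule setsum_keys_plus_distrib) (simp_all add: algebra_simps)

lemma eval_at_0 [simp]: "eval_at v 0 = 0"
  by (simp add: eval_at_def)

lemma eval_at_monomial: "eval_at v (monomial m c) = c * (\<Prod>i\<in>UNIV. v i ^ Poly_Mapping.lookup m i)"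
  by (cases "c = 0") (simp_all add: eval_at_def)

lemma eval_at_mult: "eval_at v (p * q) = eval_at v p * eval_at v q"
proof (rule additive_eqI[where F = "\<lambda>p. eval_at v (p * q)"])
  fix m c
  show "eval_at v (monomial m c * q) = eval_at v (monomial m c) * eval_at v q"
    by (rule additive_eqI[where F = "\<lambda>q. eval_at v (monomial m c * q)"])
       (simp_all add: eval_at_add algebra_simps mult_single eval_at_monomial lookup_add power_add prod.distrib)
qed (simp_all add: eval_at_add algebra_simps)

lemma eval_at_sum: "eval_at v (sum g A) = (\<Sum>i\<in>A. eval_at v (g i))"
  by (induction A rule: infinite_finite_induct) (auto simp: eval_at_add)

lemma eval_at_const [simp]: "eval_at v (const c) = c"
  by (simp add: const_def eval_at_monomial)

lemma eval_at_var [simp]: "eval_at v (var i) = v i"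
proof -
  have "(\<Prod>j\<in>UNIV. v j ^ Poly_Mapping.lookup (Poly_Mapping.single i 1) j) = (\<Prod>j\<in>UNIV. if i = j then v i else 1)"
    by (intro prod.cong) (auto simp: lookup_single when_def)
  then show ?thesis by (simp add: var_def eval_at_monomial)
qed

section \<open>Koszul exactness for ideals that contain a regular sequence\<close>

text \<open>
  Ideals as sets in a commutative ring given by a type class, so that the algebra below can
  be done without carrier sets.
\<close>

definition ring_ideal :: "'a::comm_ring_1 set \<Rightarrow> bool" where
  "ring_ideal I \<longleftrightarrow> 0 \<in> I \<and> (\<forall>a\<in>I. \<forall>b\<in>I. a + b \<in> I) \<and> (\<forall>r. \<forall>a\<in>I. r * a \<in> I)"

lemma ring_ideal_0: "ring_ideal I \<Longrightarrow> 0 \<in> I"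
  and ring_ideal_add: "ring_ideal I \<Longrightarrow> a \<in> I \<Longrightarrow> b \<in> I \<Longrightarrow> a + b \<in> I"
  and ring_ideal_mult: "ring_ideal I \<Longrightarrow> a \<in> I \<Longrightarrow> r * a \<in> I"
  by (auto simp: ring_ideal_def)

lemma ring_ideal_uminus: "ring_ideal I \<Longrightarrow> a \<in> I \<Longrightarrow> - a \<in> I"
  using ring_ideal_mult[of I a "- 1"] by simp

lemma ring_ideal_diff: "ring_ideal I \<Longrightarrow> a \<in> I \<Longrightarrow> b \<in> I \<Longrightarrow> a - b \<in> I"
  using ring_ideal_add[of I a "- b"] ring_ideal_uminus[of I b] by simp

lemma ring_ideal_sum: "ring_ideal I \<Longrightarrow> (\<And>x. x \<in> A \<Longrightarrow> g x \<in> I) \<Longrightarrow> sum g A \<in> I"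
  by (induction A rule: infinite_finite_induct) (auto intro: ring_ideal_0 ring_ideal_add)


text \<open>
  The sign with which \<open>e\<^sub>i\<close> moves to its place in the wedge product of the basis vectors indexed by \<open>T\<close>.
  An element of the exterior algebra over a free module with an ordered basis is stored as the function that
  maps an index set to its coefficient.
\<close>

definition sgn_ins :: "'i::linorder \<Rightarrow> 'i set \<Rightarrow> 'a::comm_ring_1" where
  "sgn_ins i T = (- 1) ^ card {t\<in>T. t < i}"

text \<open>
  The Koszul differential, that is, contraction with the linear form whose coefficients are the \<open>g\<^sub>i\<close>.
\<close>

definition koszul :: "('i::{finite,linorder} \<Rightarrow> 'a::comm_ring_1) \<Rightarrow> ('i set \<Rightarrow> 'a) \<Rightarrow> 'i set \<Rightarrow> 'a" where
  "koszul g w T = (\<Sum>i\<in>- T. sgn_ins i T * g i * w (insert i T))"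

definition wedge :: "('i::{finite,linorder} \<Rightarrow> 'a::comm_ring_1) \<Rightarrow> ('i set \<Rightarrow> 'a) \<Rightarrow> 'i set \<Rightarrow> 'a" where
  "wedge h w T = (\<Sum>j\<in>T. sgn_ins j (T - {j}) * h j * w (T - {j}))"

lemma sgn_ins_square: "sgn_ins i T * sgn_ins i T = (1::'a::comm_ring_1)"
  by (simp add: sgn_ins_def flip: power_mult_distrib)

lemma sgn_ins_insert:
  fixes i j :: "'i::{finite,linorder}"
  assumes "j \<notin> T"
  shows "sgn_ins i (insert j T) = (if j < i then - sgn_ins i T else sgn_ins i T)"
proof -
  have "{t \<in> insert j T. t < i} = (if j < i then insert j {t\<in>T. t < i} else {t\<in>T. t < i})"
    by auto
  then show ?thesis using assms by (simp add: sgn_ins_def)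
qed

text \<open>
  Inserting two indices in the opposite order changes the sign; this is what makes the mixed terms in the Koszul
  identities below cancel.
\<close>

lemma sgn_ins_exchange:
  fixes i j :: "'i::{finite,linorder}"
  assumes "i \<notin> T" and "j \<notin> T" and "i \<noteq> j"
  shows "sgn_ins i T * sgn_ins j (insert i T) = - (sgn_ins j T * sgn_ins i (insert j T) :: 'a::comm_ring_1)"
    and "sgn_ins i (insert j T) * sgn_ins j (insert i T) = - (sgn_ins i T * sgn_ins j T :: 'a)"
  using assms by (auto simp: sgn_ins_insert algebra_simps)

lemma koszul_diff: "koszul g (\<lambda>T. v T - w T) T = koszul g v T - koszul g w T"
  by (simp add: koszul_def right_diff_distrib sum_subtractf)

lemma koszul_cmult: "koszul g (\<lambda>T. c * w T) T = c * koszul g w T"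
  by (simp add: koszul_def sum_distrib_left mult_ac)

lemma koszul_mem:
  "ring_ideal I \<Longrightarrow> (\<And>T'. card T' = Suc (card T) \<Longrightarrow> w T' \<in> I) \<Longrightarrow> koszul g w T \<in> I"
  unfolding koszul_def by (intro ring_ideal_sum ring_ideal_mult) auto

lemma wedge_mem:
  "ring_ideal I \<Longrightarrow> (\<And>T'. Suc (card T') = card T \<Longrightarrow> w T' \<in> I) \<Longrightarrow> wedge h w T \<in> I"
  unfolding wedge_def
proof (intro ring_ideal_sum ring_ideal_mult)
  fix j assume j: "j \<in> T" and w: "\<And>T'. Suc (card T') = card T \<Longrightarrow> w T' \<in> I"
  show "w (T - {j}) \<in> I"
    using card_Suc_Diff1[of T j] j by (intro w) simp
qed

lemma alternating_double_sum:
  fixes a :: "'i \<Rightarrow> 'i \<Rightarrow> 'a::comm_ring_1"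
  assumes "finite A"
    and "\<And>i. i \<in> A \<Longrightarrow> a i i = 0" and "\<And>i j. i \<in> A \<Longrightarrow> j \<in> A \<Longrightarrow> i \<noteq> j \<Longrightarrow> a j i = - a i j"
  shows "(\<Sum>i\<in>A. \<Sum>j\<in>A. a i j) = 0"
  using assms
proof (induction A rule: finite_induct)
  case empty
  show ?case by simp
next
  case (insert x A)
  have "(\<Sum>i\<in>A. a i x) = (\<Sum>i\<in>A. - a x i)"
  proof (rule sum.cong[OF refl])
    fix i assume "i \<in> A"
    then have "x \<noteq> i" using insert.hyps by auto
    with \<open>i \<in> A\<close> show "a i x = - a x i" by (intro insert.prems) auto
  qed
  moreover have "(\<Sum>i\<in>A. \<Sum>j\<in>A. a i j) = 0"
    by (intro insert.IH insert.prems) auto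
  moreover have "a x x = 0"
    by (rule insert.prems(1)) simp
  ultimately show ?case
    using insert.hyps by (simp add: sum.distrib sum_negf)
qed

text \<open>
  The terms for \<open>(i, j)\<close> and \<open>(j, i)\<close> cancel by the sign rule.
\<close>

lemma koszul_koszul:
  fixes g :: "'i::{finite,linorder} \<Rightarrow> 'a::comm_ring_1"
  shows "koszul g (koszul g q) T = 0"
proof -
  define a where "a i j = (if i = j then 0 else
    sgn_ins i T * sgn_ins j (insert i T) * g i * g j * q (insert j (insert i T)))" for i j
  have "koszul g (koszul g q) T = (\<Sum>i\<in>- T. \<Sum>j\<in>- T. a i j)"
    unfolding koszul_def
  proof (rule sum.cong[OF refl])
    fix i assume "i \<in> - T"
    have "(\<Sum>j\<in>- T. a i j) = (\<Sum>j\<in>- insert i T. a i j)"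
      by (rule sum.mono_neutral_right) (auto simp: a_def)
    also have "(\<Sum>j\<in>- insert i T. a i j) =
        sgn_ins i T * g i * (\<Sum>j\<in>- insert i T. sgn_ins j (insert i T) * g j * q (insert j (insert i T)))"
      unfolding sum_distrib_left by (intro sum.cong refl) (auto simp: a_def)
    finally show "sgn_ins i T * g i * (\<Sum>j\<in>- insert i T. sgn_ins j (insert i T) * g j * q (insert j (insert i T)))
        = (\<Sum>j\<in>- T. a i j)" ..
  qed
  also have "\<dots> = 0"
  proof (rule alternating_double_sum)
    fix i j assume "i \<in> - T" "j \<in> - T" "i \<noteq> j"
    then have "sgn_ins i T * sgn_ins j (insert i T) = - (sgn_ins j T * sgn_ins i (insert j T) :: 'a)"
      by (intro sgn_ins_exchange(1)) auto
    then show "a j i = - a i j"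
      using \<open>i \<noteq> j\<close> by (simp add: a_def insert_commute[of i j] mult.commute[of "g i"])
  qed (simp_all add: a_def)
  finally show ?thesis .
qed

text \<open>
  The wedge product with \<open>h\<close> is a homotopy between zero and multiplication by \<open>\<Sum>i. g\<^sub>i h\<^sub>i\<close>; hence the ideal
  generated by the \<open>g\<^sub>i\<close> annihilates Koszul homology. The terms with \<open>i \<noteq> j\<close> cancel by the sign rule, those
  with \<open>i = j\<close> add up to the right-hand side.
\<close>

lemma koszul_wedge:
  fixes g h :: "'i::{finite,linorder} \<Rightarrow> 'a::comm_ring_1"
  shows "koszul g (wedge h w) T + wedge h (koszul g w) T = (\<Sum>i\<in>UNIV. g i * h i) * w T"
proof -
  define a where "a i j = sgn_ins i T * g i * (sgn_ins j (insert i (T - {j})) * h j * w (insert i (T - {j})))" for i j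
  have kw: "koszul g (wedge h w) T = (\<Sum>i\<in>- T. g i * h i * w T + (\<Sum>j\<in>T. a i j))"
    unfolding koszul_def
  proof (rule sum.cong[OF refl])
    fix i assume i: "i \<in> - T"
    have "wedge h w (insert i T) = sgn_ins i T * h i * w T
        + (\<Sum>j\<in>T. sgn_ins j (insert i T - {j}) * h j * w (insert i T - {j}))"
      using i by (simp add: wedge_def)
    also have "(\<Sum>j\<in>T. sgn_ins j (insert i T - {j}) * h j * w (insert i T - {j}))
        = (\<Sum>j\<in>T. sgn_ins j (insert i (T - {j})) * h j * w (insert i (T - {j})))"
      using i by (intro sum.cong refl) (auto simp: insert_Diff_if)
    finally have "sgn_ins i T * g i * wedge h w (insert i T)
        = (sgn_ins i T * sgn_ins i T) * (g i * h i * w T) + (\<Sum>j\<in>T. a i j)"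
      by (simp add: a_def algebra_simps sum_distrib_left)
    then show "sgn_ins i T * g i * wedge h w (insert i T) = g i * h i * w T + (\<Sum>j\<in>T. a i j)"
      by (simp add: sgn_ins_square)
  qed
  have wk: "wedge h (koszul g w) T = (\<Sum>j\<in>T. g j * h j * w T - (\<Sum>i\<in>- T. a i j))"
    unfolding wedge_def
  proof (rule sum.cong[OF refl])
    fix j assume j: "j \<in> T"
    let ?U = "T - {j}"
    have "- ?U = insert j (- T)" using j by auto
    then have "koszul g w ?U = sgn_ins j ?U * g j * w T
        + (\<Sum>i\<in>- T. sgn_ins i ?U * g i * w (insert i ?U))"
      using j by (simp add: koszul_def insert_absorb)
    then have *: "sgn_ins j ?U * h j * koszul g w ?U = (sgn_ins j ?U * sgn_ins j ?U) * (g j * h j * w T)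
        + (\<Sum>i\<in>- T. (sgn_ins i ?U * sgn_ins j ?U) * (h j * g i * w (insert i ?U)))"
      by (simp add: algebra_simps sum_distrib_left)
    have "(\<Sum>i\<in>- T. (sgn_ins i ?U * sgn_ins j ?U) * (h j * g i * w (insert i ?U))) = (\<Sum>i\<in>- T. - a i j)"
    proof (rule sum.cong[OF refl])
      fix i assume "i \<in> - T"
      then have "sgn_ins i (insert j ?U) * sgn_ins j (insert i ?U) = - (sgn_ins i ?U * sgn_ins j ?U :: 'a)"
        using j by (intro sgn_ins_exchange(2)) auto
      then have "sgn_ins i ?U * sgn_ins j ?U = - (sgn_ins i T * sgn_ins j (insert i ?U) :: 'a)"
        using j by (simp add: insert_absorb)
      then show "(sgn_ins i ?U * sgn_ins j ?U) * (h j * g i * w (insert i ?U)) = - a i j"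
        by (simp add: a_def mult_ac)
    qed
    with * show "sgn_ins j ?U * h j * koszul g w ?U = g j * h j * w T - (\<Sum>i\<in>- T. a i j)"
      by (simp add: sgn_ins_square sum_negf)
  qed
  have "(\<Sum>i\<in>- T. \<Sum>j\<in>T. a i j) = (\<Sum>j\<in>T. \<Sum>i\<in>- T. a i j)"
    by (rule sum.swap)
  moreover have "(\<Sum>i\<in>UNIV. g i * h i * w T) = (\<Sum>i\<in>T. g i * h i * w T) + (\<Sum>i\<in>- T. g i * h i * w T)"
    by (subst sum.union_disjoint[symmetric]) auto
  ultimately show ?thesis
    unfolding kw wk by (simp add: sum.distrib sum_subtractf sum_distrib_right)
qed

text \<open>
  Vanishing of the Koszul homology in degree \<open>p\<close> with coefficients in the quotient by \<open>I\<close>, phrased with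
  congruences modulo \<open>I\<close>.
\<close>

definition koszul_exact :: "'a::comm_ring_1 set \<Rightarrow> nat \<Rightarrow> ('i::{finite,linorder} \<Rightarrow> 'a) \<Rightarrow> bool" where
  "koszul_exact I p g \<longleftrightarrow> (\<forall>w. (\<forall>T. Suc (card T) = p \<longrightarrow> koszul g w T \<in> I) \<longrightarrow>
     (\<exists>q. \<forall>T. card T = p \<longrightarrow> w T - koszul g q T \<in> I))"

text \<open>
  In the top degree a cycle is annihilated by all \<open>g\<^sub>i\<close>, hence by an element that is regular modulo \<open>I\<close>.
\<close>

lemma koszul_exact_top:
  fixes g h :: "'i::{finite,linorder} \<Rightarrow> 'a::comm_ring_1"
  assumes I: "ring_ideal I"
    and nzd: "\<And>r. (\<Sum>i\<in>UNIV. g i * h i) * r \<in> I \<Longrightarrow> r \<in> I"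
  shows "koszul_exact I CARD('i) g"
  unfolding koszul_exact_def
proof (intro allI impI)
  fix w :: "'i set \<Rightarrow> 'a"
  assume cycle: "\<forall>T. Suc (card T) = CARD('i) \<longrightarrow> koszul g w T \<in> I"
  have "w UNIV \<in> I"
  proof (rule nzd)
    have "wedge h (koszul g w) UNIV \<in> I" using cycle by (intro wedge_mem[OF I]) auto
    then show "(\<Sum>i\<in>UNIV. g i * h i) * w UNIV \<in> I"
      using koszul_wedge[of g h w UNIV] by (simp add: koszul_def)
  qed
  then have "w T - koszul g (\<lambda>_. 0) T \<in> I" if "card T = CARD('i)" for T
    using that card_subset_eq[of UNIV T] by (auto simp: koszul_def)
  then show "\<exists>q. \<forall>T. card T = CARD('i) \<longrightarrow> w T - koszul g q T \<in> I" by blast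
qed

text \<open>
  This is the part of the long exact sequence for multiplication by \<open>y\<close> on the quotient by \<open>I\<close> that says that
  the homology in degree \<open>p + 1\<close> modulo \<open>I + (y)\<close> maps onto the homology in degree \<open>p\<close> modulo \<open>I\<close>, because \<open>y\<close> acts as
  zero there. For a cycle \<open>w\<close> the lift is \<open>n = h \<and> w\<close>: its differential is \<open>y w\<close> modulo \<open>I\<close>. If
  \<open>n = \<partial>q + y t\<close> modulo \<open>I\<close>, then \<open>y w = y \<partial>t\<close> modulo \<open>I\<close>, and \<open>y\<close> can be cancelled.
\<close>

lemma koszul_exact_step:
  fixes g h :: "'i::{finite,linorder} \<Rightarrow> 'a::comm_ring_1"
  assumes I: "ring_ideal I"
    and y: "y = (\<Sum>i\<in>UNIV. g i * h i)"
    and nzd: "\<And>r. y * r \<in> I \<Longrightarrow> r \<in> I"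
    and J: "J = {a + y * r | a r. a \<in> I}"
    and ex: "koszul_exact J (Suc p) g"
  shows "koszul_exact I p g"
  unfolding koszul_exact_def
proof (intro allI impI)
  fix w assume cycle: "\<forall>T. Suc (card T) = p \<longrightarrow> koszul g w T \<in> I"
  define n where "n = wedge h w"
  have dn: "y * w T - koszul g n T \<in> I" if "card T = p" for T
  proof -
    have "wedge h (koszul g w) T \<in> I"
      using that cycle by (intro wedge_mem[OF I]) auto
    moreover have "y * w T - koszul g n T = wedge h (koszul g w) T"
      using koszul_wedge[of g h w T] by (simp add: n_def y algebra_simps)
    ultimately show ?thesis by simp
  qed
  have "koszul g n T \<in> J" if "Suc (card T) = Suc p" for T
  proof -
    have "koszul g n T = - (y * w T - koszul g n T) + y * w T" by simp
    moreover have "- (y * w T - koszul g n T) \<in> I"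
      using that dn by (intro ring_ideal_uminus[OF I]) auto
    ultimately show ?thesis unfolding J by blast
  qed
  with ex obtain q where nq: "\<And>T. card T = Suc p \<Longrightarrow> n T - koszul g q T \<in> J"
    unfolding koszul_exact_def by metis
  have "\<exists>t. \<forall>T. card T = Suc p \<longrightarrow> n T - koszul g q T - y * t T \<in> I"
  proof (intro choice allI)
    fix T
    show "\<exists>t. card T = Suc p \<longrightarrow> n T - koszul g q T - y * t \<in> I"
    proof (cases "card T = Suc p")
      case True
      from nq[OF this] obtain a r where "n T - koszul g q T = a + y * r" "a \<in> I"
        by (auto simp: J)
      then show ?thesis by (intro exI[of _ r]) simp
    qed simp
  qed
  then obtain t where t: "\<And>T. card T = Suc p \<Longrightarrow> n T - koszul g q T - y * t T \<in> I"
    by blast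
  have "w T - koszul g t T \<in> I" if T: "card T = p" for T
  proof (rule nzd)
    have "koszul g (\<lambda>T. n T - koszul g q T - y * t T) T \<in> I"
      using T t by (intro koszul_mem[OF I]) auto
    then have "koszul g n T - y * koszul g t T \<in> I"
      by (simp add: koszul_diff koszul_cmult koszul_koszul)
    from ring_ideal_add[OF I this dn[OF T]]
    show "y * (w T - koszul g t T) \<in> I" by (simp add: algebra_simps)
  qed
  then show "\<exists>q. \<forall>T. card T = p \<longrightarrow> w T - koszul g q T \<in> I" by blast
qed

text \<open>
  Let \<open>n\<close> be the number of the \<open>g\<^sub>i\<close>. Starting from the top degree \<open>n\<close> modulo \<open>(y\<^sub>0, \<dots>, y\<^bsub>n-2\<^esub>)\<close>,
  the previous lemma lowers the degree and removes one \<open>y\<^sub>k\<close> at a time, down to degree 1 in the ring itself. There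
  exactness says that every syzygy is a combination of Koszul relations, whose components lie in \<open>(g)\<close>.
\<close>

lemma syzygy_components_in_ideal:
  fixes g :: "'i::{finite,linorder} \<Rightarrow> 'a::comm_ring_1" and y :: "nat \<Rightarrow> 'a"
  assumes I: "\<And>k. ring_ideal (I k)" and I0: "I 0 = {0}"
    and ISuc: "\<And>k. Suc k < CARD('i) \<Longrightarrow> I (Suc k) = {a + y k * r | a r. a \<in> I k}"
    and nzd: "\<And>k r. k < CARD('i) \<Longrightarrow> y k * r \<in> I k \<Longrightarrow> r \<in> I k"
    and y: "\<And>k. k < CARD('i) \<Longrightarrow> \<exists>h. y k = (\<Sum>i\<in>UNIV. g i * h i)"
    and syz: "(\<Sum>i\<in>UNIV. g i * a i) = 0"
  shows "\<exists>b. a i = (\<Sum>j\<in>UNIV. g j * b j)"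
proof -
  have "koszul_exact (I (CARD('i) - Suc m)) (CARD('i) - m) g" if "m < CARD('i)" for m
    using that
  proof (induction m)
    case 0
    obtain h where "y (CARD('i) - 1) = (\<Sum>i\<in>UNIV. g i * h i)"
      using y[of "CARD('i) - 1"] by auto
    then show ?case
      using koszul_exact_top[OF I, of g h "CARD('i) - 1"] nzd[of "CARD('i) - 1"] by simp
  next
    case (Suc m)
    define k where "k = CARD('i) - Suc (Suc m)"
    have k: "CARD('i) - Suc m = Suc k" "CARD('i) - m = Suc (Suc k)" "Suc k < CARD('i)"
      using Suc.prems by (auto simp: k_def)
    obtain h where h: "y k = (\<Sum>i\<in>UNIV. g i * h i)"
      using y[of k] k(3) by auto
    have ex: "koszul_exact (I (Suc k)) (Suc (Suc k)) g"
      using Suc.IH Suc.prems unfolding k(1,2) by simp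
    have "koszul_exact (I k) (Suc k) g"
      by (rule koszul_exact_step[OF I h _ ISuc[OF k(3)] ex]) (use nzd[of k] k(3) in auto)
    then show ?case unfolding k(1) k_def[symmetric] .
  qed
  from this[of "CARD('i) - 1"] have ex: "koszul_exact {0} 1 g"
    by (simp add: I0)
  define w where "w T = a (the_elem T)" for T
  have "koszul g w T \<in> {0}" if "Suc (card T) = 1" for T
  proof -
    have "T = {}" using that by simp
    then show ?thesis using syz by (simp add: koszul_def w_def sgn_ins_def)
  qed
  with ex obtain q where "\<And>T. card T = 1 \<Longrightarrow> w T - koszul g q T = 0"
    unfolding koszul_exact_def by (metis singletonD)
  from this[of "{i}"] have "a i = koszul g q {i}" by (simp add: w_def)
  also have "\<dots> = (\<Sum>j\<in>UNIV. g j * (if j = i then 0 else sgn_ins j {i} * q (insert j {i})))"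
    unfolding koszul_def by (rule sum.mono_neutral_cong_left) (auto simp: mult_ac)
  finally show ?thesis
    by (intro exI[of _ "\<lambda>j. if j = i then 0 else sgn_ins j {i} * q (insert j {i})"])
qed

section \<open>Unique factorization and logarithmic derivatives\<close>

type_synonym poly4 = "complex poly poly poly poly"

text \<open>
  Four nested univariate polynomial rings serve as a model of the polynomial ring in four variables. They
  carry unique factorization by the lemma of Gauss, which \<open>to_poly4\<close> transports to polynomials in four variables.
\<close>

definition mono4 :: "nat \<Rightarrow> nat \<Rightarrow> nat \<Rightarrow> nat \<Rightarrow> complex \<Rightarrow> poly4" where
  "mono4 i j k l c = Polynomial.monom (Polynomial.monom (Polynomial.monom (Polynomial.monom c l) k) j) i"

definition to_poly4 :: "mpoly \<Rightarrow> poly4" where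
  "to_poly4 p = (\<Sum>m\<in>Poly_Mapping.keys p.
     mono4 (Poly_Mapping.lookup m 1) (Poly_Mapping.lookup m 2)
       (Poly_Mapping.lookup m 3) (Poly_Mapping.lookup m 4) (coef p m))"

lemma mono4_0 [simp]: "mono4 i j k l 0 = 0"
  by (simp add: mono4_def)

lemma mono4_add: "mono4 i j k l (a + b) = mono4 i j k l a + mono4 i j k l b"
  by (simp add: mono4_def add_monom)

lemma mono4_mult: "mono4 i j k l a * mono4 i' j' k' l' b = mono4 (i + i') (j + j') (k + k') (l + l') (a * b)"
  by (simp add: mono4_def mult_monom)

lemma coeff_mono4: "Polynomial.coeff (Polynomial.coeff (Polynomial.coeff (Polynomial.coeff (mono4 i j k l c) i') j') k') l'
    = (if i = i' \<and> j = j' \<and> k = k' \<and> l = l' then c else 0)"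
  by (simp add: mono4_def)

lemma to_poly4_monomial: "to_poly4 (monomial m c) =
    mono4 (Poly_Mapping.lookup m 1) (Poly_Mapping.lookup m 2) (Poly_Mapping.lookup m 3) (Poly_Mapping.lookup m 4) c"
  by (cases "c = 0") (simp_all add: to_poly4_def)

lemma to_poly4_add: "to_poly4 (p + q) = to_poly4 p + to_poly4 q"
  unfolding to_poly4_def by (rule setsum_keys_plus_distrib) (simp_all add: mono4_add)

lemma to_poly4_0 [simp]: "to_poly4 0 = 0"
  by (simp add: to_poly4_def)

lemma to_poly4_mult: "to_poly4 (p * q) = to_poly4 p * to_poly4 q"
proof (rule additive_eqI[where F = "\<lambda>p. to_poly4 (p * q)"])
  fix m c
  show "to_poly4 (monomial m c * q) = to_poly4 (monomial m c) * to_poly4 q"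
    by (rule additive_eqI[where F = "\<lambda>q. to_poly4 (monomial m c * q)"])
       (simp_all add: to_poly4_add algebra_simps mult_single to_poly4_monomial mono4_mult lookup_add)
qed (simp_all add: to_poly4_add algebra_simps)

lemma exponents_eqI:
  "\<lbrakk>Poly_Mapping.lookup m 1 = Poly_Mapping.lookup n 1; Poly_Mapping.lookup m 2 = Poly_Mapping.lookup n 2;
    Poly_Mapping.lookup m 3 = Poly_Mapping.lookup n 3; Poly_Mapping.lookup m 4 = Poly_Mapping.lookup n 4\<rbrakk>
   \<Longrightarrow> m = (n :: 4 \<Rightarrow>\<^sub>0 nat)"
  by (rule poly_mapping_eqI) (metis exhaust_4)

lemma coeff_to_poly4:
  "Polynomial.coeff (Polynomial.coeff (Polynomial.coeff (Polynomial.coeff (to_poly4 p) (Poly_Mapping.lookup n 1)) (Poly_Mapping.lookup n 2))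
     (Poly_Mapping.lookup n 3)) (Poly_Mapping.lookup n 4) = coef p n"
proof (rule additive_eqI[where F = "\<lambda>p. Polynomial.coeff (Polynomial.coeff (Polynomial.coeff (Polynomial.coeff (to_poly4 p) (Poly_Mapping.lookup n 1)) (Poly_Mapping.lookup n 2))
     (Poly_Mapping.lookup n 3)) (Poly_Mapping.lookup n 4)"])
  fix m c
  show "Polynomial.coeff (Polynomial.coeff (Polynomial.coeff (Polynomial.coeff (to_poly4 (monomial m c)) (Poly_Mapping.lookup n 1)) (Poly_Mapping.lookup n 2))
     (Poly_Mapping.lookup n 3)) (Poly_Mapping.lookup n 4) = coef (monomial m c) n"
    unfolding to_poly4_monomial coeff_mono4 lookup_single when_def
    using exponents_eqI[of m n] by auto
qed (simp_all add: to_poly4_add lookup_add)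

lemma inj_to_poly4: "to_poly4 p = to_poly4 q \<Longrightarrow> p = q"
  by (rule poly_mapping_eqI) (metis coeff_to_poly4)

lemma to_poly4_eq_0_iff [simp]: "to_poly4 p = 0 \<longleftrightarrow> p = 0"
  using inj_to_poly4[of p 0] by auto

lemma to_poly4_1 [simp]: "to_poly4 1 = 1"
  by (simp add: to_poly4_monomial mono4_def monom_0 one_pCons flip: single_one)

definition exponents :: "nat \<Rightarrow> nat \<Rightarrow> nat \<Rightarrow> nat \<Rightarrow> (4 \<Rightarrow>\<^sub>0 nat)" where
  "exponents i j k l = Poly_Mapping.single 1 i + Poly_Mapping.single 2 j
     + Poly_Mapping.single 3 k + Poly_Mapping.single 4 l"

lemma lookup_exponents [simp]:
  "Poly_Mapping.lookup (exponents i j k l) 1 = i" "Poly_Mapping.lookup (exponents i j k l) 2 = j"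
  "Poly_Mapping.lookup (exponents i j k l) 3 = k" "Poly_Mapping.lookup (exponents i j k l) 4 = l"
  by (simp_all add: exponents_def lookup_add lookup_single when_def)

lemma poly_additive_induct:
  assumes "\<And>i c. P (Polynomial.monom c i)" and "\<And>p q. P p \<Longrightarrow> P q \<Longrightarrow> P (p + q)"
  shows "P (p :: 'a::comm_monoid_add poly)"
proof -
  have "P (\<Sum>i\<in>A. Polynomial.monom (Polynomial.coeff p i) i)" if "finite A" for A
    using that
  proof (induction A)
    case empty
    show ?case using assms(1)[of 0 0] by simp
  qed (auto intro: assms)
  then have "P (\<Sum>i\<le>Polynomial.degree p. Polynomial.monom (Polynomial.coeff p i) i)" by blast
  then show ?thesis by (simp add: poly_as_sum_of_monoms)
qed

text \<open>
  The image is closed under sums, and every iterated polynomial is a sum of iterated monomials.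
\<close>

lemma surj_to_poly4: "\<exists>p. to_poly4 p = q"
proof (induction q rule: poly_additive_induct)
  case (1 i q)
  show ?case
  proof (induction q rule: poly_additive_induct)
    case (1 j q)
    show ?case
    proof (induction q rule: poly_additive_induct)
      case (1 k q)
      show ?case
      proof (induction q rule: poly_additive_induct)
        case (1 l c)
        show ?case
          by (intro exI[of _ "monomial (exponents i j k l) c"]) (simp add: to_poly4_monomial mono4_def)
      qed (metis to_poly4_add add_monom)
    qed (metis to_poly4_add add_monom)
  qed (metis to_poly4_add add_monom)
qed (metis to_poly4_add)

lemma to_poly4_dvd_iff: "to_poly4 p dvd to_poly4 q \<longleftrightarrow> p dvd q"
proof
  assume "to_poly4 p dvd to_poly4 q"
  then obtain s where "to_poly4 q = to_poly4 p * s" by (auto elim: dvdE)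
  moreover obtain r where "to_poly4 r = s" using surj_to_poly4 by blast
  ultimately have "q = p * r" by (intro inj_to_poly4) (simp add: to_poly4_mult)
  then show "p dvd q" by simp
next
  assume "p dvd q"
  then show "to_poly4 p dvd to_poly4 q" by (auto elim!: dvdE simp: to_poly4_mult)
qed

lemma to_poly4_dvd_1_iff: "to_poly4 p dvd 1 \<longleftrightarrow> p dvd 1"
  using to_poly4_dvd_iff[of p 1] by simp

lemma prime_elem_to_poly4: "prime_elem (to_poly4 p) \<longleftrightarrow> prime_elem p"
proof -
  have "(\<forall>a b. to_poly4 p dvd a * b \<longrightarrow> to_poly4 p dvd a \<or> to_poly4 p dvd b) \<longleftrightarrow>
      (\<forall>a b. p dvd a * b \<longrightarrow> p dvd a \<or> p dvd b)"
    by (metis surj_to_poly4 to_poly4_dvd_iff to_poly4_mult)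
  then show ?thesis
    by (simp add: prime_elem_def to_poly4_dvd_1_iff)
qed

lemma squarefree_to_poly4: "squarefree (to_poly4 p) \<longleftrightarrow> squarefree p"
  unfolding squarefree_def
  by (metis surj_to_poly4 to_poly4_dvd_iff to_poly4_mult power2_eq_square to_poly4_dvd_1_iff)

text \<open>
  All prime exponents in a squarefree element are at most one.
\<close>

lemma squarefree_dvdI:
  fixes x y :: "'a::factorial_semiring"
  assumes "squarefree x" and "\<And>p. Factorial_Ring.prime p \<Longrightarrow> p dvd x \<Longrightarrow> p dvd y"
  shows "x dvd y"
proof (cases "y = 0")
  case False
  have "x \<noteq> 0" using assms(1) by auto
  show ?thesis
  proof (rule multiplicity_le_imp_dvd[OF \<open>x \<noteq> 0\<close>])
    fix p :: 'a assume p: "Factorial_Ring.prime p"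
    show "multiplicity p x \<le> multiplicity p y"
    proof (cases "p dvd x")
      case True
      have "multiplicity p x \<le> 1"
        using assms(1) \<open>x \<noteq> 0\<close> p by (simp add: squarefree_factorial_semiring'' )
      also have "1 \<le> multiplicity p y"
        using assms(2)[OF p True] False p by (intro multiplicity_geI) auto
      finally show ?thesis .
    qed (simp add: not_dvd_imp_multiplicity_0)
  qed
qed simp

lemma squarefree_dvdI_mpoly:
  fixes f g :: mpoly
  assumes "squarefree f" and "\<And>p. prime_elem p \<Longrightarrow> p dvd f \<Longrightarrow> p dvd g"
  shows "f dvd g"
proof -
  have "to_poly4 f dvd to_poly4 g"
  proof (rule squarefree_dvdI)
    show "squarefree (to_poly4 f)" using assms(1) by (simp add: squarefree_to_poly4)
    fix p :: poly4 assume p: "Factorial_Ring.prime p" "p dvd to_poly4 f"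
    obtain q where q: "p = to_poly4 q" using surj_to_poly4 by metis
    have "prime_elem q" "q dvd f"
      using p by (auto simp: q prime_elem_to_poly4 to_poly4_dvd_iff dest: prime_imp_prime_elem)
    from assms(2)[OF this] show "p dvd to_poly4 g" by (simp add: q to_poly4_dvd_iff)
  qed
  then show ?thesis by (simp add: to_poly4_dvd_iff)
qed

text \<open>
  The degree is 0 by convention for the zero polynomial.
\<close>

definition tdeg :: "mpoly \<Rightarrow> nat" where
  "tdeg p = Max (insert 0 (mdeg ` Poly_Mapping.keys p))"

lemma tdeg_ge: "coef p m \<noteq> 0 \<Longrightarrow> mdeg m \<le> tdeg p"
  unfolding tdeg_def by (intro Max_ge) (auto simp: in_keys_iff)

lemma lookup_nonzero: "p \<noteq> 0 \<Longrightarrow> \<exists>m. Poly_Mapping.lookup p m \<noteq> 0"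
  by (rule ccontr) (auto intro: poly_mapping_eqI)

lemma hcomp_tdeg: "p \<noteq> 0 \<Longrightarrow> hcomp (tdeg p) p \<noteq> 0"
proof
  assume p: "p \<noteq> 0" and h: "hcomp (tdeg p) p = 0"
  have "Max (insert 0 (mdeg ` Poly_Mapping.keys p)) \<in> insert 0 (mdeg ` Poly_Mapping.keys p)"
    by (intro Max_in) auto
  then consider "tdeg p = 0" | m where "m \<in> Poly_Mapping.keys p" "mdeg m = tdeg p"
    unfolding tdeg_def[symmetric] by auto
  then have "\<exists>m. coef p m \<noteq> 0 \<and> mdeg m = tdeg p"
  proof cases
    case 1
    obtain m where m: "coef p m \<noteq> 0"
      using lookup_nonzero[OF p] by blast
    moreover have "mdeg m = tdeg p" using tdeg_ge[OF m] 1 by linarith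
    ultimately show ?thesis by blast
  next
    case (2 m)
    then show ?thesis by (auto simp: in_keys_iff)
  qed
  then obtain m where m: "coef p m \<noteq> 0" "mdeg m = tdeg p" by blast
  have "coef (hcomp (tdeg p) p) m = 0" by (simp only: h lookup_zero)
  then show False using m by (simp add: coef_part)
qed

text \<open>
  The product of the top components of the factors is the top component of the product, and it is nonzero.
\<close>

lemma tdeg_le_if_dvd:
  assumes "p dvd q" and "q \<noteq> 0"
  shows "tdeg p \<le> tdeg q"
proof -
  obtain r where q: "q = p * r" using assms(1) by (auto elim: dvdE)
  with assms(2) have nz: "p \<noteq> 0" "r \<noteq> 0" by auto
  define P R where "P = hcomp (tdeg p) p" and "R = hcomp (tdeg r) r"
  have PR: "P * R \<noteq> 0" using nz hcomp_tdeg by (simp add: P_def R_def)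
  have "hcomp (tdeg p + tdeg r) q = P * R"
  proof -
    have low: "mdeg m < tdeg s" if "coef (s - hcomp (tdeg s) s) m \<noteq> 0" for s m
      using that tdeg_ge[of s m] by (auto simp: lookup_minus coef_part le_less split: if_splits)
    have van: "hcomp n (a * b) = 0"
      if "\<And>m k. coef a m \<noteq> 0 \<Longrightarrow> coef b k \<noteq> 0 \<Longrightarrow> mdeg m + mdeg k < n" for a b n
    proof (rule poly_mapping_eqI)
      fix m
      have "coef (a * b) m = 0" if "mdeg m = n"
      proof (rule ccontr)
        assume "coef (a * b) m \<noteq> 0"
        then obtain k l where "m = k + l" "k \<in> Poly_Mapping.keys a" "l \<in> Poly_Mapping.keys b"
          using keys_mult[of a b] by (auto simp: in_keys_iff)
        with \<open>\<And>m k. coef a m \<noteq> 0 \<Longrightarrow> coef b k \<noteq> 0 \<Longrightarrow> mdeg m + mdeg k < n\<close>[of k l] that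
        show False by (simp add: mdeg_add in_keys_iff)
      qed
      then show "coef (hcomp n (a * b)) m = coef 0 m" by (simp add: coef_part)
    qed
    have "q = P * R + (p - P) * r + P * (r - R)" by (simp add: q algebra_simps)
    moreover have "hcomp (tdeg p + tdeg r) ((p - P) * r) = 0"
      using low[of p] tdeg_ge[of r] unfolding P_def by (intro van) (meson add_less_le_mono)
    moreover have "hcomp (tdeg p + tdeg r) (P * (r - R)) = 0"
      using low[of r] tdeg_ge[of p] unfolding R_def P_def
      by (intro van) (auto simp: coef_part split: if_splits)
    moreover have "hcomp (tdeg p + tdeg r) (P * R) = P * R"
      using hcomp_homogeneous[OF homogeneous_mult[OF homogeneous_hcomp homogeneous_hcomp]]
      by (simp add: P_def R_def)
    ultimately show ?thesis by (simp add: part_add)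
  qed
  with PR have "hcomp (tdeg p + tdeg r) q \<noteq> 0" by simp
  then obtain m where "coef (hcomp (tdeg p + tdeg r) q) m \<noteq> 0"
    using lookup_nonzero by blast
  then have "mdeg m = tdeg p + tdeg r" "coef q m \<noteq> 0" by (auto simp: coef_part split: if_splits)
  then show ?thesis using tdeg_ge[of q m] by simp
qed

lemma tdeg_homogeneous: "homogeneous d p \<Longrightarrow> p \<noteq> 0 \<Longrightarrow> tdeg p = d"
  by (metis hcomp_homogeneous hcomp_tdeg)

lemma coef_pd: "coef (pd i p) m = of_nat (Poly_Mapping.lookup m i + 1) * coef p (m + Poly_Mapping.single i 1)"
proof (rule additive_eqI[where F = "\<lambda>p. coef (pd i p) m"])
  fix n c
  show "coef (pd i (monomial n c)) m = of_nat (Poly_Mapping.lookup m i + 1) * coef (monomial n c) (m + Poly_Mapping.single i 1)"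
  proof (cases "Poly_Mapping.lookup n i = 0")
    case True
    then have "n \<noteq> m + Poly_Mapping.single i 1" by (auto simp: lookup_add)
    then show ?thesis using True by (simp add: pd_monomial lookup_single)
  next
    case False
    then have "n - Poly_Mapping.single i 1 = m \<longleftrightarrow> n = m + Poly_Mapping.single i 1"
      using single_plus_minus[OF False] by (auto simp: add.commute)
    then show ?thesis by (auto simp: pd_monomial lookup_single when_def lookup_add)
  qed
qed (simp_all add: pd_add lookup_add algebra_simps)

text \<open>
  A derivative has smaller degree, so it can be divisible by \<open>p\<close> only if it vanishes; and in
  characteristic zero only constants have vanishing gradient.
\<close>

lemma not_dvd_own_derivatives:
  assumes "p \<noteq> 0" and "\<not> p dvd 1"
  shows "\<exists>i. \<not> p dvd pd i p"
proof (rule ccontr)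
  assume "\<not> ?thesis"
  then have dvd: "p dvd pd i p" for i by blast
  have pd0: "pd i p = 0" for i
  proof (rule ccontr)
    assume nz: "pd i p \<noteq> 0"
    have "tdeg p \<le> tdeg (pd i p)" using dvd nz by (rule tdeg_le_if_dvd)
    moreover from hcomp_tdeg[OF nz] obtain m where "coef (hcomp (tdeg (pd i p)) (pd i p)) m \<noteq> 0"
      using lookup_nonzero by blast
    then have "mdeg m = tdeg (pd i p)" "coef (pd i p) m \<noteq> 0" by (auto simp: coef_part split: if_splits)
    moreover from this(2) have "coef p (m + Poly_Mapping.single i 1) \<noteq> 0" by (auto simp: coef_pd)
    from tdeg_ge[OF this] have "mdeg m + 1 \<le> tdeg p" by (simp only: mdeg_add mdeg_single)
    ultimately show False by simp
  qed
  have "coef p m = 0" if "m \<noteq> 0" for m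
  proof -
    from that obtain i where i: "Poly_Mapping.lookup m i \<noteq> 0"
      using lookup_nonzero by blast
    have "coef (pd i p) (m - Poly_Mapping.single i 1) = 0" by (simp add: pd0)
    then have "coef p (Poly_Mapping.single i 1 + (m - Poly_Mapping.single i 1)) = 0"
      by (simp add: coef_pd add.commute del: of_nat_Suc)
    then show ?thesis by (simp only: single_plus_minus[OF i])
  qed
  then have "p = const (coef p 0)" by (intro poly_mapping_eqI) (auto simp: coef_const)
  moreover from this have "coef p 0 \<noteq> 0" using assms(1) by auto
  ultimately have "p * const (inverse (coef p 0)) = 1"
    by (metis const_1 const_mult right_inverse)
  then show False using assms(2) by (metis dvd_triv_left)
qed

text \<open>
  For a prime factor \<open>p\<close> of \<open>f = p h\<close> the hypothesis and the product rule show that \<open>p\<close> divides \<open>r h p\<^sub>i\<close> for all \<open>i\<close>,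
  where \<open>p\<^sub>i\<close> is a partial derivative of \<open>p\<close>. Since \<open>p\<close> does not divide \<open>h\<close>, nor all \<open>p\<^sub>i\<close>, it divides \<open>r\<close>.
\<close>

lemma squarefree_log_derivative:
  assumes sf: "squarefree f" and dvd: "\<And>i. f dvd r * pd i f"
  shows "f dvd r"
proof (rule squarefree_dvdI_mpoly[OF sf])
  fix p assume p: "prime_elem p" and "p dvd f"
  then obtain h where f: "f = p * h" by (auto elim: dvdE)
  have "\<not> p dvd h"
  proof
    assume "p dvd h"
    then have "p ^ 2 dvd f" unfolding f power2_eq_square by (intro mult_dvd_mono) auto
    then show False using sf p by (auto simp: squarefree_def prime_elem_def)
  qed
  obtain i where i: "\<not> p dvd pd i p"
    using not_dvd_own_derivatives[of p] p by (auto simp: prime_elem_def)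
  have "p dvd r * pd i f" using dvd[of i] f by (metis dvd_mult_left)
  moreover have "r * pd i f = r * h * pd i p + p * (r * pd i h)"
    by (simp add: f pd_mult algebra_simps)
  ultimately have "p dvd r * h * pd i p"
    by (metis dvd_add_left_iff dvd_triv_left)
  with p i \<open>\<not> p dvd h\<close> show "p dvd r"
    by (simp add: prime_elem_dvd_mult_iff)
qed

section \<open>Dimensions of graded pieces\<close>

lemma (in vector_space) span_Int_span_disjoint:
  assumes "independent (B \<union> C)" and "B \<inter> C = {}" and "x \<in> span B" and "x \<in> span C"
  shows "x = 0"
proof -
  have "representation (B \<union> C) x = representation B x" "representation (B \<union> C) x = representation C x"
    using assms by (auto intro!: representation_extend)
  then have "representation B x b = 0" for b
    using representation_ne_zero[of B x b] representation_ne_zero[of C x b] assms(2) by auto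
  moreover have "(\<Sum>b | representation B x b \<noteq> 0. scale (representation B x b) b) = x"
    using assms(3) independent_mono[OF assms(1)] by (intro sum_nonzero_representation_eq) auto
  ultimately show ?thesis by simp
qed

text \<open>
  Rank and nullity for a finite-dimensional subspace of a vector space of arbitrary dimension: the vectors
  that extend a basis of the kernel to a basis of \<open>V\<close> map to a basis of the image.
\<close>

lemma (in vector_space_pair) dim_image_plus_dim_kernel:
  assumes lin: "Vector_Spaces.linear s1 s2 f" and V: "vs1.subspace V"
    and fin: "finite F" "V \<subseteq> vs1.span F"
  shows "vs1.dim V = vs2.dim (f ` V) + vs1.dim {v \<in> V. f v = 0}"
proof -
  interpret f: Vector_Spaces.linear s1 s2 f by (rule lin)
  define K where "K = {v \<in> V. f v = 0}"
  obtain BK where BK: "BK \<subseteq> K" "vs1.independent BK" "K \<subseteq> vs1.span BK" "card BK = vs1.dim K"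
    by (rule vs1.basis_exists)
  have "BK \<subseteq> V" using BK by (auto simp: K_def)
  then obtain B where B: "BK \<subseteq> B" "B \<subseteq> V" "vs1.independent B" "V \<subseteq> vs1.span B"
    using BK(2) vs1.maximal_independent_subset_extend by metis
  have finB: "finite B"
    using vs1.independent_span_bound[OF fin(1) B(3)] B(2) fin(2) by auto
  define D where "D = B - BK"
  have B_eq: "B = BK \<union> D" "BK \<inter> D = {}" using B(1) by (auto simp: D_def)
  have spanD: "vs1.span D \<subseteq> V"
    using B(2) V by (intro vs1.span_minimal) (auto simp: D_def)
  have ker: "x = 0" if "x \<in> vs1.span D" "f x = 0" for x
  proof -
    have "x \<in> K" using that spanD by (auto simp: K_def)
    then have "x \<in> vs1.span BK" using BK(3) by auto
    with that(1) show ?thesis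
      using B(3) B_eq vs1.span_Int_span_disjoint[of BK D x] by simp
  qed
  have inj: "inj_on f (vs1.span D)"
  proof (rule inj_onI)
    fix x y assume "x \<in> vs1.span D" "y \<in> vs1.span D" "f x = f y"
    then have "x - y = 0" by (intro ker) (auto simp: f.diff intro: vs1.span_diff)
    then show "x = y" by simp
  qed
  have indD: "vs1.independent D"
    using B(3) by (rule vs1.independent_mono) (auto simp: D_def)
  have "vs2.independent (f ` D)"
    using indD inj by (rule f.independent_injective_image)
  moreover have "f ` V \<subseteq> vs2.span (f ` D)"
  proof
    fix y assume "y \<in> f ` V"
    then obtain x where x: "x \<in> vs1.span B" "y = f x" using B(4) by auto
    then obtain a b where "x = a + b" "a \<in> vs1.span BK" "b \<in> vs1.span D"
      unfolding B_eq(1) vs1.span_Un by auto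
    moreover have "f a = 0" if "a \<in> vs1.span BK" for a
      by (rule f.eq_0_on_span[OF _ that]) (use BK(1) in \<open>auto simp: K_def\<close>)
    ultimately show "y \<in> vs2.span (f ` D)"
      using x by (auto simp: f.add f.span_image)
  qed
  moreover have "f ` D \<subseteq> f ` V" using B(2) by (auto simp: D_def)
  moreover have "card (f ` D) = card D"
    using inj_on_subset[OF inj vs1.span_superset] by (rule card_image)
  ultimately have "vs2.dim (f ` V) = card D"
    by (intro vs2.dim_unique)
  moreover have "vs1.dim V = card B"
    using B by (intro vs1.dim_unique) auto
  moreover have "card B = card BK + card D"
    using finB unfolding B_eq(1) by (intro card_Un_disjoint) (use B_eq(2) in auto)
  ultimately show ?thesis
    using BK(4) by (simp add: K_def)
qed

definition mscale :: "complex \<Rightarrow> mpoly \<Rightarrow> mpoly" where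
  "mscale c p = const c * p"

definition vscale :: "complex \<Rightarrow> mpoly^'n \<Rightarrow> mpoly^'n" where
  "vscale c v = const c *s v"

interpretation mpoly_vs: vector_space mscale
  by unfold_locales (simp_all add: mscale_def algebra_simps const_add const_mult)

interpretation mvec_vs: vector_space "vscale :: complex \<Rightarrow> mpoly^'n \<Rightarrow> mpoly^'n"
  by unfold_locales (simp_all add: vscale_def vec_eq_iff algebra_simps const_add const_mult)

interpretation mvec_mpoly: vector_space_pair "vscale :: complex \<Rightarrow> mpoly^'n \<Rightarrow> mpoly^'n" mscale ..

interpretation mvec_mvec: vector_space_pair "vscale :: complex \<Rightarrow> mpoly^'n \<Rightarrow> mpoly^'n"
  "vscale :: complex \<Rightarrow> mpoly^'m \<Rightarrow> mpoly^'m" ..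

definition supported :: "('n \<Rightarrow> (4 \<Rightarrow>\<^sub>0 nat) set) \<Rightarrow> (mpoly^'n) set" where
  "supported M = {v. \<forall>j m. coef (v $ j) m \<noteq> 0 \<longrightarrow> m \<in> M j}"

lemma subspace_supported: "mvec_vs.subspace (supported M)"
  unfolding mvec_vs.subspace_def
proof (intro conjI ballI allI)
  fix v w assume vw: "v \<in> supported M" "w \<in> supported M"
  have "m \<in> M j" if "coef (v $ j) m + coef (w $ j) m \<noteq> 0" for j m
  proof -
    from that have "coef (v $ j) m \<noteq> 0 \<or> coef (w $ j) m \<noteq> 0" by auto
    then show ?thesis using vw by (auto simp: supported_def)
  qed
  then show "v + w \<in> supported M" by (simp add: supported_def lookup_add)
qed (auto simp: supported_def vscale_def)

lemma supported_basis:
  fixes M :: "'n::finite \<Rightarrow> (4 \<Rightarrow>\<^sub>0 nat) set"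
  assumes fin: "\<And>j. finite (M j)"
  defines "B \<equiv> (\<lambda>(j, m). axis j (monomial m 1)) ` (Sigma UNIV M)"
  shows "finite B" and "card B = (\<Sum>j\<in>UNIV. card (M j))"
    and "B \<subseteq> supported M" and "supported M \<subseteq> mvec_vs.span B" and "mvec_vs.independent B"
proof -
  let ?e = "\<lambda>(j, m). axis j (monomial m 1) :: mpoly^'n"
  have coef_e: "coef (axis j (monomial m 1) $ i) n = (if i = j \<and> m = n then 1 else 0)"
    for i j :: 'n and m n
    by (auto simp: axis_def lookup_single when_def)
  have inj: "inj_on ?e Y" for Y
  proof (rule inj_onI, clarify)
    fix i m j n assume "axis i (monomial m 1) = (axis j (monomial n 1) :: mpoly^'n)"
    then have "coef (axis i (monomial m 1) $ i) m = coef ((axis j (monomial n 1) :: mpoly^'n) $ i) m"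
      by simp
    then show "i = j \<and> m = n" by (simp add: coef_e split: if_splits)
  qed
  show finB: "finite B" unfolding B_def using fin by (intro finite_imageI finite_SigmaI) auto
  show "card B = (\<Sum>j\<in>UNIV. card (M j))"
    unfolding B_def using fin by (simp add: card_image[OF inj])
  show "B \<subseteq> supported M"
    unfolding B_def supported_def by (auto simp: coef_e split: if_splits)
  show "supported M \<subseteq> mvec_vs.span B"
  proof
    fix v :: "mpoly^'n" assume v: "v \<in> supported M"
    have "v = (\<Sum>j\<in>UNIV. axis j (v $ j))"
      by (simp add: vec_eq_iff axis_def)
    also have "\<dots> = (\<Sum>j\<in>UNIV. \<Sum>m\<in>Poly_Mapping.keys (v $ j). vscale (coef (v $ j) m) (axis j (monomial m 1)))"
    proof (rule sum.cong[OF refl])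
      fix j
      have "axis j (v $ j) = axis j (\<Sum>m\<in>Poly_Mapping.keys (v $ j). monomial m (coef (v $ j) m))"
        using mpoly_as_sum[of "v $ j"] by simp
      also have "\<dots> = (\<Sum>m\<in>Poly_Mapping.keys (v $ j). vscale (coef (v $ j) m) (axis j (monomial m 1)))"
        by (auto simp: vec_eq_iff axis_def vscale_def const_mult_monomial)
      finally show "axis j (v $ j) = (\<Sum>m\<in>Poly_Mapping.keys (v $ j). vscale (coef (v $ j) m) (axis j (monomial m 1)))" .
    qed
    also have "\<dots> \<in> mvec_vs.span B"
      using v unfolding B_def supported_def
      by (intro mvec_vs.span_sum mvec_vs.span_scale mvec_vs.span_base) (auto simp: in_keys_iff image_iff)
    finally show "v \<in> mvec_vs.span B" .
  qed
  show "mvec_vs.independent B"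
  proof (rule mvec_vs.independent_if_scalars_zero[OF finB])
    fix u x assume sum: "(\<Sum>x\<in>B. vscale (u x) x) = 0" and "x \<in> B"
    then obtain j m where jm: "m \<in> M j" "x = ?e (j, m)" by (auto simp: B_def)
    have "0 = coef ((\<Sum>x\<in>B. vscale (u x) x) $ j) m" by (simp add: sum)
    also have "\<dots> = (\<Sum>x\<in>B. u x * coef (x $ j) m)"
      by (simp add: lookup_sum vscale_def)
    also have "\<dots> = (\<Sum>y\<in>Sigma UNIV M. u (?e y) * coef (?e y $ j) m)"
      unfolding B_def by (rule sum.reindex[OF inj, unfolded comp_def])
    also have "\<dots> = (\<Sum>y\<in>Sigma UNIV M. if y = (j, m) then u (?e y) else 0)"
      by (intro sum.cong refl) (auto simp: coef_e split: if_splits)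
    also have "\<dots> = u x"
      using fin jm by (subst sum.delta) auto
    finally show "u x = 0" ..
  qed
qed

lemma dim_supported:
  fixes M :: "'n::finite \<Rightarrow> (4 \<Rightarrow>\<^sub>0 nat) set"
  assumes "\<And>j. finite (M j)"
  shows "mvec_vs.dim (supported M) = (\<Sum>j\<in>UNIV. card (M j))"
  using supported_basis[where M = M, OF assms] by (intro mvec_vs.dim_unique) auto

text \<open>
  The monomials of degree \<open>k\<close> in the shifted module \<open>S(-b)\<close>. Writing the condition without subtraction makes the
  set empty when \<open>k < b\<close>.
\<close>

definition shifted_monos :: "nat \<Rightarrow> nat \<Rightarrow> (4 \<Rightarrow>\<^sub>0 nat) set" where
  "shifted_monos b k = {m. mdeg m + b = k}"

text \<open>
  The dimension of the piece of degree \<open>k\<close> of \<open>S(-b)\<close>.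
\<close>

definition hdim :: "nat \<Rightarrow> nat \<Rightarrow> nat" where
  "hdim b k = (if b \<le> k then (k - b + 3) choose 3 else 0)"

lemma shifted_monos_bij:
  assumes "b \<le> k"
  shows "bij_betw (\<lambda>m. [Poly_Mapping.lookup m 1, Poly_Mapping.lookup m 2, Poly_Mapping.lookup m 3, Poly_Mapping.lookup m 4])
     (shifted_monos b k) {l::nat list. length l = 4 \<and> sum_list l = k - b}"
proof (rule bij_betwI[where g = "\<lambda>l. exponents (l ! 0) (l ! 1) (l ! 2) (l ! 3)"])
  have mdeg4: "mdeg m = Poly_Mapping.lookup m 1 + Poly_Mapping.lookup m 2 + Poly_Mapping.lookup m 3 + Poly_Mapping.lookup m 4"
    for m by (simp add: mdeg_def sum_4)
  show "(\<lambda>m. [Poly_Mapping.lookup m 1, Poly_Mapping.lookup m 2, Poly_Mapping.lookup m 3, Poly_Mapping.lookup m 4])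
     \<in> shifted_monos b k \<rightarrow> {l::nat list. length l = 4 \<and> sum_list l = k - b}"
    by (auto simp: shifted_monos_def mdeg4)
  have four: "l = [l ! 0, l ! 1, l ! 2, l ! 3]" if "length l = 4" for l :: "nat list"
    using that by (intro nth_equalityI) (auto simp: less_Suc_eq numeral_eq_Suc)
  show "(\<lambda>l. exponents (l ! 0) (l ! 1) (l ! 2) (l ! 3))
      \<in> {l::nat list. length l = 4 \<and> sum_list l = k - b} \<rightarrow> shifted_monos b k"
  proof
    fix l :: "nat list" assume l: "l \<in> {l. length l = 4 \<and> sum_list l = k - b}"
    then have "k - b = sum_list [l ! 0, l ! 1, l ! 2, l ! 3]" using four[of l] by simp
    then show "exponents (l ! 0) (l ! 1) (l ! 2) (l ! 3) \<in> shifted_monos b k"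
      using assms by (simp add: shifted_monos_def mdeg4)
  qed
  show "exponents ([Poly_Mapping.lookup m 1, Poly_Mapping.lookup m 2, Poly_Mapping.lookup m 3, Poly_Mapping.lookup m 4] ! 0)
      ([Poly_Mapping.lookup m 1, Poly_Mapping.lookup m 2, Poly_Mapping.lookup m 3, Poly_Mapping.lookup m 4] ! 1)
      ([Poly_Mapping.lookup m 1, Poly_Mapping.lookup m 2, Poly_Mapping.lookup m 3, Poly_Mapping.lookup m 4] ! 2)
      ([Poly_Mapping.lookup m 1, Poly_Mapping.lookup m 2, Poly_Mapping.lookup m 3, Poly_Mapping.lookup m 4] ! 3) = m"
    for m :: "4 \<Rightarrow>\<^sub>0 nat"
    by (rule exponents_eqI) (simp_all add: numeral_eq_Suc[of "num.One"] nth_Cons')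
  show "[Poly_Mapping.lookup (exponents (l ! 0) (l ! 1) (l ! 2) (l ! 3)) 1,
         Poly_Mapping.lookup (exponents (l ! 0) (l ! 1) (l ! 2) (l ! 3)) 2,
         Poly_Mapping.lookup (exponents (l ! 0) (l ! 1) (l ! 2) (l ! 3)) 3,
         Poly_Mapping.lookup (exponents (l ! 0) (l ! 1) (l ! 2) (l ! 3)) 4] = l"
    if "l \<in> {l::nat list. length l = 4 \<and> sum_list l = k - b}" for l
    using that four[of l] by simp
qed

lemma card_shifted_monos: "card (shifted_monos b k) = hdim b k"
proof (cases "b \<le> k")
  case True
  have "card (shifted_monos b k) = card {l::nat list. length l = 4 \<and> sum_list l = k - b}"
    using shifted_monos_bij[OF True] by (rule bij_betw_same_card)
  also have "\<dots> = (k - b + 3) choose (k - b)"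
    by (simp add: card_length_sum_list add.commute)
  also have "\<dots> = (k - b + 3) choose 3"
    using binomial_symmetric[of 3 "k - b + 3"] by simp
  finally show ?thesis using True by (simp add: hdim_def)
qed (auto simp: shifted_monos_def hdim_def)

lemma finite_shifted_monos: "finite (shifted_monos b k)"
proof (cases "b \<le> k")
  case True
  have "finite {l::nat list. length l = 4 \<and> sum_list l = k - b}"
  proof (rule finite_subset)
    show "{l::nat list. length l = 4 \<and> sum_list l = k - b} \<subseteq> {l. set l \<subseteq> {..k - b} \<and> length l = 4}"
      using member_le_sum_list by fastforce
  qed (simp add: finite_lists_length_eq)
  then show ?thesis using bij_betw_finite[OF shifted_monos_bij[OF True]] by simp
next
  case False
  then have "shifted_monos b k = {}" by (auto simp: shifted_monos_def)
  then show ?thesis by simp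
qed

text \<open>
  The piece of degree \<open>k\<close> of the graded free module with shifts \<open>b\<close>.
\<close>

definition graded_piece :: "nat^'n \<Rightarrow> nat \<Rightarrow> (mpoly^'n) set" where
  "graded_piece b k = supported (\<lambda>j. shifted_monos (b $ j) k)"

lemma graded_piece_iff: "v \<in> graded_piece b k \<longleftrightarrow>
   (\<forall>j. if b $ j \<le> k then homogeneous (k - b $ j) (v $ j) else v $ j = 0)"
proof -
  have "(\<forall>m. coef p m \<noteq> 0 \<longrightarrow> mdeg m + c = k) \<longleftrightarrow> (if c \<le> k then homogeneous (k - c) p else p = 0)" for p c
    by (auto simp: homogeneous_iff intro: poly_mapping_eqI) 
  then show ?thesis by (simp add: graded_piece_def supported_def shifted_monos_def)
qed

lemma dim_graded_piece: "mvec_vs.dim (graded_piece b k) = (\<Sum>j\<in>UNIV. hdim (b $ j) k)"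
  for b :: "nat^'n"
  unfolding graded_piece_def by (subst dim_supported) (simp_all add: finite_shifted_monos card_shifted_monos)

lemma graded_piece_finite_span: "\<exists>F. finite F \<and> graded_piece b k \<subseteq> mvec_vs.span F"
  for b :: "nat^'n"
  unfolding graded_piece_def using supported_basis[where M = "\<lambda>j. shifted_monos (b $ j) k"] finite_shifted_monos by metis

lemma subspace_graded_piece: "mvec_vs.subspace (graded_piece b k)"
  unfolding graded_piece_def by (rule subspace_supported)

lemma dim_zero_vec: "mvec_vs.dim ({0} :: (mpoly^'n) set) = 0"
  by (rule mvec_vs.dim_unique[of "{}"]) (simp_all add: mvec_vs.independent_empty)

lemma dim_mpoly_piece: "mpoly_vs.dim {p. homogeneous k p} = hdim 0 k"
proof -
  let ?V = "graded_piece (0 :: nat^1) k"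
  have lin: "Vector_Spaces.linear vscale mscale (\<lambda>v :: mpoly^1. v $ 1)"
    by unfold_locales (simp_all add: vscale_def mscale_def)
  obtain F where F: "finite F" "?V \<subseteq> mvec_vs.span F" using graded_piece_finite_span by blast
  have "(\<lambda>v. v $ 1) ` ?V = {p. homogeneous k p}"
  proof (intro subset_antisym subsetI)
    fix p assume "p \<in> {p. homogeneous k p}"
    then show "p \<in> (\<lambda>v. v $ 1) ` ?V"
      by (intro image_eqI[of _ _ "vec p"]) (auto simp: graded_piece_iff)
  qed (auto simp: graded_piece_iff)
  moreover have "{v \<in> ?V. v $ 1 = 0} = {0}"
    by (auto simp: vec_eq_iff graded_piece_iff)
  ultimately show ?thesis
    using mvec_mpoly.dim_image_plus_dim_kernel[OF lin subspace_graded_piece F]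
    by (simp add: dim_graded_piece dim_zero_vec)
qed

section \<open>The Hilbert function of the Milnor algebra\<close>

lemma mpoly_ring_simps [simp]:
  "carrier mpoly_ring = UNIV" "x \<otimes>\<^bsub>mpoly_ring\<^esub> y = x * y" "x \<oplus>\<^bsub>mpoly_ring\<^esub> y = x + y"
  "\<one>\<^bsub>mpoly_ring\<^esub> = 1" "\<zero>\<^bsub>mpoly_ring\<^esub> = 0"
  by (simp_all add: ring_of_type_algebra_def)

lemma cring_mpoly_ring: "cring mpoly_ring"
  by (rule cring_from_type_algebra)

lemma a_inv_mpoly_ring [simp]: "\<ominus>\<^bsub>mpoly_ring\<^esub> x = - x"
proof -
  interpret cring mpoly_ring by (rule cring_mpoly_ring)
  show ?thesis by (rule minus_equality) simp_all
qed

lemma ring_ideal_iff_ideal: "ring_ideal I \<longleftrightarrow> ideal I mpoly_ring"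
proof
  assume I: "ring_ideal I"
  interpret cring mpoly_ring by (rule cring_mpoly_ring)
  show "ideal I mpoly_ring"
  proof (rule idealI)
    show "subgroup I (add_monoid mpoly_ring)"
      by (rule add.subgroupI)
         (use ring_ideal_0[OF I] in \<open>auto intro: ring_ideal_uminus[OF I] ring_ideal_add[OF I]\<close>)
    fix a x assume "a \<in> I"
    then show "x \<otimes>\<^bsub>mpoly_ring\<^esub> a \<in> I" "a \<otimes>\<^bsub>mpoly_ring\<^esub> x \<in> I"
      using ring_ideal_mult[OF I, of a x] by (simp_all add: mult.commute)
  qed (rule ring_axioms)
next
  assume "ideal I mpoly_ring"
  then interpret ideal I mpoly_ring .
  show "ring_ideal I"
    unfolding ring_ideal_def
    using additive_subgroup.zero_closed[OF is_additive_subgroup]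
      additive_subgroup.a_closed[OF is_additive_subgroup] I_l_closed by auto
qed

definition grad_map :: "mpoly \<Rightarrow> mpoly^4 \<Rightarrow> mpoly" where
  "grad_map f v = (\<Sum>i\<in>UNIV. v $ i * pd i f)"

lemma grad_map_add: "grad_map f (v + w) = grad_map f v + grad_map f w"
  by (simp add: grad_map_def distrib_right sum.distrib)

lemma grad_map_smult: "grad_map f (r *s v) = r * grad_map f v"
  by (simp add: grad_map_def sum_distrib_left mult.assoc)

lemma grad_map_axis: "grad_map f (axis i r) = r * pd i f"
proof -
  have "grad_map f (axis i r) = (\<Sum>j\<in>UNIV. if j = i then r * pd j f else 0)"
    unfolding grad_map_def by (intro sum.cong) (auto simp: axis_def)
  then show ?thesis by simp
qed

lemma ring_ideal_range_grad_map: "ring_ideal (range (grad_map f))"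
  unfolding ring_ideal_def
proof (intro conjI ballI allI)
  show "0 \<in> range (grad_map f)" by (rule range_eqI[of _ _ 0]) (simp add: grad_map_def)
qed (auto simp flip: grad_map_add grad_map_smult)

lemma ring_ideal_jacobian: "ring_ideal (jacobian_ideal f)"
proof -
  interpret cring mpoly_ring by (rule cring_mpoly_ring)
  show ?thesis
    unfolding ring_ideal_iff_ideal jacobian_ideal_def by (rule genideal_ideal) simp
qed

lemma pd_in_jacobian: "pd i f \<in> jacobian_ideal f"
proof -
  interpret cring mpoly_ring by (rule cring_mpoly_ring)
  show ?thesis
    unfolding jacobian_ideal_def using genideal_self[of "range (\<lambda>i. pd i f)"] by auto
qed

lemma jacobian_ideal_eq: "jacobian_ideal f = range (grad_map f)"
proof
  interpret cring mpoly_ring by (rule cring_mpoly_ring)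
  have "pd i f \<in> range (grad_map f)" for i
    by (rule range_eqI[of _ _ "axis i 1"]) (simp add: grad_map_axis)
  then show "jacobian_ideal f \<subseteq> range (grad_map f)"
    unfolding jacobian_ideal_def
    using ring_ideal_range_grad_map[of f] unfolding ring_ideal_iff_ideal
    by (intro genideal_minimal) auto
  show "range (grad_map f) \<subseteq> jacobian_ideal f"
    unfolding grad_map_def
    by (auto intro!: ring_ideal_sum[OF ring_ideal_jacobian] ring_ideal_mult[OF ring_ideal_jacobian] pd_in_jacobian)
qed

lemma subspace_homogeneous: "mpoly_vs.subspace {p. homogeneous k p}"
  unfolding mpoly_vs.subspace_def mscale_def
  by (auto intro: homogeneous_add homogeneous_const_mult)

lemma subspace_ring_ideal: "ring_ideal I \<Longrightarrow> mpoly_vs.subspace I"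
  unfolding mpoly_vs.subspace_def mscale_def
  by (auto intro: ring_ideal_0 ring_ideal_add ring_ideal_mult)

lemma homogeneous_finite_span: "\<exists>F. finite F \<and> {p. homogeneous k p} \<subseteq> mpoly_vs.span F"
proof (intro exI conjI subsetI)
  show "finite ((\<lambda>m. monomial m 1) ` shifted_monos 0 k)" by (intro finite_imageI finite_shifted_monos)
  fix p assume "p \<in> {p. homogeneous k p}"
  then have "(\<Sum>m\<in>Poly_Mapping.keys p. mscale (coef p m) (monomial m 1)) \<in> mpoly_vs.span ((\<lambda>m. monomial m 1) ` shifted_monos 0 k)"
    by (intro mpoly_vs.span_sum mpoly_vs.span_scale mpoly_vs.span_base)
       (auto simp: homogeneous_def shifted_monos_def)
  then show "p \<in> mpoly_vs.span ((\<lambda>m. monomial m 1) ` shifted_monos 0 k)"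
    using mpoly_as_sum[of p] by (simp add: mscale_def const_mult_monomial)
qed

text \<open>
  Extend a basis of \<open>J\<^sub>k\<close> to a basis of \<open>S\<^sub>k\<close>. The classes of the additional vectors are independent over the field of
  constants and span the piece of degree \<open>k\<close> of the quotient. Properness of the ideal makes the image of the
  constants a field.
\<close>

lemma hilbert_fun_plus_dim:
  assumes proper: "1 \<notin> jacobian_ideal f"
  shows "hilbert_fun f k + mpoly_vs.dim (jacobian_ideal f \<inter> {p. homogeneous k p}) = hdim 0 k"
proof -
  define J where "J = jacobian_ideal f"
  define S where "S = {p. homogeneous k p}"
  have J: "ring_ideal J" unfolding J_def by (rule ring_ideal_jacobian)
  interpret I: ideal J mpoly_ring using J by (simp add: ring_ideal_iff_ideal)
  define c where "c = milnor_class f"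
  have hom: "ring_hom_ring mpoly_ring (milnor_algebra f) c"
  proof -
    have "c = (+>\<^bsub>mpoly_ring\<^esub>) J"
      by (rule ext) (simp add: c_def milnor_class_def J_def)
    then show ?thesis using I.rcos_ring_hom_ring by (simp add: milnor_algebra_def J_def)
  qed
  interpret h: ring_hom_ring mpoly_ring "milnor_algebra f" c by (rule hom)
  interpret P: cring mpoly_ring by (rule cring_mpoly_ring)
  have c_coset: "c p = {a + p | a. a \<in> J}" for p
    by (auto simp: c_def milnor_class_def J_def a_r_coset_def')
  have c_eq_iff: "c p = c q \<longleftrightarrow> p - q \<in> J" for p q
  proof
    assume "c p = c q"
    moreover have "p \<in> c p" using ring_ideal_0[OF J] by (auto simp: c_coset intro: exI[of _ 0])
    ultimately show "p - q \<in> J" by (auto simp: c_coset)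
  next
    have sub: "c p \<subseteq> c q" if "p - q \<in> J" for p q
    proof
      fix x assume "x \<in> c p"
      then obtain a where a: "a \<in> J" "x = a + p" by (auto simp: c_coset)
      then have "x = (a + (p - q)) + q" "a + (p - q) \<in> J" using that ring_ideal_add[OF J] by auto
      then show "x \<in> c q" unfolding c_coset by blast
    qed
    assume "p - q \<in> J"
    moreover from ring_ideal_uminus[OF J this] have "q - p \<in> J" by simp
    ultimately show "c p = c q" using sub by blast
  qed
  have c_add: "c p \<oplus>\<^bsub>milnor_algebra f\<^esub> c q = c (p + q)" 
    and c_mult: "c p \<otimes>\<^bsub>milnor_algebra f\<^esub> c q = c (p * q)" for p q
    using h.hom_add[of p q] h.hom_mult[of p q] by simp_all
  have c_zero: "\<zero>\<^bsub>milnor_algebra f\<^esub> = c 0"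
    using h.hom_zero by simp
  have "subfield (range const) mpoly_ring"
  proof (rule I.subfieldI)
    have sr: "subring (range const) mpoly_ring"
      by (rule I.subringI) (auto simp flip: const_uminus const_mult const_add const_1)
    then show "subcring (range const) mpoly_ring" by (rule P.subcringI')
    show "Units (mpoly_ring\<lparr>carrier := range const\<rparr>) = range const - {\<zero>\<^bsub>mpoly_ring\<^esub>}"
    proof (intro subset_antisym subsetI)
      fix x assume "x \<in> range const - {\<zero>\<^bsub>mpoly_ring\<^esub>}"
      then obtain a where a: "x = const a" "a \<noteq> 0" by auto
      then have "x * const (inverse a) = 1" "const (inverse a) * x = 1" by (simp_all flip: const_mult)
      with a show "x \<in> Units (mpoly_ring\<lparr>carrier := range const\<rparr>)"
        by (auto simp: Units_def)
    qed (auto simp: Units_def)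
  qed
  then have K: "subfield (c ` range const) (milnor_algebra f)"
  proof (rule h.img_is_subfield(2))
    show "\<one>\<^bsub>milnor_algebra f\<^esub> \<noteq> \<zero>\<^bsub>milnor_algebra f\<^esub>"
      using proper h.hom_one by (simp add: c_zero c_eq_iff J_def flip: h.hom_one)
  qed
  obtain F where F: "finite F" "S \<subseteq> mpoly_vs.span F"
    using homogeneous_finite_span unfolding S_def by blast
  obtain BJ where BJ: "BJ \<subseteq> J \<inter> S" "mpoly_vs.independent BJ" "J \<inter> S \<subseteq> mpoly_vs.span BJ"
      "card BJ = mpoly_vs.dim (J \<inter> S)"
    by (rule mpoly_vs.basis_exists)
  then obtain B where B: "BJ \<subseteq> B" "B \<subseteq> S" "mpoly_vs.independent B" "S \<subseteq> mpoly_vs.span B"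
    using mpoly_vs.maximal_independent_subset_extend[of BJ S] by auto
  have finB: "finite B" using mpoly_vs.independent_span_bound[OF F(1) B(3)] B(2) F(2) by auto
  have spanJ: "mpoly_vs.span BJ \<subseteq> J"
    using BJ(1) by (intro mpoly_vs.span_minimal subspace_ring_ideal[OF J]) auto
  have spanS: "mpoly_vs.span D \<subseteq> S" if "D \<subseteq> B" for D
    using that B(2) unfolding S_def by (intro mpoly_vs.span_minimal subspace_homogeneous) auto
  have dimension: "ring.dimension (milnor_algebra f) (card D) (c ` range const) (c ` mpoly_vs.span D)"
    if "D \<subseteq> B - BJ" for D
    using finite_subset[OF that finite_Diff[OF finB]] that
  proof (induction D rule: finite_induct)
    case empty
    show ?case using h.S.dimension.zero_dim by (simp add: c_zero)
  next
    case (insert v D)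
    have "c v \<notin> c ` mpoly_vs.span D"
    proof
      assume "c v \<in> c ` mpoly_vs.span D"
      then obtain x where x: "x \<in> mpoly_vs.span D" "v - x \<in> J" by (auto simp: c_eq_iff)
      have "x \<in> S" using x(1) spanS[of D] insert.prems by auto
      moreover have "v \<in> S" using insert.prems B(2) by auto
      ultimately have "v - x \<in> mpoly_vs.span BJ"
        using x(2) BJ(3) by (auto simp: S_def intro: homogeneous_diff)
      then have "(v - x) + x \<in> mpoly_vs.span (BJ \<union> D)"
        using x(1) by (intro mpoly_vs.span_add) (auto intro: subsetD[OF mpoly_vs.span_mono])
      moreover have "BJ \<union> D \<subseteq> B - {v}" using insert.prems insert.hyps B(1) by auto
      ultimately have "v \<in> mpoly_vs.span (B - {v})"
        using mpoly_vs.span_mono[of "BJ \<union> D" "B - {v}"] by auto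
      then show False using B(3) insert.prems by (auto simp: mpoly_vs.dependent_def)
    qed
    then have "ring.dimension (milnor_algebra f) (Suc (card D)) (c ` range const)
        (ring.line_extension (milnor_algebra f) (c ` range const) (c v) (c ` mpoly_vs.span D))"
      using insert by (intro h.S.dimension.Suc_dim) auto
    moreover have "ring.line_extension (milnor_algebra f) (c ` range const) (c v) (c ` mpoly_vs.span D)
        = c ` mpoly_vs.span (insert v D)"
    proof (intro subset_antisym subsetI)
      fix u assume "u \<in> ring.line_extension (milnor_algebra f) (c ` range const) (c v) (c ` mpoly_vs.span D)"
      then obtain a x where "u = c (const a * v + x)" "x \<in> mpoly_vs.span D"
        by (auto simp: h.S.line_extension_mem_iff c_add c_mult)
      then show "u \<in> c ` mpoly_vs.span (insert v D)"
        by (auto simp: mpoly_vs.span_breakdown_eq mscale_def intro!: imageI exI[of _ a])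
    next
      fix u assume "u \<in> c ` mpoly_vs.span (insert v D)"
      then obtain y a where y: "u = c y" "y - const a * v \<in> mpoly_vs.span D"
        by (auto simp: mpoly_vs.span_breakdown_eq mscale_def)
      then have "u = c (const a) \<otimes>\<^bsub>milnor_algebra f\<^esub> c v \<oplus>\<^bsub>milnor_algebra f\<^esub> c (y - const a * v)"
        by (simp add: c_add c_mult)
      with y(2) show "u \<in> ring.line_extension (milnor_algebra f) (c ` range const) (c v) (c ` mpoly_vs.span D)"
        unfolding h.S.line_extension_mem_iff by blast
    qed
    ultimately show ?case using insert.hyps by simp
  qed
  have "c ` mpoly_vs.span (B - BJ) = c ` S"
  proof (intro subset_antisym subsetI)
    fix u assume "u \<in> c ` S"
    then obtain x where x: "u = c x" "x \<in> mpoly_vs.span (BJ \<union> (B - BJ))"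
      using B(1,4) by (auto simp: Un_absorb1)
    then obtain a b where ab: "x = a + b" "a \<in> mpoly_vs.span BJ" "b \<in> mpoly_vs.span (B - BJ)"
      unfolding mpoly_vs.span_Un by auto
    then have "c x = c b" using spanJ by (auto simp: c_eq_iff)
    with x ab show "u \<in> c ` mpoly_vs.span (B - BJ)" by auto
  qed (use spanS[of "B - BJ"] in auto)
  then have "ring.dimension (milnor_algebra f) (card (B - BJ)) (c ` range const) (milnor_piece f k)"
    using dimension[of "B - BJ"] by (simp add: milnor_piece_def S_def c_def)
  then have "hilbert_fun f k = card (B - BJ)"
    using h.S.dimI[OF K] by (simp add: hilbert_fun_def over_def c_def)
  moreover have "card (B - BJ) + card BJ = card B"
    using finB B(1) by (metis card_Diff_subset card_mono finite_subset le_add_diff_inverse2)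
  moreover have "card B = hdim 0 k"
    using mpoly_vs.dim_unique[of B S] B dim_mpoly_piece by (simp add: S_def)
  ultimately show ?thesis using BJ(4) by (simp add: J_def S_def)
qed

text \<open>
  The component of degree \<open>k\<close> with respect to the grading of \<open>S(-b)\<close>.
\<close>

definition gpart :: "nat \<Rightarrow> nat \<Rightarrow> mpoly \<Rightarrow> mpoly" where
  "gpart b k = part (\<lambda>m. mdeg m + b = k)"

lemma gpart_eq: "gpart b k p = (if b \<le> k then hcomp (k - b) p else 0)"
proof (rule poly_mapping_eqI)
  fix m
  have "mdeg m + b = k \<longleftrightarrow> b \<le> k \<and> mdeg m = k - b" by auto
  then show "coef (gpart b k p) m = coef (if b \<le> k then hcomp (k - b) p else 0) m"
    by (simp add: gpart_def coef_part)
qed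

lemma gpart_mult:
  assumes "if a \<le> b then homogeneous (b - a) r else r = 0"
  shows "gpart a k (r * u) = r * gpart b k u"
proof (cases "a \<le> b")
  case True
  with assms have "homogeneous (b - a) r" by simp
  from hcomp_mult[OF this, of "k - a" u] show ?thesis
    using True by (auto simp: gpart_eq mult.commute)
qed (use assms in \<open>simp add: gpart_def\<close>)

lemma gpart_sum: "gpart a k (sum g A) = (\<Sum>i\<in>A. gpart a k (g i))"
  by (simp add: gpart_def part_sum)

definition piece_proj :: "nat^'n \<Rightarrow> nat \<Rightarrow> mpoly^'n \<Rightarrow> mpoly^'n" where
  "piece_proj b k v = (\<chi> j. gpart (b $ j) k (v $ j))"

lemma piece_proj_in: "piece_proj b k v \<in> graded_piece b k"
  by (simp add: piece_proj_def graded_piece_iff gpart_eq homogeneous_hcomp)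

lemma piece_proj_id:
  assumes "v \<in> graded_piece b k" shows "piece_proj b k v = v"
proof -
  have "gpart (b $ j) k (v $ j) = v $ j" for j
    using assms hcomp_homogeneous[of "k - b $ j" "v $ j" "k - b $ j"]
    by (cases "b $ j \<le> k") (auto simp: graded_piece_iff gpart_eq)
  then show ?thesis by (simp add: piece_proj_def vec_eq_iff)
qed

lemma piece_proj_graded_map:
  "graded_map b a M \<Longrightarrow> piece_proj a k (M *v u) = M *v piece_proj b k u"
  by (auto simp: piece_proj_def graded_map_def vec_eq_iff matrix_vector_mult_def gpart_sum
      intro!: sum.cong gpart_mult)

text \<open>
  A degree-preserving map commutes with the projections to the graded pieces.
\<close>

lemma graded_map_image:
  assumes "graded_map b a M"
  shows "(*v) M ` graded_piece b k = graded_piece a k \<inter> range ((*v) M)"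
proof (intro subset_antisym subsetI)
  fix v assume "v \<in> (*v) M ` graded_piece b k"
  then obtain u where u: "v = M *v u" "u \<in> graded_piece b k" by auto
  then have "v = piece_proj a k (M *v u)"
    by (simp add: piece_proj_graded_map[OF assms] piece_proj_id)
  then show "v \<in> graded_piece a k \<inter> range ((*v) M)"
    using piece_proj_in[of a k "M *v u"] u(1) by auto
next
  fix v assume "v \<in> graded_piece a k \<inter> range ((*v) M)"
  then obtain u where "v = M *v u" "piece_proj a k v = v" by (auto simp: piece_proj_id)
  then have "v = M *v piece_proj b k u" using piece_proj_graded_map[OF assms] by metis
  then show "v \<in> (*v) M ` graded_piece b k" using piece_proj_in by blast
qed

lemma linear_matrix: "Vector_Spaces.linear vscale vscale ((*v) M)"
  by unfold_locales
     (simp_all add: vscale_def vec_eq_iff matrix_vector_mult_def distrib_left sum.distrib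
        sum_distrib_left algebra_simps)

lemma linear_grad_map: "Vector_Spaces.linear vscale mscale (grad_map f)"
  by unfold_locales (simp_all add: vscale_def mscale_def grad_map_add grad_map_smult)

lemma dim_matrix_image:
  fixes M :: "mpoly^'n^'m"
  shows "(\<Sum>j\<in>UNIV. hdim (b $ j) k) = mvec_vs.dim ((*v) M ` graded_piece b k)
    + mvec_vs.dim {v \<in> graded_piece b k. M *v v = 0}"
proof -
  obtain F where "finite F" "graded_piece b k \<subseteq> mvec_vs.span F"
    using graded_piece_finite_span by blast
  from mvec_mvec.dim_image_plus_dim_kernel[OF linear_matrix subspace_graded_piece this]
  show ?thesis by (simp add: dim_graded_piece)
qed

lemma jacobian_piece:
  assumes "homogeneous d f"
  shows "jacobian_ideal f \<inter> {p. homogeneous k p} = grad_map f ` graded_piece (vec (d - 1)) k"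
proof (intro subset_antisym subsetI)
  have *: "gpart 0 k (grad_map f v) = grad_map f (piece_proj (vec (d - 1)) k v)" for v
  proof -
    have "gpart 0 k (pd i f * v $ i) = pd i f * gpart (d - 1) k (v $ i)" for i
      using homogeneous_pd[OF assms, of i] by (intro gpart_mult) simp
    then show ?thesis by (simp add: grad_map_def gpart_sum piece_proj_def mult.commute)
  qed
  fix p assume "p \<in> jacobian_ideal f \<inter> {p. homogeneous k p}"
  then obtain v where "p = grad_map f v" "gpart 0 k p = p"
    by (auto simp: jacobian_ideal_eq gpart_eq hcomp_homogeneous)
  with * have "p = grad_map f (piece_proj (vec (d - 1)) k v)" by simp
  then show "p \<in> grad_map f ` graded_piece (vec (d - 1)) k" using piece_proj_in by blast
next
  fix p assume "p \<in> grad_map f ` graded_piece (vec (d - 1)) k"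
  then obtain v where p: "p = grad_map f v" and v: "v \<in> graded_piece (vec (d - 1)) k" by auto
  have "homogeneous k (v $ i * pd i f)" for i
    using v homogeneous_mult[OF _ homogeneous_pd[OF assms], of "k - (d - 1)" "v $ i" i]
    by (cases "d - 1 \<le> k") (auto simp: graded_piece_iff)
  then show "p \<in> jacobian_ideal f \<inter> {p. homogeneous k p}"
    using p by (auto simp: jacobian_ideal_eq grad_map_def intro: homogeneous_sum)
qed

text \<open>
  The forms of degree \<open>k\<close> in the Jacobian ideal are the image of the gradient map, and its kernel consists of the syzygies.
\<close>

lemma hilbert_fun_syzygies:
  assumes "homogeneous d f" and "2 \<le> d"
  shows "hilbert_fun f k + 4 * hdim (d - 1) k
    = hdim 0 k + mvec_vs.dim {v \<in> graded_piece (vec (d - 1)) k. grad_map f v = 0}"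
proof -
  have "1 \<notin> jacobian_ideal f"
  proof
    assume "1 \<in> jacobian_ideal f"
    then obtain v where "(1::mpoly) = grad_map f v" "v \<in> graded_piece (vec (d - 1)) 0"
      using jacobian_piece[OF assms(1), of 0] homogeneous_1 by blast
    moreover from this(2) have "v = 0" using assms(2) by (auto simp: graded_piece_iff vec_eq_iff)
    ultimately show False by (simp add: grad_map_def)
  qed
  moreover obtain F where "finite F" "graded_piece (vec (d - 1) :: nat^4) k \<subseteq> mvec_vs.span F"
    using graded_piece_finite_span by blast
  from mvec_mpoly.dim_image_plus_dim_kernel[OF linear_grad_map subspace_graded_piece this, of f]
  have "4 * hdim (d - 1) k = mpoly_vs.dim (jacobian_ideal f \<inter> {p. homogeneous k p})
      + mvec_vs.dim {v \<in> graded_piece (vec (d - 1)) k. grad_map f v = 0}"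
    by (simp add: dim_graded_piece jacobian_piece[OF assms(1)])
  ultimately show ?thesis using hilbert_fun_plus_dim[of f k] by simp
qed

section \<open>The weak Nullstellensatz\<close>

definition add_gen :: "'a::comm_ring_1 set \<Rightarrow> 'a \<Rightarrow> 'a set" where
  "add_gen I y = {a + y * r | a r. a \<in> I}"

lemma ring_ideal_add_gen:
  assumes I: "ring_ideal I"
  shows "ring_ideal (add_gen I y)"
  unfolding ring_ideal_def
proof (intro conjI ballI allI)
  show "0 \<in> add_gen I y"
    using ring_ideal_0[OF I] by (force simp: add_gen_def intro: exI[of _ 0])
next
  fix a b assume "a \<in> add_gen I y" "b \<in> add_gen I y"
  then obtain a' r b' s where "a = a' + y * r" "b = b' + y * s" "a' \<in> I" "b' \<in> I"
    by (auto simp: add_gen_def)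
  then have "a + b = (a' + b') + y * (r + s)" "a' + b' \<in> I"
    by (auto simp: algebra_simps intro: ring_ideal_add[OF I])
  then show "a + b \<in> add_gen I y" unfolding add_gen_def by blast
next
  fix r a assume "a \<in> add_gen I y"
  then obtain a' s where "a = a' + y * s" "a' \<in> I" by (auto simp: add_gen_def)
  then have "r * a = r * a' + y * (r * s)" by (simp add: algebra_simps)
  moreover have "r * a' \<in> I" using \<open>a' \<in> I\<close> by (rule ring_ideal_mult[OF I])
  ultimately show "r * a \<in> add_gen I y" unfolding add_gen_def by blast
qed

lemma add_gen_superset: "a \<in> I \<Longrightarrow> a \<in> add_gen I y"
  unfolding add_gen_def by (force intro: exI[of _ 0])

lemma gen_in_add_gen: "ring_ideal I \<Longrightarrow> y \<in> add_gen I y"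
  unfolding add_gen_def by (force dest: ring_ideal_0 intro: exI[of _ 1])

definition poly_at :: "complex poly \<Rightarrow> mpoly \<Rightarrow> mpoly" where
  "poly_at q p = poly (map_poly const q) p"

lemma poly_at_pCons: "poly_at (pCons c q) p = const c + p * poly_at q p"
  by (simp add: poly_at_def map_poly_pCons)

lemma poly_at_0 [simp]: "poly_at 0 p = 0"
  by (simp add: poly_at_def)

lemma poly_at_add: "poly_at (q + r) p = poly_at q p + poly_at r p"
  by (induction q r rule: poly_induct2) (simp_all add: poly_at_pCons const_add algebra_simps)

lemma poly_at_smult: "poly_at (Polynomial.smult c q) p = const c * poly_at q p"
  by (induction q) (simp_all add: poly_at_pCons const_mult algebra_simps)

lemma poly_at_mult: "poly_at (q * r) p = poly_at q p * poly_at r p"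
  by (induction q) (simp_all add: poly_at_pCons poly_at_add poly_at_smult algebra_simps)

lemma poly_at_1 [simp]: "poly_at 1 p = 1"
  using poly_at_pCons[of 1 0 p] by (simp add: one_pCons)

lemma poly_at_sum: "poly_at (sum g A) p = (\<Sum>i\<in>A. poly_at (g i) p)"
  by (induction A rule: infinite_finite_induct) (simp_all add: poly_at_add)

lemma poly_at_prod: "poly_at (prod g A) p = (\<Prod>i\<in>A. poly_at (g i) p)"
  by (induction A rule: infinite_finite_induct) (simp_all add: poly_at_mult)

lemma poly_at_linear: "poly_at [:- c, 1:] p = p - const c"
  by (simp add: poly_at_pCons const_uminus)

text \<open>
  The polynomial \<open>q\<close> splits over the complex numbers, so \<open>q(p)\<close> is a product of factors that are invertible modulo \<open>I\<close>.
\<close>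

lemma poly_at_in_ideal_imp_one:
  assumes I: "ring_ideal I" and inv: "\<And>c. \<exists>u. u * (p - const c) - 1 \<in> I"
    and "q \<noteq> 0" and "poly_at q p \<in> I"
  shows "1 \<in> I"
  using assms(3,4)
proof (induction "Polynomial.degree q" arbitrary: q)
  case 0
  then obtain c where c: "q = [:c:]" "c \<noteq> 0" by (auto elim: degree_eq_zeroE)
  then have "const c \<in> I" using 0 by (simp add: poly_at_pCons)
  from ring_ideal_mult[OF I this, of "const (inverse c)"] c show ?case
    by (simp flip: const_mult)
next
  case (Suc n)
  then have "\<not> constant (poly q)" by (simp add: constant_degree)
  then obtain z where "poly q z = 0" using fundamental_theorem_of_algebra by blast
  then obtain r where r: "q = [:- z, 1:] * r" by (auto simp: poly_eq_0_iff_dvd elim: dvdE)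
  with Suc.prems(1) have "r \<noteq> 0" by auto
  then have "Polynomial.degree q = Suc (Polynomial.degree r)"
    unfolding r by (subst degree_mult_eq) auto
  then have deg: "n = Polynomial.degree r" using Suc.hyps(2) by simp
  obtain u where u: "u * (p - const z) - 1 \<in> I" using inv by blast
  have "u * poly_at q p \<in> I" by (rule ring_ideal_mult[OF I Suc.prems(2)])
  moreover have "poly_at r p * (u * (p - const z) - 1) \<in> I" by (rule ring_ideal_mult[OF I u])
  ultimately have "u * poly_at q p - poly_at r p * (u * (p - const z) - 1) \<in> I"
    by (rule ring_ideal_diff[OF I])
  moreover have "poly_at q p = (p - const z) * poly_at r p"
    by (simp only: r poly_at_mult poly_at_linear)
  ultimately have "poly_at r p \<in> I"
    by (simp add: algebra_simps)
  then show ?case using Suc.hyps(1)[OF deg \<open>r \<noteq> 0\<close>] by simp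
qed

definition up_to :: "nat \<Rightarrow> mpoly set" where
  "up_to n = mpoly_vs.span ((\<lambda>m. monomial m 1) ` {m. mdeg m \<le> n})"

lemma finite_mdeg_le: "finite {m. mdeg m \<le> n}"
proof -
  have "{m. mdeg m \<le> n} = (\<Union>k\<le>n. shifted_monos 0 k)" by (auto simp: shifted_monos_def)
  then show ?thesis by (simp add: finite_shifted_monos)
qed

lemma in_some_up_to: "\<exists>n. p \<in> up_to n"
proof
  have "(\<Sum>m\<in>Poly_Mapping.keys p. mscale (coef p m) (monomial m 1)) \<in> up_to (sum mdeg (Poly_Mapping.keys p))"
    unfolding up_to_def
    by (intro mpoly_vs.span_sum mpoly_vs.span_scale mpoly_vs.span_base)
       (auto intro!: member_le_sum)
  then show "p \<in> up_to (sum mdeg (Poly_Mapping.keys p))"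
    using mpoly_as_sum[of p] by (simp add: mscale_def const_mult_monomial)
qed

text \<open>
  Otherwise every \<open>p - c\<close> has an inverse \<open>u\<^sub>c\<close> modulo \<open>I\<close>. There are uncountably many \<open>c\<close>, and the polynomial ring is a
  countable union of finite-dimensional subspaces, so one of these contains infinitely many \<open>u\<^sub>c\<close>. A linear relation
  among them, multiplied by the product of the \<open>p - c\<close>, becomes a polynomial relation for \<open>p\<close> modulo \<open>I\<close>, and
  then \<open>I\<close> is not proper by the previous lemma.
\<close>

lemma exists_proper_add_gen:
  assumes I: "ring_ideal I" and proper: "1 \<notin> I"
  shows "\<exists>c. 1 \<notin> add_gen I (p - const c)"
proof (rule ccontr)
  assume contra: "\<not> ?thesis"
  have "\<exists>u. u * (p - const c) - 1 \<in> I" for c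
  proof -
    have "1 \<in> add_gen I (p - const c)" using contra by blast
    then obtain a u where "1 = a + (p - const c) * u" "a \<in> I" by (auto simp: add_gen_def)
    then have "u * (p - const c) - 1 = - a" by (simp add: algebra_simps)
    then show ?thesis
      using ring_ideal_uminus[OF I \<open>a \<in> I\<close>] by (intro exI[of _ u]) simp
  qed
  then obtain u where u: "\<And>c. u c * (p - const c) - 1 \<in> I" by metis
  have inj: "inj u"
  proof (rule injI, rule ccontr)
    fix c c' assume eq: "u c = u c'" and ne: "c \<noteq> c'"
    have "(u c * (p - const c) - 1) - (u c' * (p - const c') - 1) \<in> I"
      by (intro ring_ideal_diff[OF I] u)
    then have "u c * const (c' - c) \<in> I" by (simp add: eq const_diff algebra_simps)
    from ring_ideal_mult[OF I this, of "const (inverse (c' - c))"]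
    have "u c * (const (inverse (c' - c)) * const (c' - c)) \<in> I" by (simp add: mult_ac)
    then have "u c \<in> I" using ne by (simp flip: const_mult)
    from ring_ideal_mult[OF I this, of "p - const c"]
    have "u c * (p - const c) \<in> I" by (simp add: mult.commute)
    from ring_ideal_diff[OF I this u[of c]] show False using proper by simp
  qed
  have "\<exists>n. infinite {c. u c \<in> up_to n}"
  proof (rule ccontr)
    assume "\<not> ?thesis"
    then have "countable (\<Union>n. {c. u c \<in> up_to n})"
      by (auto intro!: countable_UN intro: countable_finite)
    moreover have "(\<Union>n. {c. u c \<in> up_to n}) = UNIV" using in_some_up_to by blast
    ultimately have "countable (UNIV :: complex set)" by (simp only:)
    then show False using uncountable_UNIV_complex by blast
  qed
  then obtain n where n: "infinite {c. u c \<in> up_to n}" by blast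
  let ?U = "u ` {c. u c \<in> up_to n}"
  have "infinite ?U"
    using n inj by (auto dest: finite_imageD intro: inj_on_subset)
  moreover have "?U \<subseteq> up_to n" by auto
  ultimately have "mpoly_vs.dependent ?U"
    using mpoly_vs.independent_span_bound[of "(\<lambda>m. monomial m 1) ` {m. mdeg m \<le> n}" ?U]
      finite_mdeg_le[of n] unfolding up_to_def by blast
  then obtain t w where t: "finite t" "t \<subseteq> ?U" "(\<Sum>v\<in>t. mscale (w v) v) = 0" "\<exists>v\<in>t. w v \<noteq> 0"
    unfolding mpoly_vs.dependent_explicit by blast
  obtain T where T: "t = u ` T" "finite T"
    using t(1,2) by (metis finite_subset_image)
  \<comment> \<open>The relation is indexed by \<open>c\<close> again, which is possible because the \<open>u\<^sub>c\<close> are distinct.\<close>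
  define l where "l c = w (u c)" for c
  have sum0: "(\<Sum>c\<in>T. const (l c) * u c) = 0"
    using t(3) inj unfolding T(1) mscale_def l_def
    by (subst (asm) sum.reindex) (auto intro: inj_on_subset)
  obtain c0 where c0: "c0 \<in> T" "l c0 \<noteq> 0" using t(4) by (auto simp: T(1) l_def)
  \<comment> \<open>The value of \<open>q\<close> at \<open>c0\<close> is nonzero, and modulo \<open>I\<close> it represents the product of all \<open>p - c\<close> times the relation.\<close>
  define q where "q = (\<Sum>c\<in>T. Polynomial.smult (l c) (\<Prod>b\<in>T - {c}. [:- b, 1:]))"
  have "poly q c0 = (\<Sum>c\<in>T. if c = c0 then l c0 * (\<Prod>b\<in>T - {c0}. c0 - b) else 0)"
    unfolding q_def poly_sum poly_smult poly_prod using T(2) c0(1)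
    by (intro sum.cong) auto
  also have "\<dots> = l c0 * (\<Prod>b\<in>T - {c0}. c0 - b)" using T(2) c0(1) by simp
  also have "\<dots> \<noteq> 0" using T(2) c0(2) by auto
  finally have "q \<noteq> 0" by auto
  have "poly_at q p - (\<Prod>b\<in>T. p - const b) * (\<Sum>c\<in>T. const (l c) * u c) \<in> I"
  proof -
    have "poly_at q p - (\<Prod>b\<in>T. p - const b) * (\<Sum>c\<in>T. const (l c) * u c)
        = (\<Sum>c\<in>T. - (const (l c) * (\<Prod>b\<in>T - {c}. p - const b)) * (u c * (p - const c) - 1))"
      unfolding q_def poly_at_sum sum_distrib_left sum_subtractf[symmetric]
    proof (rule sum.cong[OF refl])
      fix c assume "c \<in> T"
      then have eq: "(\<Prod>b\<in>T. p - const b) = (p - const c) * (\<Prod>b\<in>T - {c}. p - const b)"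
        using prod.remove[OF T(2) \<open>c \<in> T\<close>] by simp
      then show "poly_at (Polynomial.smult (l c) (\<Prod>b\<in>T - {c}. [:- b, 1:])) p - (\<Prod>b\<in>T. p - const b) * (const (l c) * u c)
          = - (const (l c) * (\<Prod>b\<in>T - {c}. p - const b)) * (u c * (p - const c) - 1)"
        by (simp only: eq poly_at_smult poly_at_prod poly_at_linear) (simp add: algebra_simps)
    qed
    also have "\<dots> \<in> I" by (intro ring_ideal_sum[OF I] ring_ideal_mult[OF I] u)
    finally show ?thesis .
  qed
  then have "poly_at q p \<in> I" by (simp add: sum0)
  then have "1 \<in> I"
    using u \<open>q \<noteq> 0\<close> by (intro poly_at_in_ideal_imp_one[OF I, of p q]) auto
  then show False using proper by simp
qed

text \<open>
  Modulo an ideal that contains all \<open>x\<^sub>i - v\<^sub>i\<close> every polynomial equals its value at \<open>v\<close>.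
\<close>

lemma mod_vars_eq_eval:
  assumes I: "ring_ideal I" and v: "\<And>i. var i - const (v i) \<in> I"
  shows "p - const (eval_at v p) \<in> I"
proof (induction p rule: mpoly_induct)
  case (add p q)
  from ring_ideal_add[OF I this] show ?case
    by (simp add: eval_at_add const_add algebra_simps)
next
  case (monomial m c)
  have mult: "x * y - const (a * b) \<in> I" if "x - const a \<in> I" "y - const b \<in> I" for x y a b
  proof -
    have "x * y - const (a * b) = y * (x - const a) + const a * (y - const b)"
      by (simp add: const_mult algebra_simps)
    then show ?thesis using that by (auto intro: ring_ideal_add[OF I] ring_ideal_mult[OF I])
  qed
  have pow: "x ^ n - const (a ^ n) \<in> I" if "x - const a \<in> I" for x a and n :: nat
    by (induction n) (auto intro: mult that ring_ideal_0[OF I])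
  have prod: "(\<Prod>i\<in>A. x i) - const (\<Prod>i\<in>A. a i) \<in> I" if "\<And>i. x i - const (a i) \<in> I" for A :: "4 set" and x a
    by (induction A rule: infinite_finite_induct) (auto intro: mult that ring_ideal_0[OF I])
  have "monomial m c = const c * (\<Prod>i\<in>UNIV. var i ^ Poly_Mapping.lookup m i)"
  proof -
    have single_pow: "var i ^ n = monomial (Poly_Mapping.single i n) 1" for i n
      by (induction n) (simp_all add: var_def mult_single flip: single_add)
    have "(\<Prod>i\<in>A. monomial (Poly_Mapping.single i (Poly_Mapping.lookup m i)) 1)
        = monomial (\<Sum>i\<in>A. Poly_Mapping.single i (Poly_Mapping.lookup m i)) (1::complex)" for A
      by (induction A rule: infinite_finite_induct) (simp_all add: mult_single)
    moreover have "(\<Sum>i\<in>UNIV. Poly_Mapping.single i (Poly_Mapping.lookup m i)) = m"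
      by (rule poly_mapping_eqI) (simp add: lookup_sum lookup_single when_def)
    ultimately show ?thesis by (simp add: single_pow const_mult_monomial)
  qed
  moreover have "const c * (\<Prod>i\<in>UNIV. var i ^ Poly_Mapping.lookup m i)
      - const (c * (\<Prod>i\<in>UNIV. v i ^ Poly_Mapping.lookup m i)) \<in> I"
    by (intro mult prod pow v) (simp add: ring_ideal_0[OF I])
  ultimately have "monomial m c - const (c * (\<Prod>i\<in>UNIV. v i ^ Poly_Mapping.lookup m i)) \<in> I"
    by simp
  then show ?case by (simp only: eval_at_monomial)
qed

text \<open>
  Adjoining suitable \<open>x\<^sub>i - v\<^sub>i\<close> one variable after the other keeps the ideal proper; modulo the result a
  polynomial in \<open>I\<close> equals its value at \<open>v\<close>, which must therefore be zero.
\<close>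

lemma weak_nullstellensatz:
  assumes I: "ring_ideal I" and proper: "1 \<notin> I"
  shows "\<exists>v. \<forall>p\<in>I. eval_at v p = 0"
proof -
  have "\<exists>J v. ring_ideal J \<and> 1 \<notin> J \<and> I \<subseteq> J \<and> (\<forall>i\<in>A. var i - const (v i) \<in> J)" if "finite A" for A :: "4 set"
    using that
  proof (induction A rule: finite_induct)
    case empty
    then show ?case using I proper by blast
  next
    case (insert i A)
    then obtain J v where J: "ring_ideal J" "1 \<notin> J" "I \<subseteq> J" "\<forall>i\<in>A. var i - const (v i) \<in> J" by blast
    obtain c where c: "1 \<notin> add_gen J (var i - const c)"
      using exists_proper_add_gen[OF J(1,2)] by blast
    have "\<forall>j\<in>insert i A. var j - const ((v(i := c)) j) \<in> add_gen J (var i - const c)"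
      using J(4) insert.hyps(2) by (auto intro: add_gen_superset gen_in_add_gen[OF J(1)])
    moreover have "I \<subseteq> add_gen J (var i - const c)" using J(3) by (auto intro: add_gen_superset)
    ultimately show ?case using c ring_ideal_add_gen[OF J(1)] by blast
  qed
  from this[of UNIV] obtain J v where J: "ring_ideal J" "1 \<notin> J" "I \<subseteq> J" and v: "\<And>i. var i - const (v i) \<in> J"
    by auto
  have "eval_at v p = 0" if "p \<in> I" for p
  proof (rule ccontr)
    assume nz: "eval_at v p \<noteq> 0"
    have "p - (p - const (eval_at v p)) \<in> J"
      by (rule ring_ideal_diff[OF J(1)]) (use that J(3) mod_vars_eq_eval[OF J(1) v] in auto)
    then have "const (inverse (eval_at v p)) * const (eval_at v p) \<in> J"
      by (intro ring_ideal_mult[OF J(1)]) simp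
    then show False using nz J(2) by (simp flip: const_mult)
  qed
  then show ?thesis by blast
qed

section \<open>Determinants and the degrees of a resolution\<close>

lemma coef_0_mult: "coef (p * q) 0 = coef p 0 * coef q 0"
proof -
  have "coef p 0 = eval_at (\<lambda>_. 0) p" for p
  proof (rule additive_eqI[where F = "\<lambda>p. coef p 0"])
    fix m c
    show "coef (monomial m c) 0 = eval_at (\<lambda>_. 0) (monomial m c)"
    proof (cases "m = 0")
      case False
      then obtain i where "Poly_Mapping.lookup m i \<noteq> 0" using lookup_nonzero by blast
      then have "(\<Prod>i\<in>UNIV. (0::complex) ^ Poly_Mapping.lookup m i) = 0"
        by (intro prod_zero) (auto intro: bexI[of _ i])
      with False show ?thesis by (simp add: eval_at_monomial lookup_single)
    qed (simp add: eval_at_monomial)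
  qed (simp_all add: lookup_add eval_at_add)
  then show ?thesis by (simp add: eval_at_mult)
qed

definition replace_row :: "'n \<Rightarrow> 'a^'n \<Rightarrow> 'a^'n^'n \<Rightarrow> 'a^'n^'n" where
  "replace_row p w M = (\<chi> t. if t = p then w else M $ t)"

lemma det_replace_row_sum:
  fixes M :: "'a::comm_ring_1^'n::finite^'n" and c :: "'k::finite \<Rightarrow> 'a"
  shows "det (replace_row p (\<Sum>j\<in>UNIV. c j *s v j) M) = (\<Sum>j\<in>UNIV. c j * det (replace_row p (v j) M))"
  unfolding replace_row_def
  using det_linear_row_sum[of UNIV p "\<lambda>_ j. c j *s v j" "\<lambda>t. M $ t"]
  by (simp add: det_row_mul[of p _ "\<lambda>_. v j" for j])

lemma det_replace_row_other: "l \<noteq> p \<Longrightarrow> det (replace_row p (M $ l) M) = 0"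
  for M :: "'a::comm_ring_1^'n::finite^'n"
  by (rule det_identical_rows[of p l]) (auto simp: row_def replace_row_def vec_eq_iff)

lemma replace_row_self: "replace_row p (M $ p) M = M"
  by (simp add: replace_row_def vec_eq_iff)

lemma det_replace_row_comb: "det (replace_row p (\<Sum>i\<in>UNIV. x i *s M $ i) M) = x p * det M"
  for M :: "'a::comm_ring_1^'n::finite^'n"
proof -
  have "(\<Sum>i\<in>UNIV. x i * det (replace_row p (M $ i) M)) = (\<Sum>i\<in>UNIV. if i = p then x p * det M else 0)"
    by (intro sum.cong refl) (auto simp: det_replace_row_other replace_row_self)
  then show ?thesis by (simp add: det_replace_row_sum)
qed

lemma axis_expansion:
  fixes w :: "'a::comm_ring_1^'n::finite"
  shows "w = (\<Sum>j\<in>UNIV. w $ j *s axis j 1)"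
proof -
  have "(\<Sum>j\<in>UNIV. w $ j *s axis j (1::'a)) $ k = (\<Sum>j\<in>UNIV. if j = k then w $ k else 0)" for k
    unfolding sum_component by (intro sum.cong refl) (auto simp: axis_def)
  then show ?thesis by (simp add: vec_eq_iff)
qed

text \<open>
  Column \<open>p\<close> of the adjugate of \<open>M\<close>. Describing the cofactors by replaced rows reduces all facts below to
  the multilinearity of the determinant.
\<close>

definition adj :: "'a::comm_ring_1^'n::finite^'n \<Rightarrow> 'n \<Rightarrow> 'a^'n" where
  "adj M p = (\<chi> j. det (replace_row p (axis j 1) M))"

lemma det_replace_row_adj: "det (replace_row p w M) = (\<Sum>j\<in>UNIV. w $ j * adj M p $ j)"
  by (subst axis_expansion[of w]) (simp only: det_replace_row_sum, simp add: adj_def)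

lemma matrix_adj: "M *v adj M p = axis p (det M)"
proof -
  have "(M *v adj M p) $ l = det (replace_row p (M $ l) M)" for l
    by (simp add: matrix_vector_mult_def det_replace_row_adj)
  then show ?thesis
    by (auto simp: vec_eq_iff axis_def det_replace_row_other replace_row_self)
qed

text \<open>
  A linear relation \<open>\<Sum>t. x\<^sub>t M\<^sub>t = 0\<close> between the rows makes the columns of the adjugate proportional to \<open>x\<close>. In
  the determinant with row \<open>p\<close> replaced by a unit vector, multiply row \<open>i\<close> by \<open>x\<^sub>i\<close> and substitute the relation:
  only the term with row \<open>p\<close> survives, and swapping two rows gives the cofactor for \<open>i\<close>.
\<close>

lemma adj_proportional:
  fixes M :: "'a::comm_ring_1^'n::finite^'n"
  assumes syz: "(\<Sum>t\<in>UNIV. x t *s M $ t) = 0"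
  shows "x i * adj M p $ j = x p * adj M i $ j"
proof (cases "i = p")
  case False
  \<comment> \<open>The determinant as an alternating form in rows \<open>i\<close> and \<open>p\<close>.\<close>
  define D where "D u v = det (replace_row i u (replace_row p v M))" for u v
  have swap: "replace_row i u (replace_row p v M) = replace_row p v (replace_row i u M)" for u v
    using False by (auto simp: replace_row_def vec_eq_iff)
  have D_self: "D u u = 0" for u
    unfolding D_def using False
    by (intro det_identical_rows[of i p]) (auto simp: row_def replace_row_def vec_eq_iff)
  have D_add1: "D (u + u') v = D u v + D u' v" for u u' v
    unfolding D_def replace_row_def by (rule det_row_add[where a = "\<lambda>_. u"])
  have D_add2: "D u (v + v') = D u v + D u v'" for u v v'
    unfolding D_def swap unfolding replace_row_def by (rule det_row_add[where a = "\<lambda>_. v"])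
  have D_swap: "D v u = - D u v" for u v
  proof -
    have "D u v + D v u = D (u + v) (u + v)"
      by (simp only: D_add1 D_add2) (simp add: D_self)
    then show ?thesis by (simp add: D_self eq_neg_iff_add_eq_0 add.commute)
  qed
  let ?e = "axis j 1 :: 'a^'n"
  define N where "N = replace_row p ?e M"
  have adj_p: "adj M p $ j = D (M $ i) ?e" 
    using False by (auto simp: adj_def D_def replace_row_def vec_eq_iff intro!: arg_cong[of _ _ det])
  have adj_i: "adj M i $ j = D ?e (M $ p)"
    using False by (auto simp: adj_def D_def replace_row_def vec_eq_iff intro!: arg_cong[of _ _ det])
  have "0 = det (replace_row i 0 N)"
    using det_replace_row_sum[of i "\<lambda>_. 0" "\<lambda>_. 0" N] by simp
  also have "\<dots> = (\<Sum>t\<in>UNIV. x t * D (M $ t) ?e)"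
    unfolding syz[symmetric] det_replace_row_sum by (simp add: D_def N_def)
  also have "\<dots> = (\<Sum>t\<in>{i, p}. x t * D (M $ t) ?e)"
  proof (rule sum.mono_neutral_right)
    show "\<forall>t\<in>UNIV - {i, p}. x t * D (M $ t) ?e = 0"
    proof
      fix t assume t: "t \<in> UNIV - {i, p}"
      then have "M $ t = N $ t" by (simp add: N_def replace_row_def)
      then have "D (M $ t) ?e = 0"
        using t det_replace_row_other[of t i N] by (simp add: D_def N_def)
      then show "x t * D (M $ t) ?e = 0" by simp
    qed
  qed auto
  also have "\<dots> = x i * adj M p $ j - x p * adj M i $ j"
    using False by (simp add: adj_p adj_i D_swap[of ?e])
  finally show ?thesis by simp
qed simp

text \<open>
  If the image of \<open>M\<close> contains the vectors \<open>a\<^sub>p e\<^sub>j - a\<^sub>j e\<^sub>p\<close>, then \<open>M\<close> has a nonzero minor of size \<open>n - 1\<close>. To see this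
  with square matrices, replace row \<open>p\<close> of \<open>M\<close> by a unit vector on which the kernel vector \<open>c\<close> does not vanish, and
  multiply by the matrix with columns \<open>u\<^sub>j\<close> and, in place \<open>p\<close>, \<open>c\<close>. Apart from row \<open>p\<close> the product is
  diagonal, with nonzero entries, so its determinant is not zero.
\<close>

lemma adj_nonzero:
  fixes M :: "'a::idom^'n::finite^'n"
  assumes a: "a p \<noteq> 0" and c: "M *v c = 0" "c \<noteq> 0"
    and u: "\<And>j. j \<noteq> p \<Longrightarrow> M *v u j = axis j (a p) - axis p (a j)"
  shows "adj M p \<noteq> 0"
proof
  assume zero: "adj M p = 0"
  obtain j0 where j0: "c $ j0 \<noteq> 0" using c(2) by (auto simp: vec_eq_iff)
  define M' where "M' = replace_row p (axis j0 1) M"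
  define U where "U = (\<chi> k j. if j = p then c $ k else u j $ k)"
  define Q where "Q = M' ** U"
  have "det M' = 0" by (simp add: M'_def det_replace_row_adj zero)
  then have det0: "det Q = 0" by (simp add: Q_def det_mul)
  have Q_col: "Q $ l $ j = (M' *v (if j = p then c else u j)) $ l" for l j
    by (simp add: Q_def U_def matrix_matrix_mult_def matrix_vector_mult_def)
  have M'_row: "(M' *v v) $ l = (M *v v) $ l" if "l \<noteq> p" for l v
    using that by (simp add: M'_def replace_row_def matrix_vector_mult_def)
  have Q_row: "Q $ l = a p *s axis l 1" if "l \<noteq> p" for l
    using that by (auto simp: vec_eq_iff Q_col M'_row c(1) u axis_def)
  have "Q $ p $ p = (\<Sum>k\<in>UNIV. axis j0 1 $ k * c $ k)"
    by (simp add: Q_col M'_def replace_row_def matrix_vector_mult_def)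
  also have "\<dots> = (\<Sum>k\<in>UNIV. if k = j0 then c $ j0 else 0)"
    by (intro sum.cong) (auto simp: axis_def)
  finally have Q_pp: "Q $ p $ p = c $ j0" by simp
  have adj_Q: "adj Q p $ j = 0" if "j \<noteq> p" for j
  proof -
    have "0 = det (replace_row p (Q $ j) Q)" using det_replace_row_other[OF that] by simp
    also have "\<dots> = a p * adj Q p $ j"
      unfolding det_replace_row_adj by (simp add: Q_row[OF that] axis_def if_distrib if_distribR cong: if_cong)
    finally show ?thesis using a by simp
  qed
  have "adj Q p $ p = (\<Prod>i\<in>UNIV. replace_row p (axis p 1) Q $ i $ i)"
    unfolding adj_def vec_lambda_beta
    by (rule det_diagonal) (auto simp: replace_row_def axis_def Q_row)
  also have "\<dots> \<noteq> 0"
    using a by (auto simp: replace_row_def Q_row axis_def)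
  finally have "adj Q p $ p \<noteq> 0" .
  moreover have "det Q = c $ j0 * adj Q p $ p"
  proof -
    have "det Q = (\<Sum>j\<in>UNIV. Q $ p $ j * adj Q p $ j)"
      using det_replace_row_adj[of p "Q $ p" Q] unfolding replace_row_self .
    also have "\<dots> = (\<Sum>j\<in>UNIV. if j = p then c $ j0 * adj Q p $ p else 0)"
      by (intro sum.cong refl) (auto simp: adj_Q Q_pp)
    finally show ?thesis by simp
  qed
  ultimately show False using det0 j0 by simp
qed

text \<open>
  The exponents with \<open>d\<^sub>3\<close> repeated, as they occur in the resolution.
\<close>

definition shifts :: "nat \<Rightarrow> nat \<Rightarrow> nat \<Rightarrow> 4 \<Rightarrow> nat" where
  "shifts d1 d2 d3 j = (if j = 1 then d1 else if j = 2 then d2 else d3)"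

lemma vector_4:
  "(vector [x, y, z, w] :: 'a::zero^4) $ 1 = x" "(vector [x, y, z, w] :: 'a::zero^4) $ 2 = y"
  "(vector [x, y, z, w] :: 'a::zero^4) $ 3 = z" "(vector [x, y, z, w] :: 'a::zero^4) $ 4 = w"
  by (simp_all add: vector_def)

lemma vector_shifts:
  "(vector [d1 + e, d2 + e, d3 + e, d3 + e] :: nat^4) $ j = shifts d1 d2 d3 j + e"
  using exhaust_4[of j] by (auto simp: shifts_def vector_4)

text \<open>
  The part of a resolution that describes the syzygies of the gradient of \<open>f\<close> itself, in place of those of an
  arbitrary system of generators of the Jacobian ideal.
\<close>

definition syzygy_resolution :: "nat \<Rightarrow> mpoly \<Rightarrow> (4 \<Rightarrow> nat) \<Rightarrow> nat \<Rightarrow> mpoly^4^4 \<Rightarrow> mpoly^1^4 \<Rightarrow> bool" where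
  "syzygy_resolution d f s t B C \<longleftrightarrow>
     graded_map (\<chi> j. s j + (d - 1)) (vec (d - 1)) B \<and> graded_map (vec t) (\<chi> j. s j + (d - 1)) C \<and>
     minimal_map C \<and> range ((*v) B) = {v. grad_map f v = 0} \<and>
     range ((*v) C) = {v. B *v v = 0} \<and> {v. C *v v = 0} = {0}"

text \<open>
  The entries \<open>\<alpha>\<^sub>i\<close> of the first map and the partial derivatives of \<open>f\<close> generate the same ideal and have the same degree,
  so they are related by constant matrices \<open>g\<close> and \<open>c\<close>. By minimality no syzygy of the \<open>\<alpha>\<^sub>i\<close> has a constant
  component, so the \<open>\<alpha>\<^sub>i\<close> are linearly independent over the complex numbers; hence \<open>g\<close> and \<open>c\<close> are inverse
  to each other and \<open>B\<close> can be transformed by \<open>g\<close>.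
\<close>

lemma nearly_free_resolution:
  assumes "nearly_free d f d1 d2 d3"
  shows "\<exists>B C. syzygy_resolution d f (shifts d1 d2 d3) (d3 + d) B C"
    and "(\<Sum>j\<in>UNIV. const (t j) * pd j f) = 0 \<Longrightarrow> t j = 0"
proof -
  define e where "e = d - 1"
  have hom: "homogeneous d f" using assms by (simp add: nearly_free_def)
  have shifts: "(vector [d1 + e, d2 + e, d3 + e, d3 + e] :: nat^4) = (\<chi> j. shifts d1 d2 d3 j + e)"
    by (simp add: vec_eq_iff vector_shifts)
  obtain A :: "mpoly^4^1" and B :: "mpoly^4^4" and C :: "mpoly^1^4"
    where res: "minimal_graded_free_resolution (jacobian_ideal f) (vec e)
        (\<chi> j. shifts d1 d2 d3 j + e) (vec (d3 + d)) A B C"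
    using assms unfolding nearly_free_def shifts e_def[symmetric] by blast
  define \<alpha> where "\<alpha> i = A $ 1 $ i" for i
  have A_mult: "(A *v v) $ 1 = (\<Sum>i\<in>UNIV. \<alpha> i * v $ i)" for v
    by (simp add: \<alpha>_def matrix_vector_mult_def)
  have \<alpha>_hom: "homogeneous e (\<alpha> i)" for i
    using res by (simp add: minimal_graded_free_resolution_def graded_map_def \<alpha>_def)
  have pd_hom: "homogeneous e (pd i f)" for i
    using homogeneous_pd[OF hom] by (simp add: e_def)
  have rangeA: "range ((*v) A) = {v. v $ 1 \<in> jacobian_ideal f}"
    and rangeB: "range ((*v) B) = {v. A *v v = 0}"
    using res by (auto simp: minimal_graded_free_resolution_def)
  have deg0: "p = (\<Sum>j\<in>UNIV. const (coef (v $ j) 0) * q j)"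
    if "homogeneous e p" "\<And>j. homogeneous e (q j)" "p = (\<Sum>j\<in>UNIV. v $ j * q j)" for p q and v :: "mpoly^4"
  proof -
    have "p = hcomp e p" using that(1) by (simp add: hcomp_homogeneous)
    also have "\<dots> = (\<Sum>j\<in>UNIV. hcomp e (v $ j * q j))" by (simp add: that(3) part_sum)
    also have "\<dots> = (\<Sum>j\<in>UNIV. const (coef (v $ j) 0) * q j)"
      by (simp only: hcomp_mult[OF that(2)] less_irrefl if_False diff_self_eq_0 hcomp_0)
    finally show ?thesis .
  qed
  have "\<exists>g. \<alpha> i = (\<Sum>j\<in>UNIV. const (g j) * pd j f)" for i
  proof -
    have "A *v axis i 1 \<in> {v. v $ 1 \<in> jacobian_ideal f}" unfolding rangeA[symmetric] by blast
    then have "\<alpha> i \<in> jacobian_ideal f"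
      by (simp add: matrix_vector_mult_def \<alpha>_def axis_def if_distrib cong: if_cong)
    then obtain v where "\<alpha> i = (\<Sum>j\<in>UNIV. v $ j * pd j f)"
      by (auto simp: jacobian_ideal_eq grad_map_def)
    from deg0[OF \<alpha>_hom pd_hom this] show ?thesis by (intro exI)
  qed
  then obtain g where g: "\<And>i. \<alpha> i = (\<Sum>j\<in>UNIV. const (g i j) * pd j f)" by metis
  have "\<exists>c. pd j f = (\<Sum>i\<in>UNIV. const (c i) * \<alpha> i)" for j
  proof -
    have "vec (pd j f) \<in> range ((*v) A)" unfolding rangeA by (simp add: pd_in_jacobian)
    then obtain v where "vec (pd j f) = A *v v" by blast
    then have "pd j f = (A *v v) $ 1" by (metis vec_component)
    then have "pd j f = (\<Sum>i\<in>UNIV. v $ i * \<alpha> i)" by (simp add: A_mult mult.commute)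
    from deg0[OF pd_hom \<alpha>_hom this] show ?thesis by (intro exI)
  qed
  then obtain c where c: "\<And>j. pd j f = (\<Sum>i\<in>UNIV. const (c j i) * \<alpha> i)" by metis
  have indep: "t i = 0" if "(\<Sum>i\<in>UNIV. const (t i) * \<alpha> i) = 0" for t i
  proof -
    have "A *v (\<chi> i. const (t i)) = 0"
      using that by (simp add: vec_eq_iff forall_1 A_mult mult.commute)
    then obtain u where "(\<chi> i. const (t i)) = B *v u" using rangeB by blast
    then have "const (t i) = (\<Sum>k\<in>UNIV. B $ i $ k * u $ k)"
      by (simp add: vec_eq_iff matrix_vector_mult_def)
    then have "coef (const (t i)) 0 = (\<Sum>k\<in>UNIV. coef (B $ i $ k) 0 * coef (u $ k) 0)"
      by (simp add: lookup_sum coef_0_mult)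
    also have "\<dots> = 0"
      using res by (simp add: minimal_graded_free_resolution_def minimal_map_def)
    finally show ?thesis by (simp add: coef_const)
  qed
  have gc: "(\<Sum>j\<in>UNIV. g i j * c j l) = (if i = l then 1 else 0)" for i l
  proof -
    have "\<alpha> i = (\<Sum>j\<in>UNIV. \<Sum>l\<in>UNIV. const (g i j * c j l) * \<alpha> l)"
      by (subst g, subst c) (simp add: sum_distrib_left const_mult mult.assoc)
    also have "\<dots> = (\<Sum>l\<in>UNIV. const (\<Sum>j\<in>UNIV. g i j * c j l) * \<alpha> l)"
      by (subst sum.swap) (simp add: const_sum sum_distrib_right)
    finally have 1: "\<alpha> i = (\<Sum>l\<in>UNIV. const (\<Sum>j\<in>UNIV. g i j * c j l) * \<alpha> l)" .
    have "(\<Sum>l\<in>UNIV. const (if i = l then 1 else 0) * \<alpha> l) = \<alpha> i"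
      by (simp add: if_distrib if_distribR cong: if_cong)
    with 1 have "(\<Sum>l\<in>UNIV. const ((\<Sum>j\<in>UNIV. g i j * c j l) - (if i = l then 1 else 0)) * \<alpha> l) = 0"
      by (simp only: const_diff left_diff_distrib sum_subtractf) simp
    from indep[OF this, of l] show ?thesis by simp
  qed
  have cg: "(\<Sum>i\<in>UNIV. c j i * g i l) = (if j = l then 1 else 0)" for j l
  proof -
    have "(\<chi> i j. g i j) ** (\<chi> i j. c i j) = mat 1"
      by (simp add: matrix_matrix_mult_def mat_def vec_eq_iff gc)
    then have "(\<chi> i j. c i j) ** (\<chi> i j. g i j) = mat 1"
      by (simp add: matrix_left_right_inverse)
    then show ?thesis by (simp add: matrix_matrix_mult_def mat_def vec_eq_iff)
  qed
  show "t j = 0" if "(\<Sum>j\<in>UNIV. const (t j) * pd j f) = 0" for j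
  proof -
    have "(\<Sum>j\<in>UNIV. const (t j) * pd j f) = (\<Sum>i\<in>UNIV. const (\<Sum>j\<in>UNIV. t j * c j i) * \<alpha> i)"
      unfolding const_sum sum_distrib_right
      by (subst c, subst sum.swap) (simp add: sum_distrib_left const_mult mult.assoc)
    then have "(\<Sum>i\<in>UNIV. const (\<Sum>j\<in>UNIV. t j * c j i) * \<alpha> i) = 0" using that by simp
    from indep[OF this] have z: "(\<Sum>j\<in>UNIV. t j * c j i) = 0" for i .
    have "t j = (\<Sum>k\<in>UNIV. t k * (if k = j then 1 else 0))"
      by (simp add: if_distrib cong: if_cong)
    also have "\<dots> = (\<Sum>i\<in>UNIV. (\<Sum>k\<in>UNIV. t k * c k i) * g i j)"
      unfolding cg[symmetric] sum_distrib_left sum_distrib_right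
      by (subst sum.swap) (simp add: mult.assoc)
    finally show ?thesis by (simp add: z)
  qed
  \<comment> \<open>Coordinate changes between syzygies of the \<open>\<alpha>\<^sub>i\<close> and syzygies of the gradient.\<close>
  define to where "to v = (\<chi> j. \<Sum>i\<in>UNIV. const (g i j) * v $ i)" for v :: "mpoly^4"
  define from' where "from' v = (\<chi> i. \<Sum>j\<in>UNIV. const (c j i) * v $ j)" for v :: "mpoly^4"
  have to_from: "to (from' v) = v" for v
  proof -
    have "to (from' v) $ l = (\<Sum>j\<in>UNIV. const (\<Sum>i\<in>UNIV. c j i * g i l) * v $ j)" for l
      unfolding to_def from'_def vec_lambda_beta sum_distrib_left
      by (subst sum.swap) (simp add: sum_distrib_left sum_distrib_right const_sum const_mult mult_ac)
    then show ?thesis by (simp add: vec_eq_iff cg if_distrib if_distribR cong: if_cong)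
  qed
  have from_to: "from' (to v) = v" for v
  proof -
    have "from' (to v) $ l = (\<Sum>i\<in>UNIV. const (\<Sum>j\<in>UNIV. g i j * c j l) * v $ i)" for l
      unfolding to_def from'_def vec_lambda_beta sum_distrib_left
      by (subst sum.swap) (simp add: sum_distrib_left sum_distrib_right const_sum const_mult mult_ac)
    then show ?thesis by (simp add: vec_eq_iff gc if_distrib if_distribR cong: if_cong)
  qed
  have grad_to: "grad_map f (to v) = (A *v v) $ 1" for v
    unfolding grad_map_def to_def A_mult g vec_lambda_beta sum_distrib_right
    by (subst sum.swap) (simp add: mult_ac)
  have zero_iff: "A *v v = 0 \<longleftrightarrow> grad_map f (to v) = 0" for v
    by (simp add: grad_to vec_eq_iff forall_1)
  define B' where "B' = (\<chi> j k. \<Sum>i\<in>UNIV. const (g i j) * B $ i $ k)"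
  have B': "B' *v u = to (B *v u)" for u
  proof -
    have "(B' *v u) $ j = to (B *v u) $ j" for j
      unfolding B'_def to_def matrix_vector_mult_def vec_lambda_beta sum_distrib_left sum_distrib_right
      by (subst sum.swap) (simp add: mult.assoc)
    then show ?thesis by (simp add: vec_eq_iff)
  qed
  have "syzygy_resolution d f (shifts d1 d2 d3) (d3 + d) B' C"
    unfolding syzygy_resolution_def e_def[symmetric]
  proof (intro conjI)
    show "graded_map (\<chi> j. shifts d1 d2 d3 j + e) (vec e) B'"
      using res unfolding minimal_graded_free_resolution_def graded_map_def B'_def
      by (auto intro!: homogeneous_sum homogeneous_const_mult)
    show "range ((*v) B') = {v. grad_map f v = 0}"
    proof (intro subset_antisym subsetI)
      fix v assume "v \<in> range ((*v) B')"
      then obtain u where "v = to (B *v u)" by (auto simp: B')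
      moreover have "A *v (B *v u) = 0" using rangeB by blast
      ultimately show "v \<in> {v. grad_map f v = 0}" by (simp add: zero_iff)
    next
      fix v assume "v \<in> {v. grad_map f v = 0}"
      then have "A *v from' v = 0" by (simp add: zero_iff to_from)
      then obtain u where "from' v = B *v u" using rangeB by blast
      then have "v = B' *v u" by (metis B' to_from)
      then show "v \<in> range ((*v) B')" by blast
    qed
    have "B' *v u = 0 \<longleftrightarrow> B *v u = 0" for u
    proof -
      have "to 0 = 0" "from' 0 = 0" by (simp_all add: to_def from'_def vec_eq_iff)
      then show ?thesis unfolding B' by (metis from_to)
    qed
    then show "range ((*v) C) = {v. B' *v v = 0}"
      using res by (simp add: minimal_graded_free_resolution_def)
  qed (use res in \<open>simp_all add: minimal_graded_free_resolution_def\<close>)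
  then show "\<exists>B C. syzygy_resolution d f (shifts d1 d2 d3) (d3 + d) B C" by blast
qed


text \<open>
  Each nonzero product in the expansion takes one entry from every column except \<open>j\<close>.
\<close>

lemma homogeneous_det_replace_row:
  fixes M :: "mpoly^'n::finite^'n"
  assumes "\<And>i k. homogeneous (s k) (M $ i $ k)"
  shows "homogeneous (sum s UNIV - s j) (adj M p $ j)"
proof -
  let ?N = "replace_row p (axis j 1) M"
  have "homogeneous (sum s UNIV - s j) (of_int (sign q) * (\<Prod>i\<in>UNIV. ?N $ i $ q i))"
    if q: "q permutes UNIV" for q
  proof (cases "q p = j")
    case True
    have "homogeneous (\<Sum>i\<in>UNIV. if i = p then 0 else s (q i)) (\<Prod>i\<in>UNIV. ?N $ i $ q i)"
      using assms True by (intro homogeneous_prod) (auto simp: replace_row_def axis_def homogeneous_1)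
    also have "(\<Sum>i\<in>UNIV. if i = p then 0 else s (q i)) = (\<Sum>i\<in>UNIV. s (q i)) - s (q p)"
      by (simp add: sum.remove[of UNIV p] sum.If_cases)
         (auto intro!: sum.cong)
    also have "(\<Sum>i\<in>UNIV. s (q i)) = sum s UNIV"
      using sum.permute[OF q, of s] by (simp add: comp_def)
    finally have "homogeneous (sum s UNIV - s j) (\<Prod>i\<in>UNIV. ?N $ i $ q i)" by (simp add: True)
    then show ?thesis by (auto simp: sign_def intro: homogeneous_uminus)
  next
    case False
    then have "?N $ p $ q p = 0" by (simp add: replace_row_def axis_def)
    then have "(\<Prod>i\<in>UNIV. ?N $ i $ q i) = 0" by (intro prod_zero) auto
    then show ?thesis by (simp only: mult_zero_right homogeneous_0)
  qed
  then show ?thesis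
    unfolding adj_def vec_lambda_beta det_def by (intro homogeneous_sum) auto
qed

text \<open>
  The adjugate of \<open>B\<close> equals \<open>C r\<close>, because its columns lie in the kernel of \<open>B\<close>. Its entries in row \<open>j\<close> have degree
  \<open>d\<^sub>1 + d\<^sub>2 + 2 d\<^sub>3 - s\<^sub>j\<close>, and the entries of \<open>C\<close> have degree \<open>d\<^sub>3 + 1 - s\<^sub>j\<close>, which leaves degree
  \<open>d\<^sub>1 + d\<^sub>2 + d\<^sub>3 - 1\<close> for \<open>r\<close>. As \<open>r\<close> is proportional to the gradient of \<open>f\<close>, the form \<open>\<rho> = \<Sum>i. x\<^sub>i r\<^sub>i\<close> satisfies
  \<open>\<rho> f\<^sub>k = d f r\<^sub>k\<close>, so that \<open>f\<close> divides \<open>\<rho>\<close>.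
\<close>

lemma syzygy_resolution_degree_le:
  assumes res: "syzygy_resolution d f (shifts d1 d2 d3) (d3 + d) B C"
    and hom: "homogeneous d f" and sf: "squarefree f" and nz: "pd p f \<noteq> 0"
    and le: "d1 \<le> d2" "d2 \<le> d3" "1 \<le> d3"
  shows "d \<le> d1 + d2 + d3"
proof -
  define s where "s = shifts d1 d2 d3"
  have s_le: "s j \<le> d3" for j using le by (auto simp: s_def shifts_def)
  have sum_s: "sum s UNIV = d1 + d2 + 2 * d3"
    by (simp add: s_def shifts_def sum_4)
  have d: "1 \<le> d"
  proof (rule ccontr)
    assume "\<not> 1 \<le> d"
    then have "d = 0" by simp
    then have "f = const (coef f 0)" using hom homogeneous_0_eq_const by blast
    then have "pd p f = pd p (monomial 0 (coef f 0))" by (simp add: const_def)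
    then show False using nz by (simp add: pd_monomial)
  qed
  have B_hom: "homogeneous (s k) (B $ i $ k)" for i k
    using res by (simp add: syzygy_resolution_def graded_map_def s_def)
  have kerB: "range ((*v) C) = {v. B *v v = 0}" and rangeB: "range ((*v) B) = {v. grad_map f v = 0}"
    and kerC: "{v. C *v v = 0} = {0}"
    using res by (auto simp: syzygy_resolution_def)
  define c where "c = (\<chi> j. C $ j $ 1)"
  have C_mult: "C *v v = v $ 1 *s c" for v
    by (simp add: c_def vec_eq_iff matrix_vector_mult_def mult.commute)
  have c_hom: "homogeneous (d3 + 1 - s j) (c $ j)" for j
  proof -
    have "s j + (d - 1) \<le> d3 + d" "d3 + d - (s j + (d - 1)) = d3 + 1 - s j"
      using s_le[of j] d by auto
    moreover have "graded_map (vec (d3 + d)) (\<chi> j. s j + (d - 1)) C"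
      using res unfolding syzygy_resolution_def s_def by blast
    then have "if s j + (d - 1) \<le> d3 + d then homogeneous (d3 + d - (s j + (d - 1))) (C $ j $ 1)
        else C $ j $ 1 = 0"
      unfolding graded_map_def vec_lambda_beta vec_component by blast
    ultimately show ?thesis by (simp only: c_def vec_lambda_beta if_True)
  qed
  have "c \<noteq> 0"
  proof
    assume "c = 0"
    then have "vec 1 \<in> {v. C *v v = 0}" by (simp add: C_mult)
    then show False unfolding kerC by (simp add: vec_eq_iff)
  qed
  then obtain j0 where j0: "c $ j0 \<noteq> 0" by (auto simp: vec_eq_iff)
  have Bc: "B *v c = 0"
  proof -
    have "C *v vec 1 \<in> {v. B *v v = 0}" unfolding kerB[symmetric] by blast
    then show ?thesis by (simp add: C_mult)
  qed
  have rows: "(\<Sum>i\<in>UNIV. pd i f *s B $ i) = 0"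
  proof -
    have "(\<Sum>i\<in>UNIV. pd i f * B $ i $ k) = 0" for k
    proof -
      have "B *v axis k 1 \<in> {v. grad_map f v = 0}" unfolding rangeB[symmetric] by blast
      moreover have "(B *v axis k 1) $ i = B $ i $ k" for i
        by (simp add: matrix_vector_mult_def axis_def if_distrib cong: if_cong)
      ultimately show ?thesis by (simp add: grad_map_def mult.commute)
    qed
    then show ?thesis by (simp add: vec_eq_iff)
  qed
  have "det B = 0"
  proof -
    have "pd p f * det B = det (replace_row p 0 B)"
      using det_replace_row_comb[of p "\<lambda>i. pd i f" B] by (simp add: rows)
    also have "\<dots> = 0" by (simp add: det_replace_row_adj)
    finally show ?thesis using nz by simp
  qed
  have "\<exists>r. adj B i = r *s c" for i
  proof -
    have "B *v adj B i = 0" by (simp add: matrix_adj \<open>det B = 0\<close> axis_def vec_eq_iff)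
    then have "adj B i \<in> range ((*v) C)" unfolding kerB by simp
    then show ?thesis by (auto simp: C_mult)
  qed
  then obtain r0 where r0: "\<And>i. adj B i = r0 i *s c" by metis
  define n where "n = sum s UNIV - (d3 + 1)"
  \<comment> \<open>Only the component of degree \<open>n\<close> of \<open>r0\<close> contributes to the adjugate, whose entries are homogeneous.\<close>
  define r where "r i = hcomp n (r0 i)" for i
  have n: "Suc n = d1 + d2 + d3" using le by (simp add: n_def sum_s)
  have r: "adj B i $ j = r i * c $ j" for i j
  proof -
    have "adj B i $ j = hcomp (sum s UNIV - s j) (adj B i $ j)"
      using hcomp_homogeneous[OF homogeneous_det_replace_row[of s B j i, OF B_hom]] by simp
    also have "\<dots> = hcomp (sum s UNIV - s j) (r0 i * c $ j)" by (simp add: r0)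
    also have "\<dots> = hcomp (sum s UNIV - s j - (d3 + 1 - s j)) (r0 i) * c $ j"
      using s_le[of j] le by (subst hcomp_mult[OF c_hom]) (simp add: sum_s)
    also have "sum s UNIV - s j - (d3 + 1 - s j) = n"
      using s_le[of j] le by (simp add: n_def sum_s)
    finally show ?thesis by (simp add: r_def)
  qed
  have "adj B p \<noteq> 0"
  proof -
    have "\<exists>u. B *v u = axis j (pd p f) - axis p (pd j f)" for j
    proof -
      have "grad_map f (axis j (pd p f) - axis p (pd j f)) = 0"
        using grad_map_add[of f "axis j (pd p f) - axis p (pd j f)" "axis p (pd j f)"]
        by (simp add: grad_map_axis mult.commute)
      then have "axis j (pd p f) - axis p (pd j f) \<in> range ((*v) B)" by (simp add: rangeB)
      then show ?thesis by auto
    qed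
    then obtain u where "\<And>j. B *v u j = axis j (pd p f) - axis p (pd j f)" by metis
    then show ?thesis
      using adj_nonzero[of "\<lambda>i. pd i f" p B c u] nz Bc \<open>c \<noteq> 0\<close> by auto
  qed
  then have rp: "r p \<noteq> 0" by (auto simp: vec_eq_iff r)
  have rp_prop: "pd i f * r k = pd k f * r i" for i k
    using adj_proportional[OF rows, of i k j0] j0 by (simp add: r)
  define \<rho> where "\<rho> = (\<Sum>i\<in>UNIV. var i * r i)"
  have \<rho>: "\<rho> * pd k f = of_nat d * f * r k" for k
  proof -
    have "\<rho> * pd k f = (\<Sum>i\<in>UNIV. var i * pd i f) * r k"
      by (simp add: \<rho>_def sum_distrib_right mult.assoc rp_prop mult.commute[of "r _"])
    then show ?thesis by (simp add: euler[OF hom])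
  qed
  have "f dvd \<rho> * pd k f" for k by (simp add: \<rho>)
  with sf have "f dvd \<rho>" by (rule squarefree_log_derivative)
  moreover have "\<rho> \<noteq> 0"
  proof
    assume "\<rho> = 0"
    moreover have "f \<noteq> 0" using nz by auto
    ultimately show False using \<rho>[of p] rp d by (simp add: of_nat_eq_0_iff)
  qed
  ultimately have "tdeg f \<le> tdeg \<rho>" by (rule tdeg_le_if_dvd)
  moreover have "homogeneous (1 + n) \<rho>"
    unfolding \<rho>_def r_def by (intro homogeneous_sum homogeneous_mult homogeneous_var homogeneous_hcomp)
  moreover have "f \<noteq> 0" using nz by auto
  ultimately show ?thesis
    using tdeg_homogeneous[OF hom] tdeg_homogeneous[of "1 + n" \<rho>] \<open>\<rho> \<noteq> 0\<close> n by simp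
qed

section \<open>Smooth surfaces\<close>

lemma hcomp_in_jacobian:
  assumes "homogeneous d f" and "a \<in> jacobian_ideal f"
  shows "hcomp k a \<in> jacobian_ideal f"
proof -
  obtain v where "a = (\<Sum>i\<in>UNIV. v $ i * pd i f)"
    using assms(2) by (auto simp: jacobian_ideal_eq grad_map_def)
  then have "hcomp k a = (\<Sum>i\<in>UNIV. hcomp k (v $ i * pd i f))"
    by (simp add: part_sum)
  also have "\<dots> \<in> jacobian_ideal f"
    unfolding hcomp_mult[OF homogeneous_pd[OF assms(1)]]
    by (auto intro!: ring_ideal_sum[OF ring_ideal_jacobian] ring_ideal_mult[OF ring_ideal_jacobian]
        ring_ideal_0[OF ring_ideal_jacobian] pd_in_jacobian)
  finally show ?thesis .
qed

text \<open>
  By Euler's formula a common zero of the partial derivatives lies on the surface, so smoothness excludes a common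
  zero with \<open>x\<^sub>i = 1\<close>. Hence \<open>1 = a + (x\<^sub>i - 1) b\<close> with \<open>a\<close> in the Jacobian ideal \<open>J\<close>. Comparing homogeneous components
  yields \<open>b\<^sub>k = - x\<^sub>i\<^sup>k\<close> modulo \<open>J\<close>, and \<open>b\<^sub>k = 0\<close> for large \<open>k\<close>.
\<close>

lemma var_power_in_jacobian:
  assumes hom: "homogeneous d g" and d: "1 \<le> d" and smooth: "smooth_surface g"
  shows "\<exists>N. var i ^ N \<in> jacobian_ideal g"
proof -
  define J where "J = jacobian_ideal g"
  have J: "ring_ideal J" unfolding J_def by (rule ring_ideal_jacobian)
  have "1 \<in> add_gen J (var i - 1)"
  proof (rule ccontr)
    assume "1 \<notin> add_gen J (var i - 1)"
    then obtain v where v: "\<forall>p\<in>add_gen J (var i - 1). eval_at v p = 0"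
      using weak_nullstellensatz[OF ring_ideal_add_gen[OF J]] by blast
    have "eval_at v (1 + (var i - 1)) = eval_at v (const 1) + eval_at v (var i - 1)"
      by (subst eval_at_add) simp
    moreover have "eval_at v (var i - 1) = 0" using v gen_in_add_gen[OF J] by blast
    ultimately have vi: "v i = 1" by (simp del: const_1)
    have pd0: "eval_at v (pd j g) = 0" for j
      using v pd_in_jacobian[of j g] by (auto intro: add_gen_superset simp: J_def)
    have "eval_at v (\<Sum>j\<in>UNIV. var j * pd j g) = 0"
      by (simp add: eval_at_sum eval_at_mult pd0)
    then have "eval_at v (const (of_nat d) * g) = 0"
      by (simp only: euler[OF hom] const_of_nat)
    then have "eval_at v g = 0" using d by (simp add: eval_at_mult)
    moreover have "(\<chi> j. v j) \<noteq> (0 :: complex^4)" using vi by (auto simp: vec_eq_iff intro!: exI[of _ i])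
    moreover have "($) (\<chi> j. v j) = v" by (rule ext) simp
    ultimately show False
      using smooth pd0 unfolding smooth_surface_def evaluate_id by metis
  qed
  then obtain a b where ab: "1 = a + (var i - 1) * b" "a \<in> J" by (auto simp: add_gen_def)
  have a: "hcomp k a \<in> J" for k
    using ab(2) hcomp_in_jacobian[OF hom] by (simp add: J_def)
  have hb: "hcomp k b = hcomp k a + hcomp k (b * var i) - hcomp k 1" for k
  proof -
    have "b = a + b * var i - 1" using ab(1) by (simp add: algebra_simps)
    then have "hcomp k b = hcomp k (a + b * var i - 1)" by simp
    then show ?thesis by (simp only: part_add part_diff)
  qed
  have "hcomp k b + var i ^ k \<in> J" for k
  proof (induction k)
    case 0
    have "hcomp 0 (b * var i) = 0" by (simp only: hcomp_mult[OF homogeneous_var]) simp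
    moreover have "hcomp 0 1 = 1" by (simp only: hcomp_homogeneous[OF homogeneous_1]) simp
    ultimately have "hcomp 0 b + var i ^ 0 = hcomp 0 a"
      by (subst hb) (simp only: power_0, simp)
    then show ?case using a by (simp only:)
  next
    case (Suc k)
    have "hcomp (Suc k) (b * var i) = hcomp k b * var i"
      by (simp only: hcomp_mult[OF homogeneous_var]) simp
    moreover have "hcomp (Suc k) 1 = 0" by (simp only: hcomp_homogeneous[OF homogeneous_1]) simp
    ultimately have "hcomp (Suc k) b + var i ^ Suc k = hcomp (Suc k) a + var i * (hcomp k b + var i ^ k)"
      by (subst hb) (simp add: algebra_simps)
    then show ?case
      using ring_ideal_add[OF J a ring_ideal_mult[OF J Suc]] by (simp only:)
  qed
  moreover obtain N where "hcomp N b = 0" using hcomp_large by blast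
  ultimately show ?thesis unfolding J_def by (metis add_0)
qed

lemma var_power: "var i ^ N = monomial (Poly_Mapping.single i N) 1"
  by (induction N) (simp_all add: var_def mult_single flip: single_add)

lemma coef_var_power_mult: "coef (var i ^ N * r) (Poly_Mapping.single i N + m) = coef r m"
  by (rule additive_eqI[where F = "\<lambda>r. coef (var i ^ N * r) (Poly_Mapping.single i N + m)"])
     (auto simp: var_power mult_single lookup_single when_def lookup_add algebra_simps)

lemma coef_var_power_mult_nonzero:
  assumes "coef (var i ^ N * r) m \<noteq> 0"
  shows "N \<le> Poly_Mapping.lookup m i"
proof -
  have "m \<in> Poly_Mapping.keys (monomial (Poly_Mapping.single i N) 1 * r)"
    using assms by (simp add: var_power in_keys_iff)
  then obtain n where "m = Poly_Mapping.single i N + n"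
    using keys_mult[of "monomial (Poly_Mapping.single i N) 1" r] by auto
  then show ?thesis by (simp add: lookup_add)
qed

lemma divisible_by_var_power:
  assumes "\<And>m. coef p m \<noteq> 0 \<Longrightarrow> N \<le> Poly_Mapping.lookup m i"
  shows "\<exists>r. p = var i ^ N * r"
proof -
  have "p = (\<Sum>m\<in>Poly_Mapping.keys p. monomial m (coef p m))"
    by (rule mpoly_as_sum)
  also have "\<dots> = (\<Sum>m\<in>Poly_Mapping.keys p. var i ^ N * monomial (m - Poly_Mapping.single i N) (coef p m))"
  proof (rule sum.cong[OF refl])
    fix m assume "m \<in> Poly_Mapping.keys p"
    then have "N \<le> Poly_Mapping.lookup m i" using assms by (simp add: in_keys_iff)
    then have "Poly_Mapping.single i N + (m - Poly_Mapping.single i N) = m"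
      by (intro poly_mapping_eqI) (auto simp: lookup_add lookup_minus lookup_single when_def)
    then show "monomial m (coef p m) = var i ^ N * monomial (m - Poly_Mapping.single i N) (coef p m)"
      by (simp add: var_power mult_single)
  qed
  finally show ?thesis by (auto simp flip: sum_distrib_left)
qed

definition nth_index :: "nat \<Rightarrow> 4" where
  "nth_index k = [1, 2, 3, 4] ! k"

lemma nth_index_inj: "k < 4 \<Longrightarrow> l < 4 \<Longrightarrow> nth_index k = nth_index l \<Longrightarrow> k = l"
  using nth_eq_iff_index_eq[of "[1, 2, 3, 4 :: 4]" k l] by (simp add: nth_index_def)

text \<open>
  The monomial ideal generated by the \<open>N\<close>-th powers of the first \<open>k\<close> variables, described by exponents; this makes it
  evident that the powers of the variables form a regular sequence.
\<close>

definition power_ideal :: "nat \<Rightarrow> nat \<Rightarrow> mpoly set" where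
  "power_ideal N k = {p. \<forall>m. coef p m \<noteq> 0 \<longrightarrow> (\<exists>l<k. N \<le> Poly_Mapping.lookup m (nth_index l))}"

lemma ring_ideal_power_ideal: "ring_ideal (power_ideal N k)"
  unfolding ring_ideal_def
proof (intro conjI ballI allI)
  fix p q assume pq: "p \<in> power_ideal N k" "q \<in> power_ideal N k"
  have "\<exists>l<k. N \<le> Poly_Mapping.lookup m (nth_index l)" if "coef (p + q) m \<noteq> 0" for m
  proof -
    have "coef p m \<noteq> 0 \<or> coef q m \<noteq> 0" using that by (auto simp: lookup_add)
    then show ?thesis using pq by (auto simp: power_ideal_def)
  qed
  then show "p + q \<in> power_ideal N k" by (simp add: power_ideal_def)
next
  fix r p assume p: "p \<in> power_ideal N k"
  have "\<exists>l<k. N \<le> Poly_Mapping.lookup m (nth_index l)" if "coef (r * p) m \<noteq> 0" for m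
  proof -
    have "m \<in> Poly_Mapping.keys (r * p)" using that by (simp add: in_keys_iff)
    then obtain a b where ab: "m = a + b" "b \<in> Poly_Mapping.keys p"
      using keys_mult[of r p] by auto
    then have "\<exists>l<k. N \<le> Poly_Mapping.lookup b (nth_index l)"
      using p by (simp add: power_ideal_def in_keys_iff)
    then show ?thesis by (auto simp: ab(1) lookup_add intro: trans_le_add2)
  qed
  then show "r * p \<in> power_ideal N k" by (simp add: power_ideal_def)
qed (simp add: power_ideal_def)

lemma power_ideal_0: "power_ideal N 0 = {0}"
proof -
  have "p = 0" if "p \<in> power_ideal N 0" for p
    using that lookup_nonzero[of p] by (auto simp: power_ideal_def)
  then show ?thesis by (auto simp: power_ideal_def)
qed

lemma power_ideal_Suc: "power_ideal N (Suc k) = {a + var (nth_index k) ^ N * r | a r. a \<in> power_ideal N k}"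
proof (intro subset_antisym subsetI)
  fix p assume p: "p \<in> power_ideal N (Suc k)"
  define Q where "Q m \<longleftrightarrow> (\<exists>l<k. N \<le> Poly_Mapping.lookup m (nth_index l))" for m
  have "part Q p \<in> power_ideal N k" by (auto simp: power_ideal_def coef_part Q_def split: if_splits)
  moreover have "\<exists>r. part (\<lambda>m. \<not> Q m) p = var (nth_index k) ^ N * r"
  proof (rule divisible_by_var_power)
    fix m assume "coef (part (\<lambda>m. \<not> Q m) p) m \<noteq> 0"
    then have "\<not> Q m" "coef p m \<noteq> 0" by (auto simp: coef_part split: if_splits)
    then show "N \<le> Poly_Mapping.lookup m (nth_index k)"
      using p by (auto simp: power_ideal_def Q_def less_Suc_eq)
  qed
  ultimately show "p \<in> {a + var (nth_index k) ^ N * r | a r. a \<in> power_ideal N k}"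
    using part_compl[of Q p] by (smt (verit) mem_Collect_eq)
next
  fix p assume "p \<in> {a + var (nth_index k) ^ N * r | a r. a \<in> power_ideal N k}"
  then obtain a r where p: "p = a + var (nth_index k) ^ N * r" and a: "a \<in> power_ideal N k" by blast
  have "a \<in> power_ideal N (Suc k)" using a by (auto simp: power_ideal_def less_Suc_eq)
  moreover have "var (nth_index k) ^ N * r \<in> power_ideal N (Suc k)"
    using coef_var_power_mult_nonzero by (auto simp: power_ideal_def)
  ultimately show "p \<in> power_ideal N (Suc k)"
    unfolding p by (rule ring_ideal_add[OF ring_ideal_power_ideal])
qed

lemma power_ideal_regular:
  assumes "k < 4" and "var (nth_index k) ^ N * r \<in> power_ideal N k"
  shows "r \<in> power_ideal N k"
  unfolding power_ideal_def
proof (intro CollectI allI impI)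
  fix m assume "coef r m \<noteq> 0"
  then have "coef (var (nth_index k) ^ N * r) (Poly_Mapping.single (nth_index k) N + m) \<noteq> 0"
    by (simp add: coef_var_power_mult)
  then obtain l where l: "l < k" "N \<le> Poly_Mapping.lookup (Poly_Mapping.single (nth_index k) N + m) (nth_index l)"
    using assms(2) by (auto simp: power_ideal_def)
  have "nth_index k \<noteq> nth_index l" using nth_index_inj[of k l] l(1) assms(1) by auto
  then show "\<exists>l<k. N \<le> Poly_Mapping.lookup m (nth_index l)"
    using l by (auto simp: lookup_add lookup_single when_def)
qed

text \<open>
  The components of a syzygy lie in the Jacobian ideal, which has no nonzero forms of degree less than \<open>d - 1\<close>.
\<close>

lemma smooth_no_low_syzygies:
  fixes v :: "mpoly^4"
  assumes hom: "homogeneous d g" and smooth: "smooth_surface g"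
    and syz: "grad_map g v = 0" and v: "\<And>i. homogeneous q (v $ i)" and q: "q < d - 1"
  shows "v = 0"
proof -
  define J where "J = jacobian_ideal g"
  have J: "ring_ideal J" unfolding J_def by (rule ring_ideal_jacobian)
  have "\<exists>N. var i ^ N \<in> J" for i
    unfolding J_def using q by (intro var_power_in_jacobian[OF hom _ smooth]) simp
  then obtain n where n: "\<And>i. var i ^ n i \<in> J" by metis
  define N where "N = sum n UNIV"
  have N: "\<exists>h. var i ^ N = (\<Sum>j\<in>UNIV. pd j g * h j)" for i
  proof -
    have "n i \<le> N" unfolding N_def by (rule member_le_sum) auto
    then have "var i ^ N = var i ^ (N - n i) * var i ^ n i" by (simp flip: power_add)
    then have "var i ^ N \<in> J" using ring_ideal_mult[OF J n] by simp
    then obtain w where "var i ^ N = (\<Sum>j\<in>UNIV. w $ j * pd j g)"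
      by (auto simp: J_def jacobian_ideal_eq grad_map_def)
    then show ?thesis by (intro exI[of _ "($) w"]) (simp add: mult.commute)
  qed
  have "v $ i = 0" for i
  proof -
    have "\<exists>b. v $ i = (\<Sum>j\<in>UNIV. pd j g * b j)"
    proof (rule syzygy_components_in_ideal)
      show "power_ideal N (Suc k) = {a + var (nth_index k) ^ N * r | a r. a \<in> power_ideal N k}" for k
        by (rule power_ideal_Suc)
      show "r \<in> power_ideal N k" if "k < CARD(4)" "var (nth_index k) ^ N * r \<in> power_ideal N k" for k r
        using that by (intro power_ideal_regular[of k N r]) auto
      show "(\<Sum>i\<in>UNIV. pd i g * v $ i) = 0"
        using syz by (simp add: grad_map_def mult.commute)
    qed (simp_all add: ring_ideal_power_ideal power_ideal_0 N)
    then obtain b where "v $ i = (\<Sum>j\<in>UNIV. pd j g * b j)" by blast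
    then have "v $ i = grad_map g (\<chi> j. b j)" by (simp add: grad_map_def mult.commute)
    then have "v $ i \<in> jacobian_ideal g" unfolding jacobian_ideal_eq by blast
    with v have "v $ i \<in> jacobian_ideal g \<inter> {p. homogeneous q p}" by blast
    then obtain w where w: "v $ i = grad_map g w" "w \<in> graded_piece (vec (d - 1)) q"
      unfolding jacobian_piece[OF hom] by blast
    then have "w = 0" using q by (auto simp: graded_piece_iff vec_eq_iff)
    then show ?thesis using w(1) by (simp add: grad_map_def)
  qed
  then show ?thesis by (simp add: vec_eq_iff)
qed

lemma hilbert_fun_smooth:
  assumes hom: "homogeneous d g" and smooth: "smooth_surface g" and "2 \<le> d" and k: "k < 2 * (d - 1)"
  shows "hilbert_fun g k + 4 * hdim (d - 1) k = hdim 0 k"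
proof -
  have "{v \<in> graded_piece (vec (d - 1)) k. grad_map g v = 0} = {0}"
  proof (intro subset_antisym subsetI)
    fix v assume v: "v \<in> {v \<in> graded_piece (vec (d - 1)) k. grad_map g v = 0}"
    have "v = 0"
    proof (cases "d - 1 \<le> k")
      case True
      show ?thesis
      proof (rule smooth_no_low_syzygies[OF hom smooth, of v "k - (d - 1)"])
        show "grad_map g v = 0" "\<And>i. homogeneous (k - (d - 1)) (v $ i)"
          using v True by (auto simp: graded_piece_iff)
        show "k - (d - 1) < d - 1" using k \<open>2 \<le> d\<close> by linarith
      qed
    qed (use v in \<open>auto simp: graded_piece_iff vec_eq_iff\<close>)
    then show "v \<in> {0}" by simp
  qed (auto simp: graded_piece_iff grad_map_def)
  then show ?thesis
    using hilbert_fun_syzygies[OF hom \<open>2 \<le> d\<close>, of k] by (simp add: dim_zero_vec)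
qed

section \<open>Invariants of nearly free surfaces\<close>

text \<open>
  Apply rank and nullity to the maps \<open>C\<close>, \<open>B\<close> and the gradient map in degree \<open>k\<close>; exactness identifies each kernel
  with the image of the preceding map. The equation is written without subtraction, in natural numbers.
\<close>

lemma hilbert_fun_resolution:
  assumes res: "syzygy_resolution d f s t B C" and hom: "homogeneous d f" and d: "2 \<le> d"
  shows "hilbert_fun f k + 4 * hdim (d - 1) k + hdim t k = hdim 0 k + (\<Sum>j\<in>UNIV. hdim (s j + (d - 1)) k)"
proof -
  let ?a = "vec (d - 1) :: nat^4" and ?b = "\<chi> j. s j + (d - 1)" and ?c = "vec t :: nat^1"
  have grB: "graded_map ?b ?a B" and grC: "graded_map ?c ?b C"
    and B: "range ((*v) B) = {v. grad_map f v = 0}" and C: "range ((*v) C) = {v. B *v v = 0}"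
    and kerC: "{v. C *v v = 0} = {0}"
    using res unfolding syzygy_resolution_def by simp_all
  have "{v \<in> graded_piece ?a k. grad_map f v = 0} = (*v) B ` graded_piece ?b k"
    unfolding graded_map_image[OF grB] B by (simp add: Int_def)
  moreover have "{v \<in> graded_piece ?b k. B *v v = 0} = (*v) C ` graded_piece ?c k"
    unfolding graded_map_image[OF grC] C by (simp add: Int_def)
  moreover have "{v \<in> graded_piece ?c k. C *v v = 0} = {0}"
  proof -
    have "C *v v = 0 \<longleftrightarrow> v = 0" for v using kerC by (simp add: set_eq_iff)
    moreover have "0 \<in> graded_piece ?c k" by (simp add: graded_piece_iff)
    ultimately show ?thesis by (simp add: set_eq_iff) metis
  qed
  ultimately show ?thesis
    using hilbert_fun_syzygies[OF hom d, of k] dim_matrix_image[of ?b k B] dim_matrix_image[of ?c k C]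
    by (simp add: dim_zero_vec)
qed

lemma sum_shifts: "(\<Sum>j\<in>UNIV. g (shifts d1 d2 d3 j)) = g d1 + g d2 + 2 * (g d3 :: nat)"
  by (simp add: sum_4 shifts_def)

text \<open>
  The polynomial that counts forms of degree \<open>x\<close> in four variables; it also vanishes at \<open>-1\<close>, \<open>-2\<close> and \<open>-3\<close>.
\<close>

definition hbinom :: "real \<Rightarrow> real" where
  "hbinom x = (x + 1) * (x + 2) * (x + 3) / 6"

lemma real_hdim:
  assumes "b \<le> k + 3"
  shows "real (hdim b k) = hbinom (real k - real b)"
proof (cases "b \<le> k")
  case True
  then obtain n where k: "k = b + n" using le_Suc_ex by blast
  have "6 * (n + 3 choose 3) = (n + 3) * (n + 2) * (n + 1)"
  proof -
    have X: "3 * (n + 3 choose 3) = (n + 3) * (n + 2 choose 2)"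
      using Suc_times_binomial_eq[of "n + 2" 2] by (simp add: numeral_eq_Suc)
    have Y: "2 * (n + 2 choose 2) = (n + 2) * (n + 1)"
      using Suc_times_binomial_eq[of "n + 1" 1] by (simp add: numeral_eq_Suc)
    have "6 * (n + 3 choose 3) = 2 * (3 * (n + 3 choose 3))" by simp
    also have "\<dots> = (n + 3) * (2 * (n + 2 choose 2))" unfolding X by simp
    also have "\<dots> = (n + 3) * (n + 2) * (n + 1)" unfolding Y by (simp only: mult.assoc)
    finally show ?thesis .
  qed
  then have "6 * real (n + 3 choose 3) = real ((n + 3) * (n + 2) * (n + 1))"
    by (metis of_nat_mult of_nat_numeral)
  then show ?thesis
    by (simp add: k hdim_def hbinom_def algebra_simps)
next
  case False
  then have "b = k + 1 \<or> b = k + 2 \<or> b = k + 3" using assms by auto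
  then show ?thesis by (auto simp: hdim_def hbinom_def)
qed

lemma eventually_negative_quadratic:
  fixes t x y :: real
  assumes "0 < t"
  shows "\<exists>k0. \<forall>k\<ge>k0. - t * (real k)\<^sup>2 + x * real k + y < 0"
proof -
  obtain k0 :: nat where k0: "(\<bar>x\<bar> + \<bar>y\<bar>) / t < real k0" using reals_Archimedean2 by blast
  have "- t * (real k)\<^sup>2 + x * real k + y < 0" if "max 1 k0 \<le> k" for k
  proof -
    have k: "1 \<le> real k" "(\<bar>x\<bar> + \<bar>y\<bar>) < t * real k"
      using that k0 assms by (auto simp: field_simps intro: less_le_trans)
    have "x * real k + y \<le> (\<bar>x\<bar> + \<bar>y\<bar>) * real k"
    proof -
      have "x * real k \<le> \<bar>x\<bar> * real k" by (intro mult_right_mono) auto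
      moreover have "\<bar>y\<bar> * 1 \<le> \<bar>y\<bar> * real k" using k(1) by (intro mult_left_mono) auto
      ultimately show ?thesis by (simp only: distrib_right)
    qed
    also have "\<dots> < t * real k * real k" using k by (intro mult_strict_right_mono) auto
    finally show ?thesis by (simp add: power2_eq_square algebra_simps)
  qed
  then show ?thesis by blast
qed

text \<open>
  Two polynomials that agree at all large natural numbers are equal.
\<close>

lemma hilbert_poly_eqI:
  assumes "\<And>k. q \<le> k \<Longrightarrow> real (hilbert_fun f k) = poly P (real k)"
  shows "hilbert_poly f = P"
  unfolding hilbert_poly_def
proof (rule the_equality)
  show "\<forall>\<^sub>F k in sequentially. real (hilbert_fun f k) = poly P (real k)"
    using assms by (auto simp: eventually_sequentially)
  fix Q assume "\<forall>\<^sub>F k in sequentially. real (hilbert_fun f k) = poly Q (real k)"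
  then obtain q' where q': "\<And>k. q' \<le> k \<Longrightarrow> real (hilbert_fun f k) = poly Q (real k)"
    by (auto simp: eventually_sequentially)
  show "Q = P"
  proof (rule ccontr)
    assume "Q \<noteq> P"
    then have "finite {x. poly (Q - P) x = 0}" by (intro poly_roots_finite) simp
    moreover have "real ` {max q q'..} \<subseteq> {x. poly (Q - P) x = 0}"
    proof (rule image_subsetI)
      fix k assume "k \<in> {max q q'..}"
      then show "real k \<in> {x. poly (Q - P) x = 0}" using assms[of k] q'[of k] by simp
    qed
    ultimately have "finite (real ` {max q q'..})" by (rule rev_finite_subset)
    then show False by (simp add: finite_image_iff infinite_Ici)
  qed
qed

text \<open>
  The Koszul relations have components of degree \<open>d - 1\<close>, so the submodule that they generate has none of smaller degree.
\<close>

lemma KR_degree: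
  fixes v :: "mpoly^4"
  assumes hom: "homogeneous d f" and "v \<in> KR f" and "coef (v $ i) m \<noteq> 0"
  shows "d - 1 \<le> mdeg m"
proof -
  interpret M: Modules.module "(*s) :: mpoly \<Rightarrow> mpoly^4 \<Rightarrow> mpoly^4"
    by unfold_locales (simp_all add: vec_eq_iff algebra_simps)
  define T where "T = {v :: mpoly^4. \<forall>i m. coef (v $ i) m \<noteq> 0 \<longrightarrow> d - 1 \<le> mdeg m}"
  have "M.span {axis i (pd j f) - axis j (pd i f) | i j. True} \<subseteq> T"
  proof (rule M.span_minimal)
    have "coef (pd j f) m \<noteq> 0 \<Longrightarrow> d - 1 \<le> mdeg m" for j m
      using homogeneous_pd[OF hom, of j] by (simp add: homogeneous_iff)
    then show "{axis i (pd j f) - axis j (pd i f) | i j. True} \<subseteq> T"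
      by (fastforce simp: T_def axis_def lookup_minus split: if_splits)
    show "M.subspace T"
    proof (rule M.subspaceI)
      show "0 \<in> T" by (simp add: T_def)
      fix v w assume vw: "v \<in> T" "w \<in> T"
      have "d - 1 \<le> mdeg m" if "coef (v $ i) m + coef (w $ i) m \<noteq> 0" for i m
      proof -
        have "coef (v $ i) m \<noteq> 0 \<or> coef (w $ i) m \<noteq> 0" using that by auto
        then show ?thesis using vw by (auto simp: T_def)
      qed
      then show "v + w \<in> T" by (simp add: T_def lookup_add)
    next
      fix r v assume v: "v \<in> T"
      have "d - 1 \<le> mdeg m" if "coef (r * v $ i) m \<noteq> 0" for i m
      proof -
        have "m \<in> Poly_Mapping.keys (r * v $ i)" using that by (simp add: in_keys_iff)
        then obtain a b where "m = a + b" "b \<in> Poly_Mapping.keys (v $ i)"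
          using keys_mult[of r "v $ i"] by auto
        then show ?thesis using v by (auto simp: T_def mdeg_add in_keys_iff intro: trans_le_add2)
      qed
      then show "r *s v \<in> T" by (simp add: T_def)
    qed
  qed
  then show ?thesis using assms(2,3) by (auto simp: KR_def T_def)
qed

lemma zero_in_KR: "0 \<in> KR f"
proof -
  interpret M: Modules.module "(*s) :: mpoly \<Rightarrow> mpoly^4 \<Rightarrow> mpoly^4"
    by unfold_locales (simp_all add: vec_eq_iff algebra_simps)
  show ?thesis unfolding KR_def by (rule M.span_zero)
qed

text \<open>
  Let \<open>s\<^sub>j\<close> be the degrees of the columns of \<open>B\<close> and \<open>j\<^sub>0\<close> a column of least degree. Below this degree there are no
  syzygies. The column itself is nonzero, since otherwise the unit vector at \<open>j\<^sub>0\<close> would be a multiple of \<open>C\<close>,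
  whose entries have no constant term.
\<close>

lemma mdr_eq:
  assumes res: "syzygy_resolution d f s t B C" and hom: "homogeneous d f"
    and least: "\<And>j. s j0 \<le> s j" and "s j0 < d - 1"
  shows "mdr f = s j0"
  unfolding mdr_def
proof (rule Least_equality)
  have B: "range ((*v) B) = {v. grad_map f v = 0}" and C: "range ((*v) C) = {v. B *v v = 0}"
    and minC: "minimal_map C" and grB: "graded_map (\<chi> j. s j + (d - 1)) (vec (d - 1)) B"
    using res by (simp_all add: syzygy_resolution_def)
  have AR: "AR f = range ((*v) B)" unfolding B by (simp add: AR_def grad_map_def)
  define v where "v = B *v axis j0 1"
  have v_i: "v $ i = B $ i $ j0" for i
    by (simp add: v_def matrix_vector_mult_def axis_def if_distrib cong: if_cong)
  have "v \<in> AR f" unfolding AR v_def by blast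
  moreover have v_hom: "v \<in> homogeneous_vecs (s j0)"
    using grB by (simp add: homogeneous_vecs_def v_i graded_map_def)
  moreover have "v \<notin> KR f"
  proof
    assume KR: "v \<in> KR f"
    have "v $ i = 0" for i
    proof (rule ccontr)
      assume "v $ i \<noteq> 0"
      then obtain m where m: "coef (v $ i) m \<noteq> 0" using lookup_nonzero by blast
      then have "mdeg m = s j0" using v_hom by (auto simp: homogeneous_vecs_def homogeneous_iff)
      then show False using KR_degree[OF hom KR m] \<open>s j0 < d - 1\<close> by simp
    qed
    then have "B *v axis j0 1 = 0" by (simp add: vec_eq_iff flip: v_def)
    then obtain u where "axis j0 1 = C *v u" using C by blast
    then have "(axis j0 1 :: mpoly^4) $ j0 = (C *v u) $ j0" by simp
    then have "coef 1 0 = coef (C $ j0 $ 1 * u $ 1) 0"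
      by (simp add: matrix_vector_mult_def)
    also have "\<dots> = 0" using minC by (simp add: coef_0_mult minimal_map_def)
    finally show False by simp
  qed
  ultimately show "\<not> AR f \<inter> homogeneous_vecs (s j0) \<subseteq> KR f \<inter> homogeneous_vecs (s j0)" by blast
  fix q assume q: "\<not> AR f \<inter> homogeneous_vecs q \<subseteq> KR f \<inter> homogeneous_vecs q"
  show "s j0 \<le> q"
  proof (rule ccontr)
    assume less: "\<not> s j0 \<le> q"
    have "w = 0" if "w \<in> AR f" "w \<in> homogeneous_vecs q" for w
    proof -
      have "w \<in> graded_piece (vec (d - 1)) (q + (d - 1))"
        using that(2) by (simp add: graded_piece_iff homogeneous_vecs_def)
      then have "w \<in> (*v) B ` graded_piece (\<chi> j. s j + (d - 1)) (q + (d - 1))"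
        using that(1) unfolding graded_map_image[OF grB] AR by blast
      then obtain u where u: "w = B *v u" "u \<in> graded_piece (\<chi> j. s j + (d - 1)) (q + (d - 1))" by blast
      have "u $ j = 0" for j
        using u(2) less least[of j] by (auto simp: graded_piece_iff)
      then have "u = 0" by (simp add: vec_eq_iff)
      then show ?thesis using u(1) by (simp add: matrix_vector_mult_def vec_eq_iff)
    qed
    then show False using q zero_in_KR by auto
  qed
qed

theorem theorem5p12:
  fixes f :: mpoly and d d1 d2 d3 :: nat
    and d1' d2' d3' s1' s2' s3' a' b' :: real
  assumes "homogeneous d f" and "squarefree f" and "\<not> is_cone f"
    and "1 \<le> d1" and "d1 \<le> d2" and "d2 \<le> d3"
    and "nearly_free d f d1 d2 d3"
    and "d1' = real d1" and "d2' = real d2" and "d3' = real d3 - 1"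
    and "s1' = d1' + d2' + d3'"
    and "s2' = d1' * d2' + d1' * d3' + d2' * d3'"
    and "s3' = d1' * d2' * d3'"
    and "a' = s1'^2 - s2'"
    and "b' = 2 * a' - s1'^3 + 3 / 2 * s1' * s2' - 1 / 2 * s3'"
  shows "d1 + d2 + d3 = d \<and> mdr f = d1 \<and>
     (\<forall>fs. homogeneous d fs \<and> smooth_surface fs \<longrightarrow> int (ct fs f) = int d1 + int d - 2) \<and>
     int (st f) = int d + int d3 - 3 \<and>
     hilbert_poly f = [:b' + real d + real d3 - 3, a' - 1:]"
proof -
  note hom = \<open>homogeneous d f\<close>
  obtain B C where res: "syzygy_resolution d f (shifts d1 d2 d3) (d3 + d) B C"
    using nearly_free_resolution(1)[OF \<open>nearly_free d f d1 d2 d3\<close>] by blast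
  have indep: "t j = 0" if "(\<Sum>j\<in>UNIV. const (t j) * pd j f) = 0" for t j
    using nearly_free_resolution(2)[OF \<open>nearly_free d f d1 d2 d3\<close> that] .
  have pd_nz: "pd i f \<noteq> 0" for i
  proof
    assume "pd i f = 0"
    then have "(\<Sum>j\<in>UNIV. const (if j = i then 1 else 0) * pd j f) = 0"
      by (simp add: if_distrib if_distribR cong: if_cong)
    from indep[OF this, of i] show False by simp
  qed
  have d_le: "d \<le> d1 + d2 + d3"
    using assms(2,4-6) by (intro syzygy_resolution_degree_le[OF res hom _ pd_nz]) auto
  have d: "2 \<le> d"
  proof (rule ccontr)
    assume "\<not> 2 \<le> d"
    then have const: "pd i f = const (coef (pd i f) 0)" for i
      using homogeneous_pd[OF hom, of i] by (intro homogeneous_0_eq_const) simp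
    \<comment> \<open>Two constants are linearly dependent over the complex numbers.\<close>
    define t where "t j = (if j = 1 then coef (pd 2 f) 0 else if j = 2 then - coef (pd 1 f) 0 else 0)" for j :: 4
    have "(\<Sum>j\<in>UNIV. const (t j) * pd j f) = 0"
      using const[of 1] const[of 2] by (simp add: sum_4 t_def const_uminus mult.commute)
    from indep[OF this, of 1] have "coef (pd 2 f) 0 = 0" by (simp add: t_def)
    then show False using pd_nz[of 2] const[of 2] by simp
  qed
  have H: "hilbert_fun f k + 4 * hdim (d - 1) k + hdim (d3 + d) k
      = hdim 0 k + (hdim (d1 + (d - 1)) k + hdim (d2 + (d - 1)) k + 2 * hdim (d3 + (d - 1)) k)" for k
    using hilbert_fun_resolution[OF res hom d, of k] sum_shifts[of "\<lambda>x. hdim (x + (d - 1)) k" d1 d2 d3]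
    by simp
  define e :: real where "e = real d - 1"
  have e: "real (d - 1) = e" using d by (simp add: e_def of_nat_diff)
  have H_real: "real (hilbert_fun f k) = hbinom (real k) - 4 * hbinom (real k - e)
      + hbinom (real k - (real d1 + e)) + hbinom (real k - (real d2 + e))
      + 2 * hbinom (real k - (real d3 + e)) - real (hdim (d3 + d) k)"
    if "d + d3 \<le> k + 4" for k
  proof -
    have "real (hilbert_fun f k + 4 * hdim (d - 1) k + hdim (d3 + d) k)
        = real (hdim 0 k + (hdim (d1 + (d - 1)) k + hdim (d2 + (d - 1)) k + 2 * hdim (d3 + (d - 1)) k))"
      by (simp only: H)
    then show ?thesis
      using that d assms(5,6) by (simp add: real_hdim e_def algebra_simps)
  qed
  define G where "G z = hbinom z - 4 * hbinom (z - e) + hbinom (z - (real d1 + e))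
      + hbinom (z - (real d2 + e)) + 2 * hbinom (z - (real d3 + e)) - hbinom (z - (real d3 + real d))" for z
  have H_G: "real (hilbert_fun f k) = G (real k) + hbinom (real k - (real d3 + real d)) - real (hdim (d3 + d) k)"
    if "d + d3 \<le> k + 4" for k
    using H_real[OF that] by (simp add: G_def)
  have H_G': "real (hilbert_fun f k) = G (real k)" if "d + d3 \<le> k + 3" for k
    using H_G[of k] real_hdim[of "d3 + d" k] that by simp
  have d_eq: "d1 + d2 + d3 = d"
  proof (rule ccontr)
    assume "d1 + d2 + d3 \<noteq> d"
    \<comment> \<open>For \<open>t > 0\<close> the leading term \<open>- t k\<^sup>2\<close> would make the Hilbert function negative.\<close>
    define t where "t = (real d1 + real d2 + real d3 - real d) / 2"
    have "0 < t" using d_le \<open>d1 + d2 + d3 \<noteq> d\<close> by (simp add: t_def)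
    then obtain k0 where k0: "\<And>k. k0 \<le> k \<Longrightarrow> - t * (real k)\<^sup>2 + (G 1 - G 0 + t) * real k + G 0 < 0"
      using eventually_negative_quadratic by blast
    have G_eq: "G z = - t * z\<^sup>2 + (G 1 - G 0 + t) * z + G 0" for z
      by (simp add: G_def hbinom_def t_def e_def field_simps power2_eq_square)
    define k where "k = max k0 (d + d3)"
    have k: "k0 \<le> k" "d + d3 \<le> k + 3" by (simp_all add: k_def)
    have "real (hilbert_fun f k) < 0"
      using k0[OF k(1)] by (simp only: H_G'[OF k(2)] G_eq[of "real k"])
    then show False by simp
  qed
  define P where "P = [:b' + real d + real d3 - 3, a' - 1:]"
  have G_P: "G z = poly P z" for z
    unfolding P_def G_def hbinom_def e_def assms(8-15) d_eq[symmetric]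
    by (simp add: field_simps power2_eq_square power3_eq_cube)
  have H_P: "real (hilbert_fun f k) = poly P (real k)" if "d + d3 - 3 \<le> k" for k
    using H_G'[of k] that by (simp add: G_P)
  have hp: "hilbert_poly f = P" by (rule hilbert_poly_eqI[OF H_P])
  have st: "st f = d + d3 - 3"
    unfolding st_def hp
  proof (rule Least_equality)
    show "\<forall>k\<ge>d + d3 - 3. real (hilbert_fun f k) = poly P (real k)" using H_P by blast
    fix q assume q: "\<forall>k\<ge>q. real (hilbert_fun f k) = poly P (real k)"
    show "d + d3 - 3 \<le> q"
    proof (rule ccontr)
      assume "\<not> d + d3 - 3 \<le> q"
      \<comment> \<open>Here \<open>k - (d + d\<^sub>3) = -4\<close>, where the polynomial takes the value \<open>-1\<close> but the dimension is 0.\<close>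
      define k where "k = d + d3 - 4"
      have k: "k + 4 = d + d3" "q \<le> k"
        using \<open>\<not> d + d3 - 3 \<le> q\<close> by (auto simp: k_def)
      have "real k - (real d3 + real d) = - 4" using k(1) by linarith
      then have "hbinom (real k - (real d3 + real d)) = - 1"
        by (simp only: hbinom_def) simp
      then have "real (hilbert_fun f k) = poly P (real k) - 1"
        using H_G[of k] k(1) by (simp add: G_P hdim_def)
      then show False using q k(2) by auto
    qed
  qed
  have mdr: "mdr f = d1"
    using mdr_eq[OF res hom, of 1] assms(4-6) d_eq by (simp add: shifts_def)
  have ct: "ct g f = d1 + d - 2" if g: "homogeneous d g" "smooth_surface g" for g
    unfolding ct_def
  proof (rule Greatest_equality)
    have Hg: "hilbert_fun g k + 4 * hdim (d - 1) k = hdim 0 k" if "k < 2 * (d - 1)" for k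
      using hilbert_fun_smooth[OF g d that] .
    show "\<forall>k\<le>d1 + d - 2. hilbert_fun f k = hilbert_fun g k"
    proof (intro allI impI)
      fix k assume "k \<le> d1 + d - 2"
      then have "k < d1 + (d - 1)" "k < d2 + (d - 1)" "k < d3 + (d - 1)" "k < d3 + d" "k < 2 * (d - 1)"
        using assms(4-6) d_eq by auto
      then show "hilbert_fun f k = hilbert_fun g k"
        using H[of k] Hg[of k] by (simp add: hdim_def)
    qed
    fix q assume q: "\<forall>k\<le>q. hilbert_fun f k = hilbert_fun g k"
    show "q \<le> d1 + d - 2"
    proof (rule ccontr)
      assume "\<not> q \<le> d1 + d - 2"
      \<comment> \<open>The degree of the first syzygy, seen in the grading of the Milnor algebra.\<close>
      define k where "k = d1 + (d - 1)"
      have k: "k \<le> q" "k < 2 * (d - 1)" "k < d3 + d"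
        using \<open>\<not> q \<le> d1 + d - 2\<close> assms(4-6) d_eq by (auto simp: k_def)
      have "hilbert_fun f k = hilbert_fun g k" using q k(1) by blast
      moreover have "hdim (d1 + (d - 1)) k = 1" by (simp add: hdim_def k_def)
      moreover have "hdim (d3 + d) k = 0" using k(3) by (simp add: hdim_def)
      ultimately show False using H[of k] Hg[OF k(2)] by simp
    qed
  qed
  have "int (ct g f) = int d1 + int d - 2" if "homogeneous d g" "smooth_surface g" for g
    using ct[OF that] assms(4-6) d_eq by simp
  moreover have "int (st f) = int d + int d3 - 3"
    using st assms(4-6) d_eq by simp
  ultimately show ?thesis
    using d_eq mdr hp unfolding P_def by blast
qed

end
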